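(* For positive integers $c,p$, with $H_{c,p}$ endowed with its cyclic ample framing, $$\mathrm{vol}\,\widehat{\mathcal{F}}(H_{c,p})=\#\mathcal{F}^{\circlearrowleft}_{\mathbf{0}}(H_{c,p})=\binom{(c+1)(p-1)}{p-1,\ldots,p-1}$$ (multinomial coefficient with $c+1$ entries $p-1$). In particular $\mathrm{vol}\,\widehat{\mathcal{F}}(H_{1,p})=\binom{2p-2}{p-1}$ and $\mathrm{vol}\,\widehat{\mathcal{F}}(H_{c,2})=(c+1)!$.
   Context: $H_{c,p}$ is the directed graph with vertex set $\{0,1,\dots,c+1\}\times\{1,\dots,p\}$ and edges $(a,b)\to(a+1,b)$ for $(a,b)\in\{0,\dots,c\}\times\{1,\dots,p\}$ and $(a,b)\to(a,b+1\bmod p)$ for $(a,b)\in\{1,\dots,c\}\times\{1,\dots,p\}$ ($c$ nested directed $p$-cycles). Its cyclic ample framing colours the cycle edges red and the other edges blue. A minimal cycle is a directed cycle with no proper subset a directed cycle. Netflow at $v$: outflow minus inflow. $\mathcal{F}^+(H)$: nonnegative flows with netflow 0 at internal vertices. Flow complex: $\widehat{\mathcal{F}}(H)=\{f\in\mathcal{F}^+(H):\sum_{\text{sources }s}\sum_{e\in\mathrm{out}(s)}f(e)+\sum_{C\text{ minimal cycle}}\min_{e\in C}f(e)=1\}$, normalized volume measured with respect to $\mathbb{Z}^E$ (unimodular simplices have volume 1). A cyclic integer flow is $f:E\to\mathbb{Z}_{\ge0}$ with exactly one zero edge $e_C$ on each minimal cycle $C$ and netflow 1 at every internal vertex except netflow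 0 at the tails of the $e_C$; $\mathcal{F}^{\circlearrowleft}_{\mathbf{0}}(H)$ denotes those with netflow 0 at every source. *)

theory Defs
  imports
    "HOL-Analysis.Analysis"
    "HOL-Library.Function_Algebras"
    "Graph_Theory.Arc_Walk"
begin

section \<open>Normalized volume in the space of real functions on a set\<close>

instantiation "fun" :: (type, real_vector) real_vector
begin

definition scaleR_fun :: "real \<Rightarrow> ('a \<Rightarrow> 'b) \<Rightarrow> 'a \<Rightarrow> 'b" where
  "scaleR_fun r f = (\<lambda>x. r *\<^sub>R f x)"

instance
  by standard (simp_all add: scaleR_fun_def fun_eq_iff scaleR_add_left scaleR_add_right)

end

definition integer_points :: "('e \<Rightarrow> real) set" where
  "integer_points = {f. \<forall>e. f e \<in> \<int>}"

definition affine_chart :: "nat \<Rightarrow> (nat \<Rightarrow> 'e \<Rightarrow> real) \<Rightarrow> (nat \<Rightarrow> real) \<Rightarrow> 'e \<Rightarrow> real" where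
  "affine_chart d v x = v 0 + (\<Sum>i<d. x i *\<^sub>R (v (Suc i) - v 0))"

text \<open>
  The points \<open>v 0, \<dots>, v d\<close> are the vertices of a unimodular simplex of the
  \<open>d\<close>-dimensional flat \<open>A\<close>: they are an affine basis of \<open>A\<close> over the reals and, at the
  same time, an affine basis of the lattice points of \<open>A\<close> over the integers.
\<close>

definition lattice_frame :: "nat \<Rightarrow> ('e \<Rightarrow> real) set \<Rightarrow> (nat \<Rightarrow> 'e \<Rightarrow> real) \<Rightarrow> bool" where
  "lattice_frame d A v \<longleftrightarrow>
     bij_betw (affine_chart d v) ({..<d} \<rightarrow>\<^sub>E UNIV) A \<and>
     affine_chart d v ` ({..<d} \<rightarrow>\<^sub>E \<int>) = A \<inter> integer_points"

definition lattice_flats :: "nat \<Rightarrow> ('e \<Rightarrow> real) set set" where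
  "lattice_flats d = {A. \<exists>v. lattice_frame d A v}"

text \<open>
  The \<open>d\<close>-dimensional volume of the part of \<open>X\<close> in \<open>A\<close>, scaled so that unimodular simplices
  of \<open>A\<close> have volume 1. Two frames of \<open>A\<close> differ by an integral affine transformation of
  determinant \<open>1\<close> or \<open>-1\<close>, so the choice of the frame is immaterial.
\<close>

definition flat_volume :: "nat \<Rightarrow> ('e \<Rightarrow> real) set \<Rightarrow> ('e \<Rightarrow> real) set \<Rightarrow> real" where
  "flat_volume d A X =
     (let v = (SOME v. lattice_frame d A v)
      in fact d * measure (\<Pi>\<^sub>M i\<in>{..<d}. lborel) {x \<in> {..<d} \<rightarrow>\<^sub>E UNIV. affine_chart d v x \<in> X})"

definition complex_dim :: "('e \<Rightarrow> real) set \<Rightarrow> nat" where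
  "complex_dim X =
     (GREATEST d. \<exists>S. finite S \<and> card S = Suc d \<and> \<not> affine_dependent S \<and> convex hull S \<subseteq> X)"

text \<open>
  Meant for the underlying set of a finite polytopal complex of dimension \<open>d\<close> each of whose
  \<open>d\<close>-dimensional cells spans a lattice flat. Such a set meets a \<open>d\<close>-dimensional flat in
  positive volume only if the flat is spanned by a cell, so the sum over all flats has
  finitely many nonzero terms, and it equals the sum of the normalized volumes of the
  \<open>d\<close>-dimensional cells.
\<close>

definition normalized_volume :: "('e \<Rightarrow> real) set \<Rightarrow> real" where
  "normalized_volume X =
     (\<Sum>\<^sub>\<infinity>A\<in>lattice_flats (complex_dim X). flat_volume (complex_dim X) A X)"


section \<open>Flows on directed graphs with cycles\<close>

definition sources :: "('v, 'e) pre_digraph \<Rightarrow> 'v set" where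
  "sources G = {v \<in> verts G. in_arcs G v = {}}"

definition sinks :: "('v, 'e) pre_digraph \<Rightarrow> 'v set" where
  "sinks G = {v \<in> verts G. out_arcs G v = {}}"

definition internal_verts :: "('v, 'e) pre_digraph \<Rightarrow> 'v set" where
  "internal_verts G = verts G - sources G - sinks G"

definition netflow :: "('v, 'e) pre_digraph \<Rightarrow> ('e \<Rightarrow> 'r::ab_group_add) \<Rightarrow> 'v \<Rightarrow> 'r" where
  "netflow G f v = (\<Sum>e\<in>out_arcs G v. f e) - (\<Sum>e\<in>in_arcs G v. f e)"

text \<open>Cycles are identified with their sets of arcs, which forgets the base point.\<close>

definition directed_cycles :: "('v, 'e) pre_digraph \<Rightarrow> 'e set set" where
  "directed_cycles G = {set q | q. pre_digraph.cycle G q}"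

definition minimal_cycles :: "('v, 'e) pre_digraph \<Rightarrow> 'e set set" where
  "minimal_cycles G = {C \<in> directed_cycles G. \<forall>D\<in>directed_cycles G. \<not> D \<subset> C}"

text \<open>Functions on the arcs are represented by functions vanishing outside \<open>arcs G\<close>.\<close>

definition nonneg_flows :: "('v, 'e) pre_digraph \<Rightarrow> ('e \<Rightarrow> real) set" where
  "nonneg_flows G =
     {f. (\<forall>e. e \<notin> arcs G \<longrightarrow> f e = 0) \<and> (\<forall>e\<in>arcs G. 0 \<le> f e) \<and>
         (\<forall>v\<in>internal_verts G. netflow G f v = 0)}"

definition flow_complex :: "('v, 'e) pre_digraph \<Rightarrow> ('e \<Rightarrow> real) set" where
  "flow_complex G =
     {f \<in> nonneg_flows G.
        (\<Sum>s\<in>sources G. \<Sum>e\<in>out_arcs G s. f e) + (\<Sum>C\<in>minimal_cycles G. Min (f ` C)) = 1}"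

definition zero_tails :: "('v, 'e) pre_digraph \<Rightarrow> ('e \<Rightarrow> int) \<Rightarrow> 'v set" where
  "zero_tails G f = {tail G e | e. \<exists>C\<in>minimal_cycles G. e \<in> C \<and> f e = 0}"

definition cyclic_integer_flows :: "('v, 'e) pre_digraph \<Rightarrow> ('e \<Rightarrow> int) set" where
  "cyclic_integer_flows G =
     {f. (\<forall>e. e \<notin> arcs G \<longrightarrow> f e = 0) \<and> (\<forall>e\<in>arcs G. 0 \<le> f e) \<and>
         (\<forall>C\<in>minimal_cycles G. \<exists>!e. e \<in> C \<and> f e = 0) \<and>
         (\<forall>v\<in>internal_verts G. netflow G f v = (if v \<in> zero_tails G f then 0 else 1))}"

definition cyclic_integer_flows_0 :: "('v, 'e) pre_digraph \<Rightarrow> ('e \<Rightarrow> int) set" where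
  "cyclic_integer_flows_0 G = {f \<in> cyclic_integer_flows G. \<forall>s\<in>sources G. netflow G f s = 0}"


section \<open>Nested directed cycles\<close>

text \<open>
  An arc is the pair of its tail and its head, since there are no parallel arcs; for
  \<open>p = 1\<close> the cycles are loops. The residue of \<open>b + 1\<close> modulo \<open>p\<close> is taken in \<open>{1..p}\<close>,
  so it is \<open>b mod p + 1\<close>. The cyclic ample framing of this graph, which colours the second
  family of arcs red and the first one blue, enters neither the flow complex nor the
  cyclic integer flows.
\<close>

definition nested_cycles :: "nat \<Rightarrow> nat \<Rightarrow> (nat \<times> nat, (nat \<times> nat) \<times> (nat \<times> nat)) pre_digraph" where
  "nested_cycles c p =
     \<lparr> verts = {0..c + 1} \<times> {1..p},
       arcs = {((a, b), (a + 1, b)) | a b. a \<in> {0..c} \<and> b \<in> {1..p}} \<union>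
              {((a, b), (a, b mod p + 1)) | a b. a \<in> {1..c} \<and> b \<in> {1..p}},
       tail = fst,
       head = snd \<rparr>"

definition multinomial :: "nat list \<Rightarrow> nat" where
  "multinomial ks = fact (sum_list ks) div (\<Prod>k\<leftarrow>ks. fact k)"

end

(*
  A flow on the nested cycles is determined by the flow on the blue arcs, whose total T on
  each layer is the same, together with the least value m_a of the flow on the a-th red cycle.
  Selecting on every cycle an arc where the minimum is attained cuts the flow complex into
  p^c polytopes, each lying in the lattice flat T + sum of selected values = 1. In the
  unimodular coordinates given by the m_a and all but one of the blue values of each layer
  these polytopes tile, up to null sets, a single region that fibres over the simplex
  {m >= 0, sum m <= 1} with fibre the product of c + 1 simplices of dimension p - 1 and size
  T = 1 - sum m. With N = (c + 1)(p - 1) its normalized volume is N! / (p - 1)!^(c + 1).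

  On the counting side, in each layer the red part of a cyclic integer flow is determined by
  the blue part through the cycle lemma, so cyclic flows vanishing at the sources correspond
  to sequences of compositions of a(p - 1), for a = 1, ..., c, into p nonnegative parts, and
  the product of their numbers is again the multinomial coefficient.
*)
theory Submission
  imports Defs
begin

section \<open>Lattice frames and Lebesgue measure\<close>

text \<open>\<open>flat_volume\<close> picks its frame by \<open>SOME\<close>, so nothing can be
  computed before all frames of a flat are known to give the same measure. Transition maps are
  treated as affine bijections that respect integrality; that they preserve Lebesgue measure is
  obtained by counting lattice translates instead of from a determinant.
  \<open>normalized_volume\<close> ranges over all lattice flats of the right dimension; a flat
  other than those of the selections meets each of these in a null set.

  The tiling rests on one feature of the coordinates: the blue flow and the partial sums
  \<open>excess\<close> of its imbalance across a layer do not depend on the selection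
  \<open>\<beta>\<close>. Among the conditions for a cell, only the demand that
  \<open>\<beta> a\<close> minimize \<open>excess y a\<close> involves the selection. Hence every
  point of the region lies in some cell, and two cells overlap only where minimizers tie. On the
  counting side the same partial sums, shifted by the prescribed netflow 1, determine the red flow
  through their last minimizer.\<close>

definition affine_form :: "nat \<Rightarrow> ((nat \<Rightarrow> real) \<Rightarrow> real) \<Rightarrow> bool" where
  "affine_form d h \<longleftrightarrow> (\<exists>k c. \<forall>y. h y = k + (\<Sum>i<d. c i * y i))"

lemma affine_formI: "(\<And>y. h y = k + (\<Sum>i<d. c i * y i)) \<Longrightarrow> affine_form d h"
  unfolding affine_form_def by blast

lemma affine_form_const [simp, intro]: "affine_form d (\<lambda>_. k)"
  by (rule affine_formI[where k = k and c = "\<lambda>_. 0"]) simp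

lemma affine_form_coord [intro]: "i < d \<Longrightarrow> affine_form d (\<lambda>y. y i)"
proof (rule affine_formI[where k = 0 and c = "\<lambda>j. if j = i then 1 else 0"])
  show "y i = 0 + (\<Sum>j<d. (if j = i then 1 else 0) * y j)" if "i < d" for y :: "nat \<Rightarrow> real"
    using that by (simp add: mult_delta_left)
qed

lemma affine_form_add [intro]:
  assumes "affine_form d g" "affine_form d h" shows "affine_form d (\<lambda>y. g y + h y)"
proof -
  obtain k c k' c' where g: "\<And>y. g y = k + (\<Sum>i<d. c i * y i)"
    and h: "\<And>y. h y = k' + (\<Sum>i<d. c' i * y i)"
    using assms unfolding affine_form_def by blast
  show ?thesis
    by (rule affine_formI[where k = "k + k'" and c = "\<lambda>i. c i + c' i"])
      (simp add: g h sum.distrib algebra_simps)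
qed

lemma affine_form_cmult [intro]:
  assumes "affine_form d g" shows "affine_form d (\<lambda>y. r * g y)"
proof -
  obtain k c where g: "\<And>y. g y = k + (\<Sum>i<d. c i * y i)"
    using assms unfolding affine_form_def by blast
  show ?thesis
    by (rule affine_formI[where k = "r * k" and c = "\<lambda>i. r * c i"])
      (simp add: g sum_distrib_left algebra_simps)
qed

lemma affine_form_diff [intro]:
  assumes "affine_form d g" "affine_form d h" shows "affine_form d (\<lambda>y. g y - h y)"
  using affine_form_add[OF assms(1) affine_form_cmult[OF assms(2), of "-1"]] by simp

lemma affine_form_sum [intro]:
  "(\<And>a. a \<in> A \<Longrightarrow> affine_form d (g a)) \<Longrightarrow> affine_form d (\<lambda>y. \<Sum>a\<in>A. g a y)"
  by (induction A rule: infinite_finite_induct) auto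

lemma affine_form_measurable:
  assumes "affine_form d h" shows "h \<in> borel_measurable (Pi\<^sub>M {..<d} (\<lambda>_. lborel))"
proof -
  obtain k c where h: "h = (\<lambda>y. k + (\<Sum>i<d. c i * y i))"
    using assms unfolding affine_form_def by blast
  have "(\<lambda>y. y i) \<in> borel_measurable (Pi\<^sub>M {..<d} (\<lambda>_. lborel))" if "i < d" for i
    using measurable_component_singleton[of i "{..<d}" "\<lambda>_. lborel"] that by simp
  then show ?thesis unfolding h by (intro borel_measurable_add borel_measurable_sum borel_measurable_times) auto
qed

lemma affine_form_translate:
  assumes "affine_form d h"
  shows "h (\<lambda>i\<in>{..<d}. x i + y i) = h x + h y - h (\<lambda>i\<in>{..<d}. 0)"
proof -
  obtain k c where h: "\<And>y. h y = k + (\<Sum>i<d. c i * y i)"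
    using assms unfolding affine_form_def by blast
  show ?thesis by (simp add: h algebra_simps sum.distrib)
qed

text \<open>Along a coordinate with nonzero coefficient every line meets the zero set in a single
  point, so Tonelli gives measure 0. If all coefficients vanish, \<open>h\<close> is a nonzero
  constant and the set is empty.\<close>

lemma affine_form_level_null:
  assumes h: "affine_form d h" and ne: "\<exists>y\<in>{..<d} \<rightarrow>\<^sub>E UNIV. h y \<noteq> 0"
  shows "{y \<in> {..<d} \<rightarrow>\<^sub>E UNIV. h y = 0} \<in> null_sets (Pi\<^sub>M {..<d} (\<lambda>_. lborel))"
proof -
  interpret product_sigma_finite "\<lambda>_::nat. lborel :: real measure" by standard
  obtain k c where h': "\<And>y. h y = k + (\<Sum>i<d. c i * y i)"
    using h unfolding affine_form_def by blast
  let ?M = "\<lambda>I. Pi\<^sub>M I (\<lambda>_. lborel :: real measure)" let ?S = "{y \<in> {..<d} \<rightarrow>\<^sub>E UNIV. h y = 0}"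
  have [measurable]: "h \<in> borel_measurable (?M {..<d})" by (rule affine_form_measurable[OF h])
  have "?S = {y \<in> space (?M {..<d}). h y = 0}" by (simp add: space_PiM)
  also have "\<dots> \<in> sets (?M {..<d})" by measurable
  finally have S: "?S \<in> sets (?M {..<d})" .
  show ?thesis
  proof (cases "\<exists>i<d. c i \<noteq> 0")
    case False
    then have "?S = {}" using ne by (auto simp: h')
    show ?thesis unfolding \<open>?S = {}\<close> by simp
  next
    case True
    then obtain i where i: "i < d" "c i \<noteq> 0" by blast
    define J where "J = {..<d} - {i}"
    have J: "{..<d} = insert i J" "finite J" "i \<notin> J" using i by (auto simp: J_def)
    have "emeasure (?M {..<d}) ?S = (\<integral>\<^sup>+ y. indicator ?S y \<partial>?M (insert i J))"
      using S J(1) by simp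
    also have "\<dots> = (\<integral>\<^sup>+ x. (\<integral>\<^sup>+ t. indicator ?S (x(i := t)) \<partial>lborel) \<partial>?M J)"
      using J S by (intro product_nn_integral_insert) auto
    also have "\<dots> = (\<integral>\<^sup>+ x. 0 \<partial>?M J)"
    proof (rule nn_integral_cong)
      fix x
      let ?r = "- (k + (\<Sum>j\<in>J. c j * x j)) / c i"
      have *: "h (x(i := t)) = k + c i * t + (\<Sum>j\<in>J. c j * x j)" for t
        using J by (simp add: h' sum.insert) (intro sum.cong, auto)
      have "t = ?r" if "h (x(i := t)) = 0" for t
        using that i unfolding * by (simp add: field_simps)
      then have "indicator ?S (x(i := t)) \<le> (indicator {?r} t :: ennreal)" for t
        by (auto simp: indicator_def)
      then have "(\<integral>\<^sup>+ t. indicator ?S (x(i := t)) \<partial>lborel) \<le> (\<integral>\<^sup>+ t. indicator {?r} t \<partial>(lborel::real measure))"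
        by (intro nn_integral_mono) blast
      then show "(\<integral>\<^sup>+ t. indicator ?S (x(i := t)) \<partial>lborel) = 0" by simp
    qed
    finally have "emeasure (?M {..<d}) ?S = 0" by (simp only: nn_integral_const mult_zero_left)
    then show ?thesis using S by (rule null_setsI)
  qed
qed

text \<open>The sign is a parameter because both motions are needed: translations for unfolding over
  the lattice, and a reflection for the convolution argument. The equality of measures is checked on
  boxes, one coordinate at a time.\<close>

lemma nn_integral_PiM_lborel_isometry:
  fixes t :: "nat \<Rightarrow> real"
  assumes I: "finite I" and s: "s = 1 \<or> s = (-1::real)"
    and f: "f \<in> borel_measurable (Pi\<^sub>M I (\<lambda>_. lborel))"
  shows "(\<integral>\<^sup>+ x. f (\<lambda>i\<in>I. t i + s * x i) \<partial>Pi\<^sub>M I (\<lambda>_. lborel)) = (\<integral>\<^sup>+ x. f x \<partial>Pi\<^sub>M I (\<lambda>_. lborel))"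
proof -
  interpret product_sigma_finite "\<lambda>_::nat. lborel :: real measure" by standard
  let ?M = "Pi\<^sub>M I (\<lambda>_. lborel :: real measure)" and ?h = "\<lambda>x. \<lambda>i\<in>I. t i + s * x i"
  have h: "?h \<in> measurable ?M ?M"
  proof (rule measurable_restrict)
    fix i assume "i \<in> I"
    then have [measurable]: "(\<lambda>x. x i) \<in> borel_measurable ?M"
      using measurable_component_singleton[of i I "\<lambda>_. lborel :: real measure"] by simp
    show "(\<lambda>x. t i + s * x i) \<in> measurable ?M lborel" by simp
  qed
  have line: "distr lborel borel (\<lambda>x. t i + s * x) = lborel" for i
    using lborel_real_affine[of s "t i"] s by (auto simp: density_1)
  have "distr ?M ?M ?h = ?M"
  proof (rule PiM_eqI[OF I])
    fix A :: "nat \<Rightarrow> real set" assume A: "\<And>i. i \<in> I \<Longrightarrow> A i \<in> sets lborel"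
    have "emeasure (distr ?M ?M ?h) (Pi\<^sub>E I A) = emeasure ?M (?h -` Pi\<^sub>E I A \<inter> space ?M)"
      using A I by (intro emeasure_distr h sets_PiM_I_finite) auto
    also have "?h -` Pi\<^sub>E I A \<inter> space ?M = Pi\<^sub>E I (\<lambda>i. (\<lambda>x. t i + s * x) -` A i)"
      by (auto simp: space_PiM PiE_iff)
    also have "emeasure ?M \<dots> = (\<Prod>i\<in>I. emeasure lborel ((\<lambda>x. t i + s * x) -` A i))"
    proof (rule emeasure_PiM[OF I])
      fix i assume "i \<in> I"
      then have "(\<lambda>x. t i + s * x) -` A i \<inter> space borel \<in> sets borel"
        using A[of i] by (intro measurable_sets[where A = borel]) auto
      then show "(\<lambda>x. t i + s * x) -` A i \<in> sets lborel" by simp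
    qed
    also have "\<dots> = (\<Prod>i\<in>I. emeasure lborel (A i))"
    proof (rule prod.cong[OF refl])
      fix i assume "i \<in> I"
      then have "emeasure (distr lborel borel (\<lambda>x. t i + s * x)) (A i)
          = emeasure lborel ((\<lambda>x. t i + s * x) -` A i)"
        using A[of i] by (subst emeasure_distr) auto
      then show "emeasure lborel ((\<lambda>x. t i + s * x) -` A i) = emeasure lborel (A i)"
        by (simp add: line)
    qed
    finally show "emeasure (distr ?M ?M ?h) (Pi\<^sub>E I A) = (\<Prod>i\<in>I. emeasure lborel (A i))" .
  qed simp
  then show ?thesis using nn_integral_distr[OF h, of f] f by simp
qed

text \<open>Abstract form of the change of coordinates between two lattice frames of one flat. The
  assumption \<open>integral\<close> takes the place of an integer matrix of determinant 1 or
  -1.\<close>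

locale unimodular_affine =
  fixes d :: nat and T :: "(nat \<Rightarrow> real) \<Rightarrow> nat \<Rightarrow> real"
  assumes bij: "bij_betw T ({..<d} \<rightarrow>\<^sub>E UNIV) ({..<d} \<rightarrow>\<^sub>E UNIV)"
    and form: "i < d \<Longrightarrow> affine_form d (\<lambda>y. T y i)"
    and integral: "y \<in> {..<d} \<rightarrow>\<^sub>E UNIV \<Longrightarrow> T y \<in> {..<d} \<rightarrow>\<^sub>E \<int> \<longleftrightarrow> y \<in> {..<d} \<rightarrow>\<^sub>E \<int>"
begin

section \<open>Invariance of Lebesgue measure under unimodular affine maps\<close>

abbreviation E where "E \<equiv> {..<d} \<rightarrow>\<^sub>E (UNIV :: real set)"
abbreviation L where "L \<equiv> {..<d} \<rightarrow>\<^sub>E (\<int> :: real set)"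
abbreviation M where "M \<equiv> Pi\<^sub>M {..<d} (\<lambda>_. lborel :: real measure)"
abbreviation Q where "Q \<equiv> {..<d} \<rightarrow>\<^sub>E {0..<1 :: real}"

abbreviation plus_E where "plus_E x y \<equiv> (\<lambda>i\<in>{..<d}. x i + y i :: real)"

lemma T_in_E: "y \<in> E \<Longrightarrow> T y \<in> E"
  using bij by (auto simp: bij_betw_def)

lemma T_translate: "T (plus_E x y) i = T x i + T y i - T (\<lambda>i\<in>{..<d}. 0) i" if "i < d"
  using affine_form_translate[OF form[OF that]] .

lemma T_surj: "y \<in> E \<Longrightarrow> \<exists>x\<in>E. T x = y"
  using bij unfolding bij_betw_def by (metis (no_types, lifting) imageE)

lemma T_inj: "x \<in> E \<Longrightarrow> y \<in> E \<Longrightarrow> T x = T y \<Longrightarrow> x = y"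
  using bij by (auto simp: bij_betw_def inj_on_def)

lemma E_eqI: "x \<in> E \<Longrightarrow> y \<in> E \<Longrightarrow> (\<And>i. i < d \<Longrightarrow> x i = y i) \<Longrightarrow> x = y"
  by (rule PiE_ext) auto

text \<open>Translations lift through \<open>T\<close> because it is affine and onto. A lattice
  translation lifts to a lattice one: \<open>T\<close> maps the origin to a lattice point, so
  \<open>T y'\<close> is a lattice point, and \<open>integral\<close> pulls this back to
  \<open>y'\<close>.\<close>

lemma T_shift:
  assumes "y \<in> E"
  shows "\<exists>y'\<in>E. (\<forall>x\<in>E. T (plus_E x y') = plus_E (T x) y) \<and> (y \<in> L \<longrightarrow> y' \<in> L)"
proof -
  let ?o = "\<lambda>i\<in>{..<d}. 0::real"
  obtain y' where y': "y' \<in> E" "T y' = plus_E (T ?o) y"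
    using T_surj[of "plus_E (T ?o) y"] by auto
  have "T (plus_E x y') = plus_E (T x) y" if "x \<in> E" for x
    by (rule E_eqI) (simp_all add: T_translate y'(2) T_in_E)
  moreover have "y' \<in> L" if "y \<in> L"
  proof -
    have "T ?o \<in> L" by (subst integral) auto
    then have "T y' \<in> L" using that unfolding y'(2) by (auto simp: PiE_iff)
    then show ?thesis using integral[OF y'(1)] by simp
  qed
  ultimately show ?thesis using y'(1) by blast
qed

lemma measurable_T [measurable]: "T \<in> measurable M M"
proof (rule measurable_PiM_single')
  show "(\<lambda>y. T y i) \<in> measurable M lborel" if "i \<in> {..<d}" for i
    using affine_form_measurable[OF form] that by simp
  show "T \<in> space M \<rightarrow> {..<d} \<rightarrow>\<^sub>E space lborel"
    using T_in_E by (auto simp: space_PiM)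
qed

lemma measurable_coord [measurable]: "i < d \<Longrightarrow> (\<lambda>x. x i) \<in> borel_measurable M"
  using measurable_component_singleton[of i "{..<d}" "\<lambda>_. lborel :: real measure"] by simp

lemma measurable_plus_E: "(\<lambda>x. plus_E x y) \<in> measurable M M"
  by (intro measurable_restrict) simp

lemma Q_sets [measurable]: "Q \<in> sets M"
  by (intro sets_PiM_I_finite) auto

lemma emeasure_Q: "emeasure M Q = 1"
proof -
  interpret product_sigma_finite "\<lambda>_::nat. lborel :: real measure" by standard
  show ?thesis by (subst emeasure_PiM) auto
qed

lemma countable_L: "countable L"
  by (intro countable_PiE) (auto simp: Ints_def)

lemma translate_into_Q:
  assumes x: "x \<in> E"
  shows "\<exists>!k. k \<in> L \<and> plus_E x k \<in> Q"
proof (rule ex1I)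
  show "(\<lambda>i\<in>{..<d}. - of_int \<lfloor>x i\<rfloor>) \<in> L \<and> plus_E x (\<lambda>i\<in>{..<d}. - of_int \<lfloor>x i\<rfloor>) \<in> Q"
    by (auto simp: PiE_iff) linarith
next
  fix k assume k: "k \<in> L \<and> plus_E x k \<in> Q"
  show "k = (\<lambda>i\<in>{..<d}. - of_int \<lfloor>x i\<rfloor>)"
  proof (rule E_eqI)
    fix i assume i: "i < d"
    then have "k i \<in> \<int>" "0 \<le> x i + k i" "x i + k i < 1" using k by (auto simp: PiE_iff)
    then obtain z where z: "k i = of_int z" by (auto elim: Ints_cases)
    have "\<lfloor>x i\<rfloor> = - z" using \<open>0 \<le> x i + k i\<close> \<open>x i + k i < 1\<close> unfolding z by (intro floor_unique) auto
    then show "k i = (\<lambda>i\<in>{..<d}. - of_int \<lfloor>x i\<rfloor>) i" using i z by simp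
  qed (use k in auto)
qed

lemma nn_integral_count_indicator:
  assumes "\<exists>!k. k \<in> L \<and> P k"
  shows "(\<integral>\<^sup>+ k. indicator {k. P k} k \<partial>count_space L) = 1"
proof -
  obtain k0 where k0: "k0 \<in> L" "\<And>k. k \<in> L \<Longrightarrow> P k \<longleftrightarrow> k = k0" using assms by metis
  have "(\<integral>\<^sup>+ k. indicator {k. P k} k \<partial>count_space L) = (\<integral>\<^sup>+ k. indicator {k0} k \<partial>count_space L)"
    using k0 by (intro nn_integral_cong) (auto simp: indicator_def)
  also have "\<dots> = 1" using k0 by (subst nn_integral_indicator) auto
  finally show ?thesis .
qed

text \<open>Unfolding over the lattice: the factor 1 is written as the number of \<open>k\<close>
  with \<open>plus_E x k\<close> in \<open>Q\<close>, sum and integral are exchanged,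
  \<open>x\<close> is translated by \<open>- k\<close>, and the sum is reindexed by
  \<open>neg\<close>.\<close>

lemma nn_integral_periodization:
  assumes [measurable]: "f \<in> borel_measurable M"
  shows "(\<integral>\<^sup>+ x. f x \<partial>M) = (\<integral>\<^sup>+ x. indicator Q x * (\<integral>\<^sup>+ k. f (plus_E x k) \<partial>count_space L) \<partial>M)"
proof -
  note measurable_plus_E [measurable]
  define neg where "neg k = (\<lambda>i\<in>{..<d}. - k i :: real)" for k
  have neg_E: "plus_E (plus_E x k) (neg k) = x" if "x \<in> E" for x k
    by (rule E_eqI) (use that in \<open>auto simp: neg_def\<close>)
  have "(\<integral>\<^sup>+ x. f x \<partial>M) = (\<integral>\<^sup>+ x. (\<integral>\<^sup>+ k. indicator Q (plus_E x k) * f x \<partial>count_space L) \<partial>M)"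
  proof (rule nn_integral_cong)
    fix x assume "x \<in> space M"
    then have x: "x \<in> E" by (simp add: space_PiM)
    have "(\<integral>\<^sup>+ k. indicator Q (plus_E x k) * f x \<partial>count_space L)
        = (\<integral>\<^sup>+ k. indicator {k. plus_E x k \<in> Q} k * f x \<partial>count_space L)"
      by (intro nn_integral_cong) (auto simp: indicator_def)
    also have "\<dots> = f x"
      using nn_integral_count_indicator[OF translate_into_Q[OF x]]
      by (subst nn_integral_multc) (auto simp del: nn_integral_indicator)
    finally show "f x = (\<integral>\<^sup>+ k. indicator Q (plus_E x k) * f x \<partial>count_space L)" by simp
  qed
  also have "\<dots> = (\<integral>\<^sup>+ k. (\<integral>\<^sup>+ x. indicator Q (plus_E x k) * f x \<partial>M) \<partial>count_space L)"
    by (intro nn_integral_count_space_nn_integral countable_L) measurable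
  also have "\<dots> = (\<integral>\<^sup>+ k. (\<integral>\<^sup>+ x. indicator Q x * f (plus_E x (neg k)) \<partial>M) \<partial>count_space L)"
  proof (rule nn_integral_cong)
    fix k
    let ?g = "\<lambda>x. indicator Q x * f (plus_E x (neg k))"
    have "(\<integral>\<^sup>+ x. indicator Q (plus_E x k) * f x \<partial>M) = (\<integral>\<^sup>+ x. ?g (\<lambda>i\<in>{..<d}. k i + 1 * x i) \<partial>M)"
    proof (rule nn_integral_cong)
      fix x assume "x \<in> space M"
      then have "x \<in> E" by (simp add: space_PiM)
      moreover have "(\<lambda>i\<in>{..<d}. k i + 1 * x i) = plus_E x k" by (auto simp: add.commute)
      ultimately show "indicator Q (plus_E x k) * f x = ?g (\<lambda>i\<in>{..<d}. k i + 1 * x i)"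
        by (simp only: neg_E)
    qed
    also have "\<dots> = (\<integral>\<^sup>+ x. ?g x \<partial>M)" by (intro nn_integral_PiM_lborel_isometry) auto
    finally show "(\<integral>\<^sup>+ x. indicator Q (plus_E x k) * f x \<partial>M) = (\<integral>\<^sup>+ x. ?g x \<partial>M)" .
  qed
  also have "\<dots> = (\<integral>\<^sup>+ k. (\<integral>\<^sup>+ x. indicator Q x * f (plus_E x k) \<partial>M) \<partial>count_space L)"
  proof -
    have "neg k \<in> L" if "k \<in> L" for k using that by (simp add: PiE_iff neg_def)
    moreover have "neg (neg k) = k" if "k \<in> L" for k
      by (rule E_eqI) (use that in \<open>simp_all add: PiE_iff neg_def\<close>)
    ultimately have "bij_betw neg L L" by (intro bij_betwI[where g = neg]) auto
    then show ?thesis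
      by (rule nn_integral_bij_count_space)
  qed
  also have "\<dots> = (\<integral>\<^sup>+ x. (\<integral>\<^sup>+ k. indicator Q x * f (plus_E x k) \<partial>count_space L) \<partial>M)"
    by (intro nn_integral_count_space_nn_integral[symmetric] countable_L) measurable
  also have "\<dots> = (\<integral>\<^sup>+ x. indicator Q x * (\<integral>\<^sup>+ k. f (plus_E x k) \<partial>count_space L) \<partial>M)"
    by (intro nn_integral_cong) (simp add: nn_integral_cmult)
  finally show ?thesis .
qed

text \<open>Both \<open>Q\<close> and its preimage are fundamental domains of the lattice \<open>L\<close>.\<close>

lemma nn_integral_preimage_Q: "(\<integral>\<^sup>+ x. indicator Q (T x) \<partial>M) = 1"
proof -
  have "(\<integral>\<^sup>+ x. indicator Q (T x) \<partial>M)
      = (\<integral>\<^sup>+ x. indicator Q x * (\<integral>\<^sup>+ k. indicator Q (T (plus_E x k)) \<partial>count_space L) \<partial>M)"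
    by (rule nn_integral_periodization) measurable
  also have "\<dots> = (\<integral>\<^sup>+ x. indicator Q x \<partial>M)"
  proof (rule nn_integral_cong)
    fix x assume "x \<in> space M"
    then have x: "x \<in> E" by (simp add: space_PiM)
    have "\<exists>!k. k \<in> L \<and> T (plus_E x k) \<in> Q"
    proof -
      obtain l where l: "l \<in> L" "plus_E (T x) l \<in> Q" using translate_into_Q[OF T_in_E[OF x]] by blast
      have lE: "l \<in> E" using l by auto
      obtain k where k: "k \<in> E" "T (plus_E x k) = plus_E (T x) l" "k \<in> L"
        using T_shift[OF lE] x l(1) by blast
      show ?thesis
      proof (rule ex1I)
        show "k \<in> L \<and> T (plus_E x k) \<in> Q" using k l by simp
      next
        fix k' assume k': "k' \<in> L \<and> T (plus_E x k') \<in> Q"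
        then have k'E: "k' \<in> E" by auto
        \<comment> \<open>Uniqueness: the two image points differ by an integer vector and both lie
          in the half-open cube, so the difference is 0.\<close>
        have "T k' i = T k i" if i: "i < d" for i
        proof -
          have "T k' \<in> L" "T k \<in> L" using k k' integral[OF k'E] integral[OF k(1)] by auto
          then have "T k' i - T k i \<in> \<int>" using i by (auto simp: PiE_iff)
          then obtain z where z: "T k' i - T k i = of_int z" by (auto elim: Ints_cases)
          have "T (plus_E x k') i - T (plus_E x k) i = of_int z" using z by (simp add: T_translate i)
          moreover have "T (plus_E x k') i \<in> {0..<1}" "T (plus_E x k) i \<in> {0..<1}"
            using k' k(2) l(2) i by (auto simp: PiE_iff)
          ultimately have "z = 0" by auto
          then show ?thesis using z by simp
        qed
        then have "T k' = T k" using E_eqI T_in_E k(1) k'E by blast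
        then show "k' = k" using T_inj k(1) k'E by blast
      qed
    qed
    from nn_integral_count_indicator[OF this]
    have "(\<integral>\<^sup>+ k. indicator Q (T (plus_E x k)) \<partial>count_space L) = 1"
      by (simp add: indicator_def)
    then show "indicator Q x * (\<integral>\<^sup>+ k. indicator Q (T (plus_E x k)) \<partial>count_space L) = indicator Q x"
      by simp
  qed
  also have "\<dots> = 1" using emeasure_Q by simp
  finally show ?thesis .
qed

text \<open>
  The pushforward along \<open>T\<close> is invariant under all translations, because \<open>T\<close> is surjective.
  Such a measure is a multiple of Lebesgue measure, and the constant is read off at \<open>Q\<close>.
\<close>

lemma nn_integral_preserved:
  assumes g [measurable]: "g \<in> borel_measurable M"
  shows "(\<integral>\<^sup>+ x. g (T x) \<partial>M) = (\<integral>\<^sup>+ x. g x \<partial>M)"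
proof -
  interpret product_sigma_finite "\<lambda>_::nat. lborel :: real measure" by standard
  interpret sigma_finite_measure M by (rule sigma_finite) simp
  interpret MM: pair_sigma_finite M M by standard
  define q :: "(nat \<Rightarrow> real) \<Rightarrow> ennreal" where "q = indicator Q"
  have q [measurable]: "q \<in> borel_measurable M" unfolding q_def by simp
  have qQ: "(\<integral>\<^sup>+ x. q x \<partial>M) = 1" using emeasure_Q unfolding q_def by simp
  have plus [measurable]: "(\<lambda>w. plus_E (f w) (h w)) \<in> measurable (M \<Otimes>\<^sub>M M) M"
    if [measurable]: "f \<in> measurable (M \<Otimes>\<^sub>M M) M" "h \<in> measurable (M \<Otimes>\<^sub>M M) M" for f h
    by (intro measurable_restrict) simp
  have minus [measurable]: "(\<lambda>w. \<lambda>i\<in>{..<d}. f w i + -1 * h w i) \<in> measurable (M \<Otimes>\<^sub>M M) M"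
    if [measurable]: "f \<in> measurable (M \<Otimes>\<^sub>M M) M" "h \<in> measurable (M \<Otimes>\<^sub>M M) M" for f h
    by (intro measurable_restrict) simp
  note measurable_plus_E [measurable]
  have shift: "(\<integral>\<^sup>+ x. f (plus_E x y) \<partial>M) = (\<integral>\<^sup>+ x. f x \<partial>M)" if "f \<in> borel_measurable M" for f y
  proof -
    have "(\<integral>\<^sup>+ x. f (plus_E x y) \<partial>M) = (\<integral>\<^sup>+ x. f (\<lambda>i\<in>{..<d}. y i + 1 * x i) \<partial>M)"
      by (simp add: add.commute)
    also have "\<dots> = (\<integral>\<^sup>+ x. f x \<partial>M)" using that by (intro nn_integral_PiM_lborel_isometry) auto
    finally show ?thesis .
  qed
  have "(\<integral>\<^sup>+ x. g (T x) \<partial>M) = (\<integral>\<^sup>+ x. g (T x) * (\<integral>\<^sup>+ y. q y \<partial>M) \<partial>M)" by (simp add: qQ)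
  \<comment> \<open>The factor \<open>q\<close> of integral 1 is evaluated at \<open>T x - y\<close>
    in place of \<open>y\<close>. This makes the integrand a convolution, in which the roles of
    \<open>g\<close> and \<open>q\<close> can be exchanged.\<close>
  also have "\<dots> = (\<integral>\<^sup>+ x. g (T x) * (\<integral>\<^sup>+ y. q (\<lambda>i\<in>{..<d}. T x i + -1 * y i) \<partial>M) \<partial>M)"
    by (subst nn_integral_PiM_lborel_isometry[where s = "-1"]) auto
  also have "\<dots> = (\<integral>\<^sup>+ x. (\<integral>\<^sup>+ y. g (T x) * q (\<lambda>i\<in>{..<d}. T x i + -1 * y i) \<partial>M) \<partial>M)"
  proof (rule nn_integral_cong)
    fix x
    have "(\<lambda>y. \<lambda>i\<in>{..<d}. T x i + -1 * y i) \<in> measurable M M" by (intro measurable_restrict) simp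
    then show "g (T x) * (\<integral>\<^sup>+ y. q (\<lambda>i\<in>{..<d}. T x i + -1 * y i) \<partial>M)
        = (\<integral>\<^sup>+ y. g (T x) * q (\<lambda>i\<in>{..<d}. T x i + -1 * y i) \<partial>M)"
      by (subst nn_integral_cmult) (auto intro: measurable_compose[OF _ q])
  qed
  also have "\<dots> = (\<integral>\<^sup>+ y. (\<integral>\<^sup>+ x. g (T x) * q (\<lambda>i\<in>{..<d}. T x i + -1 * y i) \<partial>M) \<partial>M)"
    by (rule MM.Fubini') measurable
  \<comment> \<open>For fixed \<open>y\<close>, shifting \<open>x\<close> by the lift
    \<open>y'\<close> of \<open>y\<close> turns \<open>T x\<close> into \<open>T x + y\<close>; then
    \<open>q\<close> no longer sees \<open>y\<close>.\<close>
  also have "\<dots> = (\<integral>\<^sup>+ y. (\<integral>\<^sup>+ x. g (plus_E (T x) y) * q (T x) \<partial>M) \<partial>M)"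
  proof (rule nn_integral_cong)
    fix y assume "y \<in> space M"
    then have y: "y \<in> E" by (simp add: space_PiM)
    obtain y' where y': "\<forall>x\<in>E. T (plus_E x y') = plus_E (T x) y"
      using T_shift[OF y] by (elim bexE conjE)
    let ?f = "\<lambda>x. g (T x) * q (\<lambda>i\<in>{..<d}. T x i + -1 * y i)"
    have "(\<lambda>x. \<lambda>i\<in>{..<d}. T x i + -1 * y i) \<in> measurable M M"
    proof (intro measurable_restrict)
      fix i assume "i \<in> {..<d}"
      then have [measurable]: "(\<lambda>x. T x i) \<in> borel_measurable M" using affine_form_measurable[OF form] by simp
      show "(\<lambda>x. T x i + -1 * y i) \<in> measurable M lborel" by simp
    qed
    then have "?f \<in> borel_measurable M" by (intro borel_measurable_times_ennreal measurable_compose[OF _ q]) auto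
    from shift[OF this, of y'] have "(\<integral>\<^sup>+ x. ?f x \<partial>M) = (\<integral>\<^sup>+ x. ?f (plus_E x y') \<partial>M)" by simp
    also have "\<dots> = (\<integral>\<^sup>+ x. g (plus_E (T x) y) * q (T x) \<partial>M)"
    proof (rule nn_integral_cong)
      fix x assume "x \<in> space M"
      then have x: "x \<in> E" by (simp add: space_PiM)
      have "(\<lambda>i\<in>{..<d}. plus_E (T x) y i + -1 * y i) = T x"
        by (rule E_eqI) (auto intro!: T_in_E x)
      then show "?f (plus_E x y') = g (plus_E (T x) y) * q (T x)" using bspec[OF y' x] by simp
    qed
    finally show "(\<integral>\<^sup>+ x. ?f x \<partial>M) = (\<integral>\<^sup>+ x. g (plus_E (T x) y) * q (T x) \<partial>M)" .
  qed
  \<comment> \<open>After the second exchange the inner integral is that of \<open>g\<close>, by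
    translation invariance, and the factor left over is the measure of the preimage of
    \<open>Q\<close>.\<close>
  also have "\<dots> = (\<integral>\<^sup>+ x. (\<integral>\<^sup>+ y. g (plus_E (T x) y) * q (T x) \<partial>M) \<partial>M)"
    by (rule MM.Fubini') measurable
  also have "\<dots> = (\<integral>\<^sup>+ x. (\<integral>\<^sup>+ y. g y \<partial>M) * q (T x) \<partial>M)"
  proof (rule nn_integral_cong)
    fix x
    have "(\<lambda>y. plus_E (T x) y) \<in> measurable M M" by (intro measurable_restrict) simp
    then have "(\<lambda>y. g (plus_E (T x) y)) \<in> borel_measurable M" by (rule measurable_compose[OF _ g])
    then have "(\<integral>\<^sup>+ y. g (plus_E (T x) y) * q (T x) \<partial>M) = (\<integral>\<^sup>+ y. g (plus_E (T x) y) \<partial>M) * q (T x)"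
      by (rule nn_integral_multc)
    also have "(\<integral>\<^sup>+ y. g (plus_E (T x) y) \<partial>M) = (\<integral>\<^sup>+ y. g y \<partial>M)"
      using shift[OF g, of "T x"] by (simp add: add.commute)
    finally show "(\<integral>\<^sup>+ y. g (plus_E (T x) y) * q (T x) \<partial>M) = (\<integral>\<^sup>+ y. g y \<partial>M) * q (T x)" .
  qed
  also have "\<dots> = (\<integral>\<^sup>+ y. g y \<partial>M) * (\<integral>\<^sup>+ x. q (T x) \<partial>M)"
    by (rule nn_integral_cmult) measurable
  also have "(\<integral>\<^sup>+ x. q (T x) \<partial>M) = 1" unfolding q_def by (rule nn_integral_preimage_Q)
  finally show ?thesis by simp
qed

lemma measure_preserved:
  assumes [measurable]: "B \<in> sets M"
  shows "measure M {y \<in> E. T y \<in> B} = measure M B"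
proof -
  have eq: "{y \<in> E. T y \<in> B} = T -` B \<inter> space M" by (auto simp: space_PiM)
  have [measurable]: "{y \<in> E. T y \<in> B} \<in> sets M" unfolding eq by measurable
  have "emeasure M {y \<in> E. T y \<in> B} = (\<integral>\<^sup>+ y. indicator {y \<in> E. T y \<in> B} y \<partial>M)"
    by simp
  also have "\<dots> = (\<integral>\<^sup>+ y. indicator B (T y) \<partial>M)"
    by (intro nn_integral_cong) (auto simp: indicator_def space_PiM)
  also have "\<dots> = emeasure M B" by (subst nn_integral_preserved) auto
  finally show ?thesis by (simp add: measure_def)
qed

end

section \<open>Lattice flats and the normalized volume\<close>

lemma scaleR_delta_left: "(if P then r else 0) *\<^sub>R (x :: _ :: real_vector) = (if P then r *\<^sub>R x else 0)"
  by simp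

lemma affine_chart_apply:
  "affine_chart d v y e = v 0 e + (\<Sum>i<d. y i * (v (Suc i) e - v 0 e))"
proof -
  have "(\<Sum>i\<in>I. y i *\<^sub>R (v (Suc i) - v 0)) e = (\<Sum>i\<in>I. y i * (v (Suc i) e - v 0 e))" for I :: "nat set"
    by (induction I rule: infinite_finite_induct) (simp_all add: scaleR_fun_def)
  then show ?thesis by (simp add: affine_chart_def)
qed

lemma affine_form_affine_chart: "affine_form d (\<lambda>y. affine_chart d v y e)"
  unfolding affine_chart_apply
  by (rule affine_formI[where k = "v 0 e" and c = "\<lambda>i. v (Suc i) e - v 0 e"]) (simp add: mult.commute)

lemma affine_chart_cong: "(\<And>i. i < d \<Longrightarrow> x i = y i) \<Longrightarrow> affine_chart d v x = affine_chart d v y"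
  unfolding affine_chart_def by (intro arg_cong2[where f = "(+)"] sum.cong) auto

lemma affine_chart_restrict [simp]: "affine_chart d v (restrict y {..<d}) = affine_chart d v y"
  by (rule affine_chart_cong) simp

lemma affine_chart_zero [simp]: "affine_chart d v (\<lambda>_. 0) = v 0"
  by (simp add: affine_chart_def)

lemma affine_chart_unit [simp]: "i < d \<Longrightarrow> affine_chart d v (\<lambda>j. if j = i then 1 else 0) = v (Suc i)"
  by (rule ext) (simp add: affine_chart_apply mult_delta_left)

lemma frame_chart_mem: 
  assumes "lattice_frame d A v" shows "affine_chart d v y \<in> A"
proof -
  have "affine_chart d v (restrict y {..<d}) \<in> affine_chart d v ` ({..<d} \<rightarrow>\<^sub>E UNIV)"
    by (intro imageI PiE_I) auto
  then show ?thesis using assms by (simp add: lattice_frame_def bij_betw_def)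
qed

lemma frame_mem:
  assumes "lattice_frame d A v" "i \<le> d" shows "v i \<in> A"
proof -
  note * = frame_chart_mem[OF assms(1)]
  show ?thesis
  proof (cases i)
    case 0 then show ?thesis using *[of "\<lambda>_. 0"] by simp
  next
    case (Suc j) then show ?thesis using *[of "\<lambda>k. if k = j then 1 else 0"] assms(2) by simp
  qed
qed

lemma frame_chart_surj:
  "lattice_frame d A v \<Longrightarrow> f \<in> A \<Longrightarrow> \<exists>y\<in>{..<d} \<rightarrow>\<^sub>E UNIV. affine_chart d v y = f"
  unfolding lattice_frame_def bij_betw_def by blast

lemma frame_chart_inj:
  assumes "lattice_frame d A v" "affine_chart d v x = affine_chart d v y" "i < d"
  shows "x i = y i"
proof -
  have "inj_on (affine_chart d v) ({..<d} \<rightarrow>\<^sub>E UNIV)"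
    using assms(1) by (simp add: lattice_frame_def bij_betw_def)
  then have "restrict x {..<d} = restrict y {..<d}" by (rule inj_onD) (use assms(2) in simp_all)
  from fun_cong[OF this, of i] show ?thesis using assms(3) by simp
qed

lemma frame_chart_integral:
  assumes v: "lattice_frame d A v" and y: "y \<in> {..<d} \<rightarrow>\<^sub>E UNIV"
  shows "affine_chart d v y \<in> integer_points \<longleftrightarrow> y \<in> {..<d} \<rightarrow>\<^sub>E \<int>"
proof
  assume "affine_chart d v y \<in> integer_points"
  then have "affine_chart d v y \<in> affine_chart d v ` ({..<d} \<rightarrow>\<^sub>E \<int>)"
    using v frame_chart_mem[OF v, of y] by (simp add: lattice_frame_def)
  then obtain z where z: "z \<in> {..<d} \<rightarrow>\<^sub>E \<int>" "affine_chart d v y = affine_chart d v z" by blast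
  have "y = z"
    by (rule PiE_ext[OF y]) (use z frame_chart_inj[OF v z(2)] in \<open>auto simp: PiE_iff\<close>)
  then show "y \<in> {..<d} \<rightarrow>\<^sub>E \<int>" using z by simp
qed (use v in \<open>auto simp: lattice_frame_def\<close>)

text \<open>A linear relation between the directions would give two parameters for the same point of
  the flat. The scale \<open>r\<close> is there for the small simplex that bounds
  \<open>complex_dim\<close> from below.\<close>

lemma frame_directions_independent:
  assumes v: "lattice_frame d A v" and r: "r \<noteq> 0"
  shows "inj_on (\<lambda>i. r *\<^sub>R (v (Suc i) - v 0)) {..<d}"
    and "independent ((\<lambda>i. r *\<^sub>R (v (Suc i) - v 0)) ` {..<d})"
proof -
  let ?B = "\<lambda>i. r *\<^sub>R (v (Suc i) - v 0)"
  have zero: "u i = 0" if "(\<Sum>i<d. u i *\<^sub>R ?B i) = 0" "i < d" for u i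
  proof -
    have "affine_chart d v (\<lambda>i. u i * r) = affine_chart d v (\<lambda>_. 0)"
      using that(1) by (simp add: affine_chart_def)
    from frame_chart_inj[OF v this that(2)] show ?thesis using r by simp
  qed
  show inj: "inj_on ?B {..<d}"
  proof (rule inj_onI, rule ccontr)
    fix i j assume ij: "i \<in> {..<d}" "j \<in> {..<d}" "?B i = ?B j" "i \<noteq> j"
    have "(\<Sum>k<d. ((if k = i then 1 else 0) - (if k = j then 1 else 0)) *\<^sub>R ?B k) = ?B i - ?B j"
      unfolding scaleR_left_diff_distrib sum_subtractf scaleR_delta_left using ij by simp
    with ij zero[of "\<lambda>k. (if k = i then 1 else 0) - (if k = j then 1 else 0)" i] show False by auto
  qed
  show "independent (?B ` {..<d})"
  proof
    assume "dependent (?B ` {..<d})"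
    then obtain u where u: "\<exists>b\<in>?B ` {..<d}. u b \<noteq> 0" "(\<Sum>b\<in>?B ` {..<d}. u b *\<^sub>R b) = 0"
      by (auto simp: dependent_finite)
    have "(\<Sum>i<d. u (?B i) *\<^sub>R ?B i) = 0"
      using u(2) by (subst (asm) sum.reindex[OF inj]) (simp add: o_def)
    then have "\<forall>i<d. u (?B i) = 0" using zero[of "\<lambda>i. u (?B i)"] by blast
    then show False using u(1) by auto
  qed
qed

lemma frame_span:
  assumes v: "lattice_frame d A v"
  shows "f \<in> A \<longleftrightarrow> f - v 0 \<in> span ((\<lambda>i. v (Suc i) - v 0) ` {..<d})"
proof
  assume "f \<in> A"
  then obtain y where "affine_chart d v y = f" using frame_chart_surj[OF v] by blast
  then have "f - v 0 = (\<Sum>i<d. y i *\<^sub>R (v (Suc i) - v 0))" by (auto simp: affine_chart_def)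
  also have "\<dots> \<in> span ((\<lambda>i. v (Suc i) - v 0) ` {..<d})"
    by (intro span_sum span_scale span_base) auto
  finally show "f - v 0 \<in> span ((\<lambda>i. v (Suc i) - v 0) ` {..<d})" .
next
  assume *: "f - v 0 \<in> span ((\<lambda>i. v (Suc i) - v 0) ` {..<d})"
  have inj: "inj_on (\<lambda>i. v (Suc i) - v 0) {..<d}"
    using frame_directions_independent(1)[OF v, of 1] by simp
  obtain u where "f - v 0 = (\<Sum>b\<in>(\<lambda>i. v (Suc i) - v 0) ` {..<d}. u b *\<^sub>R b)"
    using * by (auto simp: span_finite)
  also have "\<dots> = (\<Sum>i<d. u (v (Suc i) - v 0) *\<^sub>R (v (Suc i) - v 0))"
    by (subst sum.reindex[OF inj]) (simp add: o_def)
  finally have "affine_chart d v (\<lambda>i. u (v (Suc i) - v 0)) = f"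
    by (simp add: affine_chart_def algebra_simps)
  then show "f \<in> A" using frame_chart_mem[OF v] by metis
qed

text \<open>The directions of \<open>A\<close> lie in the span of those of \<open>A'\<close>, and
  both families have \<open>d\<close> members. A direction of \<open>A'\<close> outside the span of
  the directions of \<open>A\<close> would give \<open>d + 1\<close> independent vectors in a space
  spanned by \<open>d\<close>.\<close>

lemma lattice_flats_subset_eq:
  assumes "A \<in> lattice_flats d" "A' \<in> lattice_flats d" "A \<subseteq> A'"
  shows "A = A'"
proof -
  obtain v w where v: "lattice_frame d A v" and w: "lattice_frame d A' w"
    using assms by (auto simp: lattice_flats_def)
  let ?V = "(\<lambda>i. v (Suc i) - v 0) ` {..<d}" and ?W = "(\<lambda>i. w (Suc i) - w 0) ` {..<d}"
  have iV: "independent ?V" and cV: "card ?V = d"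
    using frame_directions_independent[OF v, of 1] by (simp_all add: card_image)
  have cW: "card ?W = d" using frame_directions_independent[OF w, of 1] by (simp add: card_image)
  have v0: "v i - w 0 \<in> span ?W" if "i \<le> d" for i
    using frame_mem[OF v that] assms(3) frame_span[OF w] by blast
  have VW: "?V \<subseteq> span ?W"
  proof
    fix x assume "x \<in> ?V"
    then obtain i where i: "i < d" "x = (v (Suc i) - w 0) - (v 0 - w 0)" by auto
    show "x \<in> span ?W" unfolding i(2) using i(1) by (intro span_diff v0) auto
  qed
  have "?W \<subseteq> span ?V"
  proof (rule subsetI, rule ccontr)
    fix x assume x: "x \<in> ?W" and nx: "x \<notin> span ?V"
    then have "independent (insert x ?V)" using iV by (simp add: independent_insert)
    moreover have "insert x ?V \<subseteq> span ?W" using VW x by (auto intro: span_base)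
    ultimately have "card (insert x ?V) \<le> card ?W"
      using independent_span_bound[of ?W] by auto
    moreover have "x \<notin> ?V" by (rule contra_subsetD[OF span_superset nx])
    ultimately show False using cV cW by (simp add: card_insert_if)
  qed
  then have WV: "span ?W \<subseteq> span ?V" by (intro span_minimal subspace_span)
  have "f \<in> A" if "f \<in> A'" for f
  proof -
    have "f - w 0 \<in> span ?W" using frame_span[OF w] that by simp
    then have "(f - w 0) - (v 0 - w 0) \<in> span ?V"
      by (intro subsetD[OF WV span_diff] v0) simp_all
    then show ?thesis using frame_span[OF v, of f] by simp
  qed
  then show ?thesis using assms(3) by blast
qed

text \<open>The frame chosen by \<open>SOME\<close> in \<open>flat_volume\<close> and the given
  frame \<open>w\<close> differ by a unimodular affine map \<open>T\<close>, which preserves the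
  measure of the preimage of \<open>X\<close>. From here on volumes are computed in a convenient
  frame.\<close>

lemma flat_volume_frame:
  assumes w: "lattice_frame d A w"
    and B: "{y \<in> {..<d} \<rightarrow>\<^sub>E UNIV. affine_chart d w y \<in> X} \<in> sets (Pi\<^sub>M {..<d} (\<lambda>_. lborel))"
  shows "flat_volume d A X
    = fact d * measure (Pi\<^sub>M {..<d} (\<lambda>_. lborel)) {y \<in> {..<d} \<rightarrow>\<^sub>E UNIV. affine_chart d w y \<in> X}"
proof -
  define v where "v = (SOME v. lattice_frame d A v)"
  have v: "lattice_frame d A v" unfolding v_def by (rule someI[of "lattice_frame d A", OF w])
  let ?E = "{..<d} \<rightarrow>\<^sub>E (UNIV :: real set)"
  \<comment> \<open>Coordinates of the vertices of \<open>v\<close> in the frame \<open>w\<close>;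
    they determine the affine map \<open>T\<close> from \<open>v\<close>-coordinates to
    \<open>w\<close>-coordinates.\<close>
  have "\<forall>i\<in>{..d}. \<exists>y. affine_chart d w y = v i"
    using frame_chart_surj[OF w frame_mem[OF v]] by (meson atMost_iff)
  then obtain u where u: "\<And>i. i \<le> d \<Longrightarrow> affine_chart d w (u i) = v i"
    by (auto simp: Bex_def dest!: bchoice)
  define T where "T y = (\<lambda>i\<in>{..<d}. u 0 i + (\<Sum>j<d. y j * (u (Suc j) i - u 0 i)))" for y
  have T: "affine_chart d w (T y) = affine_chart d v y" for y
  proof
    fix e
    let ?D = "\<lambda>i. w (Suc i) e - w 0 e"
    have ue: "v i e = w 0 e + (\<Sum>k<d. u i k * ?D k)" if "i \<le> d" for i
      using fun_cong[OF u[OF that], of e] by (simp add: affine_chart_apply)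
    have "affine_chart d w (T y) e
        = w 0 e + (\<Sum>i<d. (u 0 i + (\<Sum>j<d. y j * (u (Suc j) i - u 0 i))) * ?D i)"
      by (simp add: affine_chart_apply T_def)
    also have "\<dots> = w 0 e + (\<Sum>i<d. u 0 i * ?D i) + (\<Sum>i<d. \<Sum>j<d. y j * ((u (Suc j) i - u 0 i) * ?D i))"
      by (simp add: distrib_right sum.distrib sum_distrib_right mult.assoc)
    also have "(\<Sum>i<d. \<Sum>j<d. y j * ((u (Suc j) i - u 0 i) * ?D i))
        = (\<Sum>j<d. y j * ((\<Sum>i<d. u (Suc j) i * ?D i) - (\<Sum>i<d. u 0 i * ?D i)))"
      by (subst sum.swap) (simp add: sum_distrib_left left_diff_distrib right_diff_distrib sum_subtractf)
    also have "\<dots> = (\<Sum>j<d. y j * (v (Suc j) e - v 0 e))"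
      by (intro sum.cong) (simp_all add: ue)
    also have "w 0 e + (\<Sum>i<d. u 0 i * ?D i) = v 0 e" by (simp add: ue)
    finally show "affine_chart d w (T y) e = affine_chart d v y e" by (simp add: affine_chart_apply)
  qed
  have TE: "T y \<in> ?E" for y by (simp add: T_def)
  interpret unimodular_affine d T
  proof
    have "affine_chart d w \<circ> T = affine_chart d v" using T by (simp add: fun_eq_iff)
    then show "bij_betw T ?E ?E"
      using bij_betw_comp_iff2[of "affine_chart d w" ?E A T ?E] v w TE
      by (auto simp: lattice_frame_def)
    show "affine_form d (\<lambda>y. T y i)" if "i < d" for i
      by (rule affine_formI[where k = "u 0 i" and c = "\<lambda>j. u (Suc j) i - u 0 i"])
        (simp add: T_def that mult.commute)
    show "T y \<in> {..<d} \<rightarrow>\<^sub>E \<int> \<longleftrightarrow> y \<in> {..<d} \<rightarrow>\<^sub>E \<int>" if "y \<in> ?E" for y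
      using frame_chart_integral[OF w TE] frame_chart_integral[OF v that] by (simp add: T)
  qed
  have "{y \<in> ?E. affine_chart d v y \<in> X} = {y \<in> ?E. T y \<in> {y \<in> ?E. affine_chart d w y \<in> X}}"
    using TE by (simp add: T)
  then have "measure M {y \<in> ?E. affine_chart d v y \<in> X} = measure M {y \<in> ?E. affine_chart d w y \<in> X}"
    using measure_preserved[OF B] by simp
  then show ?thesis by (simp add: flat_volume_def Let_def v_def[symmetric])
qed

text \<open>Flats are described by equations because a single equation violated somewhere on another
  flat already makes the intersection null there. \<open>H\<close> may be infinite: vanishing
  outside \<open>arcs G\<close> is one equation for each edge that is not an arc.\<close>

definition cut_out_by :: "('e \<Rightarrow> real) set \<Rightarrow> (('e \<Rightarrow> real) \<Rightarrow> real) set \<Rightarrow> bool" where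
  "cut_out_by A H \<longleftrightarrow> A = {f. \<forall>h\<in>H. h f = 0} \<and>
     (\<forall>h\<in>H. \<forall>d v. affine_form d (\<lambda>y. h (affine_chart d v y)))"

text \<open>Some equation of \<open>B\<close> fails at a point of \<open>A\<close>, so its pullback
  to the chart is an affine form that is not identically 0.\<close>

lemma frame_preimage_null:
  assumes v: "lattice_frame d A v" and B: "cut_out_by B H" and nsub: "\<not> A \<subseteq> B"
  shows "\<exists>N\<in>null_sets (Pi\<^sub>M {..<d} (\<lambda>_. lborel)). {y \<in> {..<d} \<rightarrow>\<^sub>E UNIV. affine_chart d v y \<in> B} \<subseteq> N"
proof -
  obtain f h where f: "f \<in> A" and h: "h \<in> H" "h f \<noteq> 0" using B nsub by (auto simp: cut_out_by_def)
  obtain y where y: "y \<in> {..<d} \<rightarrow>\<^sub>E UNIV" "affine_chart d v y = f" using frame_chart_surj[OF v f] by blast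
  have "{y \<in> {..<d} \<rightarrow>\<^sub>E UNIV. h (affine_chart d v y) = 0} \<in> null_sets (Pi\<^sub>M {..<d} (\<lambda>_. lborel))"
    by (rule affine_form_level_null) (use B h y in \<open>auto simp: cut_out_by_def\<close>)
  moreover have "{y \<in> {..<d} \<rightarrow>\<^sub>E UNIV. affine_chart d v y \<in> B}
      \<subseteq> {y \<in> {..<d} \<rightarrow>\<^sub>E UNIV. h (affine_chart d v y) = 0}"
    using B h by (auto simp: cut_out_by_def)
  ultimately show ?thesis by blast
qed

text \<open>\<open>S\<close> itself may fail to be measurable; \<open>measure\<close> is then 0 by
  convention.\<close>

lemma measure_subset_null: "N \<in> null_sets M \<Longrightarrow> S \<subseteq> N \<Longrightarrow> measure M S = 0"
  by (metis measure_eq_0_null_sets measure_notin_sets null_sets_subset)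

text \<open>A member of \<open>\<A>\<close> containing \<open>A\<close> would equal
  \<open>A\<close>, as the dimensions agree. So the part of \<open>X\<close> in \<open>A\<close> is
  covered by finitely many null sets. This cuts the infinite sum over flats down to a finite
  one.\<close>

lemma flat_volume_null:
  assumes A: "A \<in> lattice_flats d" and fin: "finite \<A>" and X: "X \<subseteq> \<Union>\<A>"
    and cut: "\<And>B. B \<in> \<A> \<Longrightarrow> \<exists>H. cut_out_by B H" and flats: "\<A> \<subseteq> lattice_flats d" and nin: "A \<notin> \<A>"
  shows "flat_volume d A X = 0"
proof -
  let ?M = "Pi\<^sub>M {..<d} (\<lambda>_. lborel :: real measure)"
  define v where "v = (SOME v. lattice_frame d A v)"
  have v: "lattice_frame d A v"
    using A someI[of "lattice_frame d A"] unfolding lattice_flats_def v_def by blast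
  have "\<forall>B\<in>\<A>. \<exists>N\<in>null_sets ?M. {y \<in> {..<d} \<rightarrow>\<^sub>E UNIV. affine_chart d v y \<in> B} \<subseteq> N"
  proof
    fix B assume B: "B \<in> \<A>"
    then have "\<not> A \<subseteq> B" using lattice_flats_subset_eq[OF A] flats nin by blast
    then show "\<exists>N\<in>null_sets ?M. {y \<in> {..<d} \<rightarrow>\<^sub>E UNIV. affine_chart d v y \<in> B} \<subseteq> N"
      using frame_preimage_null[OF v] cut[OF B] by blast
  qed
  then obtain N where N: "\<And>B. B \<in> \<A> \<Longrightarrow> N B \<in> null_sets ?M"
    "\<And>B. B \<in> \<A> \<Longrightarrow> {y \<in> {..<d} \<rightarrow>\<^sub>E UNIV. affine_chart d v y \<in> B} \<subseteq> N B"
    unfolding Bex_def by (elim bchoice[elim_format] exE) blast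
  have "(\<Union>B\<in>\<A>. N B) \<in> null_sets ?M" using N(1) fin by (intro null_sets.finite_UN) auto
  moreover have "{y \<in> {..<d} \<rightarrow>\<^sub>E UNIV. affine_chart d v y \<in> X} \<subseteq> (\<Union>B\<in>\<A>. N B)"
  proof
    fix y assume y: "y \<in> {y \<in> {..<d} \<rightarrow>\<^sub>E UNIV. affine_chart d v y \<in> X}"
    then obtain B where "B \<in> \<A>" "affine_chart d v y \<in> B" using X by auto
    moreover have "y \<in> {..<d} \<rightarrow>\<^sub>E UNIV" using y by simp
    ultimately show "y \<in> (\<Union>B\<in>\<A>. N B)" using N(2)[of B] by auto
  qed
  ultimately have "measure ?M {y \<in> {..<d} \<rightarrow>\<^sub>E UNIV. affine_chart d v y \<in> X} = 0"
    by (rule measure_subset_null)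
  then show ?thesis by (simp add: flat_volume_def Let_def v_def[symmetric])
qed

lemma normalized_volume_eq_sum:
  assumes "complex_dim X = d" "finite \<A>" "X \<subseteq> \<Union>\<A>" "\<A> \<subseteq> lattice_flats d"
    and "\<And>B. B \<in> \<A> \<Longrightarrow> \<exists>H. cut_out_by B H"
  shows "normalized_volume X = (\<Sum>A\<in>\<A>. flat_volume d A X)"
proof -
  have "normalized_volume X = (\<Sum>\<^sub>\<infinity>A\<in>\<A>. flat_volume d A X)"
    unfolding normalized_volume_def assms(1)
    using assms flat_volume_null[of _ d \<A> X] by (intro infsum_cong_neutral) auto
  then show ?thesis using assms(2) by simp
qed

text \<open>Lower bound: the simplex at \<open>z\<close> whose edges are \<open>r\<close> times the
  frame directions lies in \<open>K\<close>. Upper bound: by \<open>cone\<close> a ray from the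
  origin meets \<open>X\<close> at most once, so an affinely independent set whose hull lies in
  \<open>X\<close> is even linearly independent, and it sits in a space spanned by
  \<open>d + 1\<close> vectors.\<close>

lemma complex_dim_eqI:
  assumes w: "lattice_frame d A w"
    and K: "convex K" "K \<subseteq> X" and r: "r > 0"
    and z: "affine_chart d w z \<in> K"
    and zi: "\<And>i. i < d \<Longrightarrow> affine_chart d w (\<lambda>j. z j + (if j = i then r else 0)) \<in> K"
    and X: "X \<subseteq> span (w ` {..d})"
    and cone: "\<And>f t. f \<in> X \<Longrightarrow> t > 0 \<Longrightarrow> t *\<^sub>R f \<in> X \<Longrightarrow> t = 1"
  shows "complex_dim X = d"
  unfolding complex_dim_def
proof (rule Greatest_equality)
  let ?p = "affine_chart d w z" and ?B = "\<lambda>i. r *\<^sub>R (w (Suc i) - w 0)"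
  have r0: "r \<noteq> 0" using r by simp
  have pi: "affine_chart d w (\<lambda>j. z j + (if j = i then r else 0)) = ?p + ?B i" if "i < d" for i
    using that
    by (simp add: affine_chart_def scaleR_left_distrib sum.distrib scaleR_delta_left)
  let ?S = "(\<lambda>i. ?p + ?B i) ` {..<d}"
  have B0: "0 \<notin> ?B ` {..<d}"
    using dependent_zero[of "?B ` {..<d}"] frame_directions_independent(2)[OF w r0] by argo
  have nin: "?p \<notin> ?S"
  proof
    assume "?p \<in> ?S"
    then obtain i where i: "i < d" "?p = ?p + ?B i" by auto
    then have "0 = ?B i" by simp
    then show False using B0 i(1) by (simp only: image_iff) blast
  qed
  have inj: "inj_on (\<lambda>i. ?p + ?B i) {..<d}"
    using frame_directions_independent(1)[OF w r0] by (simp add: inj_on_def)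
  have im: "(\<lambda>x. - ?p + x) ` ?S = ?B ` {..<d}" by (simp add: image_image)
  have "\<not> affine_dependent (insert ?p ?S)"
    using affine_dependent_iff_dependent[OF nin] frame_directions_independent(2)[OF w r0] unfolding im by simp
  moreover have "card (insert ?p ?S) = Suc d" using nin inj by (simp add: card_image)
  moreover have "convex hull insert ?p ?S \<subseteq> X"
    using z zi pi K by (intro order.trans[OF hull_minimal K(2)]) auto
  ultimately show "\<exists>S. finite S \<and> card S = Suc d \<and> \<not> affine_dependent S \<and> convex hull S \<subseteq> X"
    by (intro exI[of _ "insert ?p ?S"]) simp
next
  fix k assume "\<exists>S. finite S \<and> card S = Suc k \<and> \<not> affine_dependent S \<and> convex hull S \<subseteq> X"
  then obtain S where S: "finite S" "card S = Suc k" "\<not> affine_dependent S" "convex hull S \<subseteq> X" by blast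
  have "independent S"
  proof
    assume "dependent S"
    then obtain u where u: "\<exists>s\<in>S. u s \<noteq> 0" "(\<Sum>s\<in>S. u s *\<^sub>R s) = 0"
      using S(1) by (auto simp: dependent_finite)
    have nz: "sum u S \<noteq> 0"
      using S(1,3) u affine_dependent_explicit_finite[OF S(1)] by auto
    define n where "n = real (card S)"
    have n: "n > 0" using S(2) by (simp add: n_def)
    \<comment> \<open>The scale is chosen so that moving the uniform weights \<open>1 / n\<close> by
      \<open>\<delta> * u s\<close> keeps them nonnegative; the sign in \<open>\<delta>\<close>
      makes their total exceed 1.\<close>
    define b where "b = 1 / (n * (1 + (\<Sum>s\<in>S. \<bar>u s\<bar>)))"
    have pos: "1 + (\<Sum>s\<in>S. \<bar>u s\<bar>) > 0" by (intro add_pos_nonneg sum_nonneg) auto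
    have b: "b > 0" using n pos by (simp add: b_def)
    define \<delta> where "\<delta> = sgn (sum u S) * b"
    have small: "0 \<le> 1 / n + \<delta> * u s" if "s \<in> S" for s
    proof -
      have "\<bar>u s\<bar> \<le> 1 + (\<Sum>s\<in>S. \<bar>u s\<bar>)" using member_le_sum[of s S "\<lambda>s. \<bar>u s\<bar>"] that S(1) by auto
      then have "\<bar>u s\<bar> / (1 + (\<Sum>s\<in>S. \<bar>u s\<bar>)) / n \<le> 1 / n"
        using n pos by (intro divide_right_mono) simp_all
      then have "b * \<bar>u s\<bar> \<le> 1 / n" by (simp add: b_def mult.commute)
      moreover have "\<bar>\<delta> * u s\<bar> = b * \<bar>u s\<bar>" using nz b by (simp add: \<delta>_def abs_mult abs_sgn_eq)
      ultimately show ?thesis by linarith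
    qed
    define \<tau> where "\<tau> = 1 + \<delta> * sum u S"
    have "\<delta> * sum u S = b * \<bar>sum u S\<bar>" by (simp add: \<delta>_def abs_sgn mult_ac)
    then have \<tau>: "\<tau> > 1" using b nz by (simp add: \<tau>_def)
    define m where "m = (\<Sum>s\<in>S. (1 / n) *\<^sub>R s)"
    have "m \<in> convex hull S"
      unfolding m_def using n S(1)
      by (intro convex_sum[OF S(1) convex_convex_hull]) (auto simp: n_def hull_inc)
    then have "m \<in> X" using S(4) by blast
    \<comment> \<open>Adding the relation leaves the barycentre in place but changes its coefficient
      sum to \<open>\<tau>\<close>. Rescaling by \<open>1 / \<tau>\<close> gives a second point of
      the hull on the same ray.\<close>
    have "m = (\<Sum>s\<in>S. (1 / n + \<delta> * u s) *\<^sub>R s)"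
    proof -
      have "(\<Sum>s\<in>S. (\<delta> * u s) *\<^sub>R s) = 0" using u(2) by (simp flip: scaleR_scaleR scaleR_sum_right)
      then show ?thesis by (simp add: m_def scaleR_left_distrib sum.distrib)
    qed
    then have m': "(1 / \<tau>) *\<^sub>R m = (\<Sum>s\<in>S. ((1 / n + \<delta> * u s) / \<tau>) *\<^sub>R s)"
      by (simp add: scaleR_sum_right)
    have "(1 / \<tau>) *\<^sub>R m \<in> convex hull S"
      unfolding m'
    proof (rule convex_sum[OF S(1) convex_convex_hull])
      have "(\<Sum>s\<in>S. 1 / n + \<delta> * u s) = \<tau>"
        using n by (simp add: sum.distrib \<tau>_def n_def sum_distrib_left)
      then show "(\<Sum>s\<in>S. (1 / n + \<delta> * u s) / \<tau>) = 1"
        using \<tau> by (simp flip: sum_divide_distrib)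
    qed (use small \<tau> in \<open>auto simp: hull_inc\<close>)
    then have "1 / \<tau> = 1" using cone[OF \<open>m \<in> X\<close>, of "1 / \<tau>"] S(4) \<tau> by auto
    then show False using \<tau> by simp
  qed
  moreover have "S \<subseteq> span (w ` {..d})" using S(4) X hull_subset[of S convex] by blast
  ultimately have "card S \<le> card (w ` {..d})" using independent_span_bound[of "w ` {..d}" S] by simp
  also have "\<dots> \<le> Suc d" using card_image_le[of "{..d}" w] by simp
  finally show "k \<le> d" using S(2) by simp
qed

section \<open>The graph of nested cycles\<close>

definition blue :: "nat \<Rightarrow> nat \<Rightarrow> (nat \<times> nat) \<times> (nat \<times> nat)" where
  "blue a b = ((a, b), (a + 1, b))"

lemma cas_closed:
  assumes "pre_digraph.cas G u q v" "e \<in> set q"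
  shows "head G e = v \<or> (\<exists>e'\<in>set q. tail G e' = head G e)"
  using assms
proof (induction q arbitrary: u)
  case (Cons e0 q)
  then have q: "pre_digraph.cas G (head G e0) q v" by (simp add: pre_digraph.cas.simps)
  show ?case
  proof (cases "e = e0")
    case True
    then show ?thesis using q by (cases q) (auto simp: pre_digraph.cas.simps)
  next
    case False
    then show ?thesis using Cons.IH[OF q] Cons.prems by auto
  qed
qed simp

lemma closed_walk_successor:
  assumes "pre_digraph.cas G u q u" "e \<in> set q"
  shows "\<exists>e'\<in>set q. tail G e' = head G e"
proof -
  have "tail G (hd q) = u" "hd q \<in> set q" using assms by (cases q; auto simp: pre_digraph.cas.simps)+
  then show ?thesis using cas_closed[OF assms] by metis
qed

section \<open>Arcs, vertices and netflow\<close>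

locale nested =
  fixes c p :: nat
  assumes c: "1 \<le> c" and p: "1 \<le> p"
begin

abbreviation G where "G \<equiv> nested_cycles c p"

definition red :: "nat \<Rightarrow> nat \<Rightarrow> (nat \<times> nat) \<times> (nat \<times> nat)" where
  "red a b = ((a, b), (a, b mod p + 1))"

text \<open>Inverse of the cyclic successor \<open>b mod p + 1\<close> on \<open>{1..p}\<close>; the
  red inflow at \<open>b\<close> comes from there.\<close>

definition prev :: "nat \<Rightarrow> nat" where
  "prev b = (if b = 1 then p else b - 1)"

definition layer :: "nat \<Rightarrow> ((nat \<times> nat) \<times> (nat \<times> nat)) set" where
  "layer a = red a ` {1..p}"

lemma mod_succ: "b \<in> {1..p} \<Longrightarrow> b mod p + 1 = (if b = p then 1 else b + 1)"
  by auto

lemma prev_in: "b \<in> {1..p} \<Longrightarrow> prev b \<in> {1..p}"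
  using p by (auto simp: prev_def)

lemma succ_eq_iff: "b \<in> {1..p} \<Longrightarrow> b' \<in> {1..p} \<Longrightarrow> b' mod p + 1 = b \<longleftrightarrow> b' = prev b"
  unfolding mod_succ prev_def by auto

lemma red_neq_blue [simp]: "red a b \<noteq> blue a' b'" "blue a' b' \<noteq> red a b"
  by (auto simp: red_def blue_def)

lemma red_eq_iff [simp]: "red a b = red a' b' \<longleftrightarrow> a = a' \<and> b = b'"
  by (auto simp: red_def)

lemma blue_eq_iff [simp]: "blue a b = blue a' b' \<longleftrightarrow> a = a' \<and> b = b'"
  by (auto simp: blue_def)

lemma arcs_iff: "e \<in> arcs G \<longleftrightarrow>
    (\<exists>a b. e = blue a b \<and> a \<le> c \<and> b \<in> {1..p}) \<or> (\<exists>a b. e = red a b \<and> a \<in> {1..c} \<and> b \<in> {1..p})"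
  by (auto simp: nested_cycles_def blue_def red_def)

lemma blue_arc [simp]: "blue a b \<in> arcs G \<longleftrightarrow> a \<le> c \<and> b \<in> {1..p}"
  by (auto simp: arcs_iff)

lemma red_arc [simp]: "red a b \<in> arcs G \<longleftrightarrow> a \<in> {1..c} \<and> b \<in> {1..p}"
  by (auto simp: arcs_iff)

lemma tail_head [simp]:
  "tail G (blue a b) = (a, b)" "head G (blue a b) = (a + 1, b)"
  "tail G (red a b) = (a, b)" "head G (red a b) = (a, b mod p + 1)"
  by (simp_all add: nested_cycles_def blue_def red_def)

lemma out_arcs_iff: "e \<in> out_arcs G (a, b) \<longleftrightarrow>
    (e = blue a b \<and> a \<le> c \<and> b \<in> {1..p}) \<or> (e = red a b \<and> a \<in> {1..c} \<and> b \<in> {1..p})"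
  by (auto simp: out_arcs_def arcs_iff)

lemma in_arcs_iff: "b \<in> {1..p} \<Longrightarrow> e \<in> in_arcs G (a, b) \<longleftrightarrow>
    (e = blue (a - 1) b \<and> a \<in> {1..c + 1}) \<or> (e = red a (prev b) \<and> a \<in> {1..c})"
  using succ_eq_iff prev_in[of b] by (auto simp: in_arcs_def arcs_iff)

lemma out_arcs_eq:
  assumes "b \<in> {1..p}"
  shows "out_arcs G (a, b) = (if a \<le> c then {blue a b} else {}) \<union> (if a \<in> {1..c} then {red a b} else {})"
proof (rule set_eqI)
  show "e \<in> out_arcs G (a, b) \<longleftrightarrow>
      e \<in> (if a \<le> c then {blue a b} else {}) \<union> (if a \<in> {1..c} then {red a b} else {})" for e
    unfolding out_arcs_iff using assms by simp
qed

lemma in_arcs_eq: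
  assumes "b \<in> {1..p}"
  shows "in_arcs G (a, b)
    = (if a \<in> {1..c + 1} then {blue (a - 1) b} else {}) \<union> (if a \<in> {1..c} then {red a (prev b)} else {})"
proof (rule set_eqI)
  show "e \<in> in_arcs G (a, b) \<longleftrightarrow> e \<in> (if a \<in> {1..c + 1} then {blue (a - 1) b} else {})
      \<union> (if a \<in> {1..c} then {red a (prev b)} else {})" for e
    unfolding in_arcs_iff[OF assms] by simp
qed

lemma verts_eq: "verts G = {0..c + 1} \<times> {1..p}"
  by (simp add: nested_cycles_def)

lemma sources_eq: "sources G = {0} \<times> {1..p}"
proof -
  have "in_arcs G v = {} \<longleftrightarrow> fst v = 0" if "v \<in> {0..c + 1} \<times> {1..p}" for v
    using that in_arcs_eq[of "snd v" "fst v"] by (auto simp del: in_in_arcs_conv split: if_splits)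
  then have "sources G = {v \<in> {0..c + 1} \<times> {1..p}. fst v = 0}"
    unfolding sources_def verts_eq by (intro Collect_cong conj_cong refl)
  also have "\<dots> = {0} \<times> {1..p}" by (rule set_eqI) (simp add: mem_Times_iff, linarith)
  finally show ?thesis .
qed

lemma sinks_eq: "sinks G = {c + 1} \<times> {1..p}"
proof -
  have "out_arcs G v = {} \<longleftrightarrow> fst v = c + 1" if "v \<in> {0..c + 1} \<times> {1..p}" for v
    using that out_arcs_eq[of "snd v" "fst v"] by (auto simp del: in_out_arcs_conv split: if_splits)
  then have "sinks G = {v \<in> {0..c + 1} \<times> {1..p}. fst v = c + 1}"
    unfolding sinks_def verts_eq by (intro Collect_cong conj_cong refl)
  also have "\<dots> = {c + 1} \<times> {1..p}" by (rule set_eqI) (simp add: mem_Times_iff, linarith)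
  finally show ?thesis .
qed

lemma internal_verts_eq: "internal_verts G = {1..c} \<times> {1..p}"
  unfolding internal_verts_def sources_eq sinks_eq by (auto simp: verts_eq)

lemma netflow_internal:
  assumes "a \<in> {1..c}" "b \<in> {1..p}"
  shows "netflow G f (a, b) = f (blue a b) + f (red a b) - (f (blue (a - 1) b) + f (red a (prev b)))"
  using assms by (simp add: netflow_def out_arcs_eq in_arcs_eq)

lemma netflow_source: "b \<in> {1..p} \<Longrightarrow> netflow G f (0, b) = f (blue 0 b)"
  by (simp add: netflow_def out_arcs_eq in_arcs_eq)

section \<open>Minimal cycles\<close>

lemma layer_eq_iff [simp]: "layer a = layer a' \<longleftrightarrow> a = a'"
proof
  assume "layer a = layer a'"
  then have "red a 1 \<in> layer a'" using p by (auto simp: layer_def)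
  then show "a = a'" by (auto simp: layer_def)
qed simp

lemma layer_directed_cycle:
  assumes a: "a \<in> {1..c}"
  shows "layer a \<in> directed_cycles G"
proof -
  interpret pre_digraph G .
  let ?q = "map (red a) [1..<Suc p]"
  have "cas (a, k) (map (red a) [k..<Suc p]) (a, 1)" if "k \<le> p" for k
    using that
  proof (induction k rule: inc_induct)
    case (step n)
    then show ?case by (simp add: upt_conv_Cons del: upt_Suc)
  qed simp
  then have cas: "cas (a, 1) ?q (a, 1)" using p by blast
  have "awalk (a, 1) ?q (a, 1)"
    unfolding awalk_def using a p cas by (auto simp: verts_eq simp del: upt_Suc)
  moreover have "distinct (tl (awalk_verts (a, 1) ?q))"
  proof -
    have "inj_on (\<lambda>b. (a, b mod p + 1)) {1..p}"
    proof (rule inj_onI)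
      fix x y assume xy: "x \<in> {1..p}" "y \<in> {1..p}" "(a, x mod p + 1) = (a, y mod p + 1)"
      have "x mod p + 1 \<in> {1..p}" using p by (simp add: Suc_leI)
      then show "x = y" using succ_eq_iff[of "x mod p + 1" x] succ_eq_iff[of "x mod p + 1" y] xy by simp
    qed
    then have "distinct (map (\<lambda>b. (a, b mod p + 1)) [1..<Suc p])"
      unfolding distinct_map set_upt atLeastLessThanSuc_atLeastAtMost by (simp only: distinct_upt)
    moreover have "tl (awalk_verts (a, 1) ?q) = map (\<lambda>b. (a, b mod p + 1)) [1..<Suc p]"
      using p unfolding awalk_verts_conv'[OF cas] by (simp add: comp_def del: upt_Suc)
    ultimately show ?thesis by (simp only:)
  qed
  moreover have "?q \<noteq> []" using p by (simp del: upt_Suc)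
  ultimately have "cycle ?q" unfolding cycle_def by blast
  then show ?thesis
    unfolding directed_cycles_def
    by (intro CollectI exI[of _ ?q])
      (auto simp: layer_def atLeastLessThanSuc_atLeastAtMost simp del: upt_Suc)
qed

text \<open>Let \<open>a\<close> be the highest layer of a tail. Blue arcs raise the layer, so every
  arc of \<open>D\<close> ending in layer \<open>a\<close> is followed by a red one, and the red
  successors run through the whole cycle.\<close>

lemma directed_cycle_contains_layer:
  assumes "D \<in> directed_cycles G"
  shows "\<exists>a\<in>{1..c}. layer a \<subseteq> D"
proof -
  interpret pre_digraph G .
  obtain q u where q: "D = set q" "awalk u q u" "q \<noteq> []"
    using assms by (auto simp: directed_cycles_def cycle_def)
  then have D: "D \<subseteq> arcs G" "cas u q u" "finite D" "D \<noteq> {}" by (auto simp: awalk_def)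
  define a where "a = Max ((\<lambda>e. fst (tail G e)) ` D)"
  have max: "fst (tail G e) \<le> a" if "e \<in> D" for e
    unfolding a_def using D that by (intro Max_ge) auto
  have next_red: "red a (snd (head G e)) \<in> D" if e: "e \<in> D" "fst (head G e) = a" for e
  proof -
    obtain e' where e': "e' \<in> D" "tail G e' = head G e"
      using closed_walk_successor[OF D(2)] e(1) q(1) by blast
    obtain e'' where e'': "e'' \<in> D" "tail G e'' = head G e'"
      using closed_walk_successor[OF D(2)] e'(1) q(1) by blast
    obtain k where k: "head G e = (a, k)" using e(2) by (cases "head G e") auto
    have "e' \<in> arcs G" using e'(1) D(1) by blast
    then have "e' = blue a k \<or> e' = red a k" using e'(2) unfolding k arcs_iff by auto
    moreover have "e' \<noteq> blue a k" using max[OF e''(1)] e''(2) by auto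
    ultimately show ?thesis using e'(1) k by simp
  qed
  have "a \<in> (\<lambda>e. fst (tail G e)) ` D" unfolding a_def using D by (intro Max_in) auto
  then obtain e where e: "e \<in> D" "fst (tail G e) = a" by auto
  obtain e' where e': "e' \<in> D" "tail G e' = head G e"
    using closed_walk_successor[OF D(2)] e(1) q(1) by blast
  have "e \<in> arcs G" using e(1) D(1) by blast
  then have "fst (head G e) = a" using max[OF e'(1)] e(2) unfolding e'(2) arcs_iff by auto
  then have "red a (snd (head G e)) \<in> D" using next_red e by simp
  then obtain b where b: "red a b \<in> D" by blast
  then have ab: "a \<in> {1..c}" "b \<in> {1..p}" using D(1) by (auto dest!: subsetD)
  have succ: "red a (k mod p + 1) \<in> D" if "red a k \<in> D" for k using next_red[OF that] by simp
  have up: "red a k \<in> D" if "red a l \<in> D" "l \<le> k" "k \<le> p" "1 \<le> l" for k l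
    using that(2,3)
  proof (induction k rule: dec_induct)
    case (step n)
    then show ?case using succ[of n] that(4) by (simp split: if_splits)
  qed (use that in simp)
  have "red a p \<in> D" using up[OF b] ab by simp
  then have "red a 1 \<in> D" using succ[of p] by simp
  then have "red a k \<in> D" if "k \<in> {1..p}" for k using up that by auto
  then have "layer a \<subseteq> D" by (auto simp: layer_def)
  then show ?thesis using ab by blast
qed

lemma minimal_cycles_eq: "minimal_cycles G = layer ` {1..c}"
proof (intro equalityI subsetI)
  fix C assume "C \<in> minimal_cycles G"
  then have C: "C \<in> directed_cycles G" "\<And>D. D \<in> directed_cycles G \<Longrightarrow> \<not> D \<subset> C"
    by (auto simp: minimal_cycles_def)
  obtain a where a: "a \<in> {1..c}" "layer a \<subseteq> C" using directed_cycle_contains_layer[OF C(1)] by blast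
  then have "C = layer a" using C(2)[OF layer_directed_cycle[OF a(1)]] by blast
  then show "C \<in> layer ` {1..c}" using a by blast
next
  fix C assume "C \<in> layer ` {1..c}"
  then obtain a where a: "a \<in> {1..c}" "C = layer a" by blast
  have "\<not> D \<subset> C" if cyc: "D \<in> directed_cycles G" for D
  proof
    assume D: "D \<subset> C"
    obtain a' where a': "layer a' \<subseteq> D" using directed_cycle_contains_layer[OF cyc] by blast
    have "red a' 1 \<in> layer a'" using p by (auto simp: layer_def)
    then have "red a' 1 \<in> layer a" using a' D a(2) by auto
    then have "a = a'" by (auto simp: layer_def)
    then show False using a' D a(2) by blast
  qed
  then show "C \<in> minimal_cycles G" using layer_directed_cycle a by (auto simp: minimal_cycles_def)
qed

text \<open>Summation of the recurrence from \<open>r p\<close>, the value before index 1. On the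
  right the case \<open>b = p\<close> contains the closing condition that \<open>s\<close> sums to
  0. Abelian groups cover real flows and integer flows alike.\<close>

lemma cyclic_recurrence_iff:
  fixes r s :: "nat \<Rightarrow> 'b :: ab_group_add"
  shows "(\<forall>b\<in>{1..p}. r b = r (prev b) + s b) \<longleftrightarrow> (\<forall>b\<in>{1..p}. r b = r p + sum s {1..b})"
proof
  assume rec: "\<forall>b\<in>{1..p}. r b = r (prev b) + s b"
  have "r b = r p + sum s {1..b}" if "1 \<le> b" "b \<le> p" for b
    using that
  proof (induction b rule: dec_induct)
    case base
    then show ?case using rec by (simp add: prev_def)
  next
    case (step n)
    then show ?case using bspec[OF rec, of "Suc n"] by (simp add: prev_def add.assoc)
  qed
  then show "\<forall>b\<in>{1..p}. r b = r p + sum s {1..b}" by (metis atLeastAtMost_iff)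
next
  assume sol: "\<forall>b\<in>{1..p}. r b = r p + sum s {1..b}"
  show "\<forall>b\<in>{1..p}. r b = r (prev b) + s b"
  proof
    fix b assume b: "b \<in> {1..p}"
    show "r b = r (prev b) + s b"
    proof (cases "b = 1")
      case True
      then show ?thesis using bspec[OF sol b] by (simp add: prev_def)
    next
      case False
      then obtain n where n: "b = Suc n" "n \<in> {1..p}" using b by (cases b) auto
      then show ?thesis using bspec[OF sol b] bspec[OF sol n(2)] False by (simp add: prev_def add.assoc)
    qed
  qed
qed

end

section \<open>Volumes of fibred simplices\<close>

abbreviation PiL :: "nat set \<Rightarrow> (nat \<Rightarrow> real) measure" where
  "PiL A \<equiv> Pi\<^sub>M A (\<lambda>_. lborel)"

text \<open>Only the coordinates in \<open>A\<close> are constrained, so that membership can also be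
  tested for points with further coordinates.\<close>

definition orthant_simplex :: "nat set \<Rightarrow> real \<Rightarrow> (nat \<Rightarrow> real) set" where
  "orthant_simplex A t = {x. (\<forall>i\<in>A. 0 \<le> x i) \<and> sum x A \<le> t}"

lemma orthant_simplex_cong:
  "(\<And>i. i \<in> A \<Longrightarrow> x i = y i) \<Longrightarrow> x \<in> orthant_simplex A t \<longleftrightarrow> y \<in> orthant_simplex A t"
  unfolding orthant_simplex_def using sum.cong[of A A x y] by auto

lemma orthant_simplex_neg: "x \<in> orthant_simplex A t \<Longrightarrow> 0 \<le> t"
  unfolding orthant_simplex_def using sum_nonneg[of A x] by auto

lemma sets_orthant_simplex [measurable]:
  assumes "finite B" "A \<subseteq> B" shows "{x \<in> space (PiL B). x \<in> orthant_simplex A t} \<in> sets (PiL B)"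
proof -
  have "finite A" using assms finite_subset by blast
  have [measurable]: "(\<lambda>x. x i) \<in> borel_measurable (PiL B)" if "i \<in> A" for i
    using measurable_component_singleton[of i B "\<lambda>_. lborel :: real measure"] that assms by auto
  have [measurable]: "(\<lambda>x. sum x A) \<in> borel_measurable (PiL B)"
    by (rule borel_measurable_sum) measurable
  show ?thesis unfolding orthant_simplex_def mem_Collect_eq
    using \<open>finite A\<close> by measurable
qed

lemma emeasure_orthant_simplex:
  assumes "finite A" "0 \<le> t"
  shows "emeasure (PiL A) {x \<in> space (PiL A). x \<in> orthant_simplex A t} = t ^ card A / fact (card A)"
  using emeasure_std_simplex_aux[OF assms]
  by (simp add: orthant_simplex_def Int_def conj_ac)

lemma emeasure_PiL_fold:
  assumes A: "finite A" "finite B" "A \<inter> B = {}" and Z: "Z \<in> sets (PiL (A \<union> B))"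
  shows "emeasure (PiL (A \<union> B)) Z
    = (\<integral>\<^sup>+ x. emeasure (PiL B) {y \<in> space (PiL B). merge A B (x, y) \<in> Z} \<partial>PiL A)"
proof -
  interpret product_sigma_finite "\<lambda>_::nat. lborel :: real measure" by standard
  have "emeasure (PiL (A \<union> B)) Z = (\<integral>\<^sup>+ z. indicator Z z \<partial>PiL (A \<union> B))" using Z by simp
  also have "\<dots> = (\<integral>\<^sup>+ x. (\<integral>\<^sup>+ y. indicator Z (merge A B (x, y)) \<partial>PiL B) \<partial>PiL A)"
    by (rule product_nn_integral_fold) (use A Z in auto)
  also have "\<dots> = (\<integral>\<^sup>+ x. emeasure (PiL B) {y \<in> space (PiL B). merge A B (x, y) \<in> Z} \<partial>PiL A)"
  proof (rule nn_integral_cong)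
    fix x assume x: "x \<in> space (PiL A)"
    have "(\<lambda>y. merge A B (x, y)) \<in> measurable (PiL B) (PiL (A \<union> B))"
      by (rule measurable_compose[OF measurable_Pair1'[OF x] measurable_merge])
    from measurable_sets[OF this Z]
    have [measurable]: "{y \<in> space (PiL B). merge A B (x, y) \<in> Z} \<in> sets (PiL B)"
      by (simp add: vimage_def Int_def conj_commute)
    have "(\<integral>\<^sup>+ y. indicator Z (merge A B (x, y)) \<partial>PiL B)
        = (\<integral>\<^sup>+ y. indicator {y \<in> space (PiL B). merge A B (x, y) \<in> Z} y \<partial>PiL B)"
      by (intro nn_integral_cong) (auto simp: indicator_def)
    then show "(\<integral>\<^sup>+ y. indicator Z (merge A B (x, y)) \<partial>PiL B)
        = emeasure (PiL B) {y \<in> space (PiL B). merge A B (x, y) \<in> Z}" by simp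
  qed
  finally show ?thesis .
qed

lemma merge_in_simplex:
  assumes "A \<inter> B = {}"
  shows "C \<subseteq> A \<Longrightarrow> merge A B (x, y) \<in> orthant_simplex C t \<longleftrightarrow> x \<in> orthant_simplex C t"
    and "C \<subseteq> B \<Longrightarrow> merge A B (x, y) \<in> orthant_simplex C t \<longleftrightarrow> y \<in> orthant_simplex C t"
  using assms by (intro orthant_simplex_cong; auto simp: merge_def)+

lemma emeasure_simplex_power:
  assumes fin: "\<And>a. finite (J a)" and card: "\<And>a. card (J a) = q"
    and disj: "\<And>a b. a \<noteq> b \<Longrightarrow> J a \<inter> J b = {}" and t: "0 \<le> (t::real)"
  shows "emeasure (PiL (\<Union>a<n. J a)) {x \<in> space (PiL (\<Union>a<n. J a)). \<forall>a<n. x \<in> orthant_simplex (J a) t}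
    = ennreal ((t ^ q / fact q) ^ n)"
proof (induction n)
  case 0
  have "space (PiL {}) = {\<lambda>_. undefined}" by (simp add: space_PiM)
  then show ?case by (simp add: PiM_empty)
next
  case (Suc n)
  let ?A = "\<Union>a<n. J a" and ?B = "J n"
  let ?P = "{x \<in> space (PiL ?A). \<forall>a<n. x \<in> orthant_simplex (J a) t}"
  let ?Q = "{x \<in> space (PiL ?B). x \<in> orthant_simplex ?B t}"
  let ?Z = "{x \<in> space (PiL (?A \<union> ?B)). \<forall>a<Suc n. x \<in> orthant_simplex (J a) t}"
  have "J a \<inter> ?B = {}" if "a < n" for a using disj[of a n] that by simp
  then have AB: "finite ?A" "finite ?B" "?A \<inter> ?B = {}" using fin by auto
  have sets: "{x \<in> space (PiL B). \<forall>a<k. x \<in> orthant_simplex (J a) t} \<in> sets (PiL B)"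
    if "finite B" "(\<Union>a<k. J a) \<subseteq> B" for B k
  proof -
    have "{x \<in> space (PiL B). \<forall>a\<in>{..<k}. x \<in> orthant_simplex (J a) t} \<in> sets (PiL B)"
      by (intro sets.sets_Collect_finite_All sets_orthant_simplex) (use that in auto)
    then show ?thesis unfolding Ball_def lessThan_iff .
  qed
  have UN: "(\<Union>a<Suc n. J a) = ?A \<union> ?B" by (auto simp: less_Suc_eq)
  have "emeasure (PiL (?A \<union> ?B)) ?Z
      = (\<integral>\<^sup>+ x. emeasure (PiL ?B) {y \<in> space (PiL ?B). merge ?A ?B (x, y) \<in> ?Z} \<partial>PiL ?A)"
    using AB by (intro emeasure_PiL_fold sets) (auto simp: less_Suc_eq)
  also have "\<dots> = (\<integral>\<^sup>+ x. emeasure (PiL ?B) ?Q * indicator ?P x \<partial>PiL ?A)"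
  proof (rule nn_integral_cong)
    fix x assume x: "x \<in> space (PiL ?A)"
    have sp: "merge ?A ?B (x, y) \<in> space (PiL (?A \<union> ?B))" if "y \<in> space (PiL ?B)" for y
      using that x by (auto simp: space_PiM merge_def PiE_iff extensional_def)
    have "merge ?A ?B (x, y) \<in> ?Z \<longleftrightarrow> x \<in> ?P \<and> y \<in> ?Q" if "y \<in> space (PiL ?B)" for y
    proof -
      have "(\<forall>a<Suc n. merge ?A ?B (x, y) \<in> orthant_simplex (J a) t)
          \<longleftrightarrow> (\<forall>a<n. x \<in> orthant_simplex (J a) t) \<and> y \<in> orthant_simplex ?B t"
        unfolding All_less_Suc using merge_in_simplex[OF AB(3)]
        by (metis (no_types, lifting) UN_upper lessThan_iff order_refl)
      then show ?thesis using sp[OF that] x that by simp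
    qed
    then have "{y \<in> space (PiL ?B). merge ?A ?B (x, y) \<in> ?Z} = (if x \<in> ?P then ?Q else {})"
      by auto
    then show "emeasure (PiL ?B) {y \<in> space (PiL ?B). merge ?A ?B (x, y) \<in> ?Z}
        = emeasure (PiL ?B) ?Q * indicator ?P x"
      by (simp only:) (simp add: indicator_def)
  qed
  also have "\<dots> = emeasure (PiL ?B) ?Q * emeasure (PiL ?A) ?P"
    using sets[OF AB(1) order_refl] by (rule nn_integral_cmult_indicator)
  also have "\<dots> = ennreal (t ^ q / fact q) * ennreal ((t ^ q / fact q) ^ n)"
    using Suc.IH emeasure_orthant_simplex[OF fin t, of n] by (simp add: card)
  also have "\<dots> = ennreal ((t ^ q / fact q) ^ Suc n)"
    using t by (simp flip: ennreal_mult)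
  finally show ?case unfolding UN .
qed

text \<open>
  The fibre over \<open>x\<close> is a product of \<open>n\<close> simplices of size \<open>1 - sum x {..<k}\<close>, whose volume is a
  constant multiple of that of one simplex of the same size and the same dimension \<open>n * q\<close>; the
  integral of the latter is the volume of the standard simplex of dimension \<open>k + n * q\<close>.
\<close>

lemma emeasure_simplex_fibration:
  assumes n: "0 < n"
  shows "emeasure (PiL {..<k + n * q}) {y \<in> space (PiL {..<k + n * q}). (\<forall>i<k. 0 \<le> y i) \<and>
      (\<forall>a<n. y \<in> orthant_simplex {k + a * q..<k + a * q + q} (1 - sum y {..<k}))}
    = ennreal (fact (n * q) / (fact q ^ n * fact (k + n * q)))"
proof -
  let ?A = "{..<k}" and ?B = "{k..<k + n * q}" and ?J = "\<lambda>a. {k + a * q..<k + a * q + q}"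
  let ?C = "\<lambda>y. (\<forall>i<k. 0 \<le> y i) \<and> (\<forall>a<n. y \<in> orthant_simplex (?J a) (1 - sum y ?A))"
  let ?K = "fact (n * q) / fact q ^ n :: real"
  have AB: "finite ?A" "finite ?B" "?A \<inter> ?B = {}" and un: "?A \<union> ?B = {..<k + n * q}" by auto
  have J_le: "a * q + q \<le> n * q" if "a < n" for a
    using mult_le_mono1[of "Suc a" n q] that by simp
  have UJ: "(\<Union>a<n. ?J a) = ?B"
  proof (intro equalityI subsetI)
    fix i assume "i \<in> (\<Union>a<n. ?J a)"
    then obtain a where "a < n" "i \<in> ?J a" by blast
    then show "i \<in> ?B" using J_le[of a] by auto
  next
    fix i assume i: "i \<in> ?B"
    then have q: "q > 0" by (cases q) auto
    let ?a = "(i - k) div q"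
    have "?a < n" using i q by (auto simp: div_less_iff_less_mult)
    moreover have "?a * q \<le> i - k" "i - k < ?a * q + q"
      using div_times_less_eq_dividend[of "i - k" q] dividend_less_div_times[OF q, of "i - k"] by simp_all
    then have "i \<in> ?J ?a" using i unfolding atLeastLessThan_iff by linarith
    ultimately show "i \<in> (\<Union>a<n. ?J a)" by blast
  qed
  have disj: "?J a \<inter> ?J b = {}" if "a \<noteq> b" for a b
  proof -
    have "a * q + q \<le> b * q \<or> b * q + q \<le> a * q"
      using that mult_le_mono1[of "Suc a" b q] mult_le_mono1[of "Suc b" a q] by (auto simp: nat_neq_iff)
    then show ?thesis by auto
  qed
  have sums: "sum (merge ?A ?B (x, y)) ?A = sum x ?A" for x y
    by (intro sum.cong) (auto simp: merge_def)
  let ?Z = "{y \<in> space (PiL (?A \<union> ?B)). ?C y}"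
  let ?W = "{y \<in> space (PiL (?A \<union> ?B)). y \<in> orthant_simplex (?A \<union> ?B) 1}"
  have Z: "?Z \<in> sets (PiL (?A \<union> ?B))"
  proof -
    have comp: "(\<lambda>x. x i) \<in> borel_measurable (PiL (?A \<union> ?B))" if "i \<in> ?A \<union> ?B" for i
      using measurable_component_singleton[of i "?A \<union> ?B" "\<lambda>_. lborel :: real measure"] that by auto
    have J: "?J a \<subseteq> ?A \<union> ?B" if "a < n" for a using UJ that by blast
    have ge: "{y \<in> space (PiL (?A \<union> ?B)). 0 \<le> y i} \<in> sets (PiL (?A \<union> ?B))" if "i \<in> ?A \<union> ?B" for i
      using comp[OF that] by measurable
    have S: "(\<lambda>y. sum y D) \<in> borel_measurable (PiL (?A \<union> ?B))" if "D \<subseteq> ?A \<union> ?B" for D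
      using comp that by (intro borel_measurable_sum) auto
    have le: "{y \<in> space (PiL (?A \<union> ?B)). sum y (?J a) \<le> 1 - sum y ?A} \<in> sets (PiL (?A \<union> ?B))" if "a < n" for a
      using S[OF J[OF that]] S[of ?A] by measurable
    have "?Z = {y \<in> space (PiL (?A \<union> ?B)). (\<forall>i\<in>{..<k}. 0 \<le> y i) \<and>
        (\<forall>a\<in>{..<n}. (\<forall>i\<in>?J a. 0 \<le> y i) \<and> sum y (?J a) \<le> 1 - sum y ?A)}"
      by (auto simp: orthant_simplex_def)
    also have "\<dots> \<in> sets (PiL (?A \<union> ?B))"
      by (intro sets.sets_Collect_conj sets.sets_Collect_finite_All ge le) (use J in \<open>blast | simp\<close>)+
    finally show ?thesis .
  qed
  have W: "?W \<in> sets (PiL (?A \<union> ?B))" by (rule sets_orthant_simplex) auto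
  have sp: "merge ?A ?B (x, y) \<in> space (PiL (?A \<union> ?B))" if "x \<in> space (PiL ?A)" "y \<in> space (PiL ?B)" for x y
    using that by (auto simp: space_PiM merge_def PiE_iff extensional_def)
  have "emeasure (PiL (?A \<union> ?B)) ?Z
      = (\<integral>\<^sup>+ x. emeasure (PiL ?B) {y \<in> space (PiL ?B). merge ?A ?B (x, y) \<in> ?Z} \<partial>PiL ?A)"
    by (rule emeasure_PiL_fold[OF AB Z])
  also have "\<dots> = (\<integral>\<^sup>+ x. ennreal ?K * emeasure (PiL ?B) {y \<in> space (PiL ?B). merge ?A ?B (x, y) \<in> ?W} \<partial>PiL ?A)"
  proof (rule nn_integral_cong)
    fix x assume x: "x \<in> space (PiL ?A)"
    define t where "t = 1 - sum x ?A"
    have Zx: "merge ?A ?B (x, y) \<in> ?Z \<longleftrightarrow>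
        (\<forall>i<k. 0 \<le> x i) \<and> (\<forall>a<n. y \<in> orthant_simplex (?J a) t)" if "y \<in> space (PiL ?B)" for y
    proof -
      have "merge ?A ?B (x, y) \<in> orthant_simplex (?J a) t \<longleftrightarrow> y \<in> orthant_simplex (?J a) t" if "a < n" for a
        using merge_in_simplex(2)[OF AB(3)] UJ that by blast
      then show ?thesis using sp[OF x that] sums by (auto simp: t_def merge_def)
    qed
    have Wx: "merge ?A ?B (x, y) \<in> ?W \<longleftrightarrow> (\<forall>i<k. 0 \<le> x i) \<and> y \<in> orthant_simplex ?B t"
      if "y \<in> space (PiL ?B)" for y
    proof -
      have "sum (merge ?A ?B (x, y)) (?A \<union> ?B) = sum x ?A + sum y ?B"
        using AB sums by (subst sum.union_disjoint) (auto simp: merge_def intro!: sum.cong)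
      moreover have "(\<forall>i\<in>?A \<union> ?B. 0 \<le> merge ?A ?B (x, y) i) \<longleftrightarrow> (\<forall>i<k. 0 \<le> x i) \<and> (\<forall>i\<in>?B. 0 \<le> y i)"
        using AB by (auto simp: merge_def)
      ultimately show ?thesis using sp[OF x that] by (auto simp: orthant_simplex_def t_def)
    qed
    show "emeasure (PiL ?B) {y \<in> space (PiL ?B). merge ?A ?B (x, y) \<in> ?Z}
        = ennreal ?K * emeasure (PiL ?B) {y \<in> space (PiL ?B). merge ?A ?B (x, y) \<in> ?W}"
    proof (cases "(\<forall>i<k. 0 \<le> x i) \<and> 0 \<le> t")
      case False
      \<comment> \<open>At least one block is needed here: it is a simplex of size \<open>t\<close>
        that excludes a negative \<open>t\<close>.\<close>
      have "{y \<in> space (PiL ?B). merge ?A ?B (x, y) \<in> ?Z} = {}"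
        using False n Zx orthant_simplex_neg by blast
      moreover have "{y \<in> space (PiL ?B). merge ?A ?B (x, y) \<in> ?W} = {}"
        using False Wx orthant_simplex_neg by blast
      ultimately show ?thesis by (simp only: emeasure_empty mult_zero_right)
    next
      case True
      have "{y \<in> space (PiL ?B). merge ?A ?B (x, y) \<in> ?Z}
          = {y \<in> space (PiL (\<Union>a<n. ?J a)). \<forall>a<n. y \<in> orthant_simplex (?J a) t}"
        unfolding UJ using Zx True by blast
      then have "emeasure (PiL ?B) {y \<in> space (PiL ?B). merge ?A ?B (x, y) \<in> ?Z} = ennreal ((t ^ q / fact q) ^ n)"
        using emeasure_simplex_power[of ?J q t n] disj True by (simp only: UJ) simp
      moreover have "{y \<in> space (PiL ?B). merge ?A ?B (x, y) \<in> ?W} = {y \<in> space (PiL ?B). y \<in> orthant_simplex ?B t}"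
        using Wx True by blast
      then have "emeasure (PiL ?B) {y \<in> space (PiL ?B). merge ?A ?B (x, y) \<in> ?W} = ennreal (t ^ (n * q) / fact (n * q))"
        using emeasure_orthant_simplex[of ?B t] True by simp
      \<comment> \<open>The ratio of the two fibre volumes is free of \<open>t\<close>; this is what
        allows the exchange of fibres.\<close>
      moreover have "(t ^ q / fact q) ^ n = ?K * (t ^ (n * q) / fact (n * q))"
        by (simp add: power_divide mult.commute flip: power_mult)
      ultimately show ?thesis using True by (simp flip: ennreal_mult)
    qed
  qed
  also have "\<dots> = ennreal ?K * (\<integral>\<^sup>+ x. emeasure (PiL ?B) {y \<in> space (PiL ?B). merge ?A ?B (x, y) \<in> ?W} \<partial>PiL ?A)"
  proof (rule nn_integral_cmult)
    interpret product_sigma_finite "\<lambda>_::nat. lborel :: real measure" by standard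
    interpret B: sigma_finite_measure "PiL ?B" by (rule sigma_finite) simp
    have "merge ?A ?B -` ?W \<inter> space (PiL ?A \<Otimes>\<^sub>M PiL ?B) \<in> sets (PiL ?A \<Otimes>\<^sub>M PiL ?B)"
      by (rule measurable_sets[OF measurable_merge W])
    from B.measurable_emeasure_Pair[OF this]
    have "(\<lambda>x. emeasure (PiL ?B) (Pair x -` (merge ?A ?B -` ?W \<inter> space (PiL ?A \<Otimes>\<^sub>M PiL ?B))))
        \<in> borel_measurable (PiL ?A)" .
    moreover have "Pair x -` (merge ?A ?B -` ?W \<inter> space (PiL ?A \<Otimes>\<^sub>M PiL ?B))
        = {y \<in> space (PiL ?B). merge ?A ?B (x, y) \<in> ?W}" if "x \<in> space (PiL ?A)" for x
      using that by (auto simp: space_pair_measure)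
    ultimately show "(\<lambda>x. emeasure (PiL ?B) {y \<in> space (PiL ?B). merge ?A ?B (x, y) \<in> ?W})
        \<in> borel_measurable (PiL ?A)"
      by (simp cong: measurable_cong)
  qed
  also have "(\<integral>\<^sup>+ x. emeasure (PiL ?B) {y \<in> space (PiL ?B). merge ?A ?B (x, y) \<in> ?W} \<partial>PiL ?A)
      = emeasure (PiL (?A \<union> ?B)) ?W"
    by (rule emeasure_PiL_fold[OF AB W, symmetric])
  also have "\<dots> = ennreal (1 / fact (k + n * q))"
    using emeasure_orthant_simplex[of "?A \<union> ?B" 1] unfolding un by simp
  also have "ennreal ?K * \<dots> = ennreal (fact (n * q) / (fact q ^ n * fact (k + n * q)))"
    by (simp flip: ennreal_mult)
  finally show ?thesis unfolding un .
qed

section \<open>Coordinates on the flats of the flow complex\<close>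

text \<open>An affine map is determined by its values at the origin and at the unit vectors; for
  affine \<open>F\<close> these values form the frame whose chart is \<open>F\<close>.\<close>

definition form_frame :: "((nat \<Rightarrow> real) \<Rightarrow> 'e \<Rightarrow> real) \<Rightarrow> nat \<Rightarrow> 'e \<Rightarrow> real" where
  "form_frame F k = (case k of 0 \<Rightarrow> F (\<lambda>_. 0) | Suc i \<Rightarrow> F (\<lambda>j. if j = i then 1 else 0))"

lemma affine_chart_form_frame:
  assumes "\<And>e. affine_form d (\<lambda>y. F y e)"
  shows "affine_chart d (form_frame F) y = F y"
proof
  fix e
  obtain k c where F: "\<And>y. F y e = k + (\<Sum>i<d. c i * y i)"
    using assms[of e] unfolding affine_form_def by blast
  have "F (\<lambda>j. if j = i then 1 else 0) e = k + c i" if "i < d" for i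
    using that by (simp add: F mult_delta_right)
  then show "affine_chart d (form_frame F) y e = F y e"
    by (simp add: affine_chart_apply form_frame_def F mult.commute)
qed

context nested
begin

definition N where "N = (c + 1) * (p - 1)"

definition dm where "dm = c + N"

text \<open>
  Coordinates \<open>y\<close> of a flow: \<open>y (a - 1)\<close> is the flow on the arc of cycle \<open>a\<close> selected by
  \<open>\<beta> a\<close>, and \<open>y (idx a j)\<close> is the flow on \<open>blue a j\<close> for \<open>j < p\<close>.
\<close>

definition idx :: "nat \<Rightarrow> nat \<Rightarrow> nat" where
  "idx a j = c + a * (p - 1) + (j - 1)"

text \<open>The blue total of every layer, as dictated by the normalization when the
  \<open>y i\<close> with \<open>i < c\<close> are the selected red values.\<close>

definition through :: "(nat \<Rightarrow> real) \<Rightarrow> real" where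
  "through y = 1 - (\<Sum>i<c. y i)"

definition bflow :: "(nat \<Rightarrow> real) \<Rightarrow> nat \<Rightarrow> nat \<Rightarrow> real" where
  "bflow y a j = (if j < p then y (idx a j) else through y - (\<Sum>k\<in>{1..<p}. y (idx a k)))"

text \<open>Partial sums of the blue imbalance across layer \<open>a\<close>. By conservation the
  red flow on arc \<open>b\<close> exceeds that on arc \<open>p\<close> by this amount, whatever the
  selection.\<close>

definition excess :: "(nat \<Rightarrow> real) \<Rightarrow> nat \<Rightarrow> nat \<Rightarrow> real" where
  "excess y a j = (\<Sum>i\<in>{1..j}. bflow y (a - 1) i - bflow y a i)"

text \<open>A red arc is recognized by tail and head in the same layer. Subtracting the excess at
  \<open>\<beta> a\<close> normalizes the red flow to \<open>y (a - 1)\<close> on the selected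
  arc.\<close>

definition flow :: "(nat \<Rightarrow> nat) \<Rightarrow> (nat \<Rightarrow> real) \<Rightarrow> (nat \<times> nat) \<times> (nat \<times> nat) \<Rightarrow> real" where
  "flow \<beta> y e = (if e \<notin> arcs G then 0
     else if fst (snd e) \<noteq> fst (fst e) then bflow y (fst (fst e)) (snd (fst e))
     else y (fst (fst e) - 1) + excess y (fst (fst e)) (snd (fst e)) - excess y (fst (fst e)) (\<beta> (fst (fst e))))"

definition coord :: "(nat \<Rightarrow> nat) \<Rightarrow> ((nat \<times> nat) \<times> (nat \<times> nat) \<Rightarrow> real) \<Rightarrow> nat \<Rightarrow> real" where
  "coord \<beta> f = (\<lambda>i\<in>{..<dm}. if i < c then f (red (i + 1) (\<beta> (i + 1)))
     else f (blue ((i - c) div (p - 1)) ((i - c) mod (p - 1) + 1)))"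

definition selections :: "(nat \<Rightarrow> nat) set" where
  "selections = {1..c} \<rightarrow>\<^sub>E {1..p}"

text \<open>Contains the part of the flow complex where the selected arcs carry the minima: there
  each minimum is the value of the flow at a fixed arc, and the normalization becomes
  affine.\<close>

definition flat :: "(nat \<Rightarrow> nat) \<Rightarrow> ((nat \<times> nat) \<times> (nat \<times> nat) \<Rightarrow> real) set" where
  "flat \<beta> = {f. (\<forall>e. e \<notin> arcs G \<longrightarrow> f e = 0) \<and> (\<forall>a\<in>{1..c}. \<forall>b\<in>{1..p}. netflow G f (a, b) = 0) \<and>
     (\<Sum>b\<in>{1..p}. f (blue 0 b)) + (\<Sum>a\<in>{1..c}. f (red a (\<beta> a))) = 1}"

section \<open>Enumeration of the blue coordinates\<close>

lemma idx_less: "a \<le> c \<Longrightarrow> 1 \<le> j \<Longrightarrow> j < p \<Longrightarrow> idx a j < dm"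
proof -
  assume a: "a \<le> c" "1 \<le> j" "j < p"
  have "a * (p - 1) + (j - 1) < a * (p - 1) + (p - 1)" using a by simp
  also have "\<dots> = Suc a * (p - 1)" by simp
  also have "\<dots> \<le> N" unfolding N_def using a by (intro mult_le_mono1) simp
  finally show ?thesis by (simp add: idx_def dm_def)
qed

lemma idx_decode:
  assumes "1 \<le> j" "j < p"
  shows "\<not> idx a j < c" "(idx a j - c) div (p - 1) = a" "(idx a j - c) mod (p - 1) + 1 = j"
proof -
  have *: "idx a j - c = a * (p - 1) + (j - 1)" "j - 1 < p - 1" using assms by (simp_all add: idx_def)
  show "\<not> idx a j < c" by (simp add: idx_def)
  show "(idx a j - c) div (p - 1) = a" unfolding *(1) using *(2) by (simp only: div_mult_self3) simp
  show "(idx a j - c) mod (p - 1) + 1 = j" unfolding *(1) using *(2) assms(1) by (simp only: mod_mult_self3) simp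
qed

lemma idx_encode:
  assumes "c \<le> i" "i < dm"
  shows "(i - c) div (p - 1) \<le> c" "(i - c) mod (p - 1) + 1 < p"
    "idx ((i - c) div (p - 1)) ((i - c) mod (p - 1) + 1) = i"
proof -
  have i: "i - c < (c + 1) * (p - 1)" using assms by (simp add: dm_def N_def)
  then have "0 < p - 1" by (cases "p - 1") auto
  have "(i - c) div (p - 1) < c + 1" using i \<open>0 < p - 1\<close> by (simp only: div_less_iff_less_mult)
  then show "(i - c) div (p - 1) \<le> c" by simp
  have "(i - c) mod (p - 1) < p - 1" using \<open>0 < p - 1\<close> by (rule mod_less_divisor)
  then show "(i - c) mod (p - 1) + 1 < p" by simp
  have "(i - c) div (p - 1) * (p - 1) + (i - c) mod (p - 1) = i - c" by (rule div_mult_mod_eq)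
  then show "idx ((i - c) div (p - 1)) ((i - c) mod (p - 1) + 1) = i"
    using assms unfolding idx_def by linarith
qed

section \<open>Affine parametrization of a flat\<close>

lemma flow_blue: "a \<le> c \<Longrightarrow> b \<in> {1..p} \<Longrightarrow> flow \<beta> y (blue a b) = bflow y a b"
  by (simp add: flow_def) (simp add: blue_def)

lemma flow_red: "a \<in> {1..c} \<Longrightarrow> b \<in> {1..p} \<Longrightarrow>
    flow \<beta> y (red a b) = y (a - 1) + excess y a b - excess y a (\<beta> a)"
  by (simp add: flow_def) (simp add: red_def)

lemma flow_outside: "e \<notin> arcs G \<Longrightarrow> flow \<beta> y e = 0"
  by (simp add: flow_def)

lemma interval_split_last: "{1..p} = insert p {1..<p}"
  using p by auto

lemma sum_bflow: "(\<Sum>b\<in>{1..p}. bflow y a b) = through y"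
proof -
  have "(\<Sum>b\<in>{1..p}. bflow y a b) = bflow y a p + (\<Sum>b\<in>{1..<p}. bflow y a b)"
    unfolding interval_split_last by (rule sum.insert) auto
  also have "(\<Sum>b\<in>{1..<p}. bflow y a b) = (\<Sum>b\<in>{1..<p}. y (idx a b))"
    by (rule sum.cong) (auto simp: bflow_def)
  finally show ?thesis by (simp add: bflow_def)
qed

text \<open>Consecutive layers carry the same blue total, so the red flow closes up around the
  cycle.\<close>

lemma excess_p: "excess y a p = 0"
  by (simp only: excess_def sum_subtractf sum_bflow diff_self)

lemma netflow_zero_iff:
  fixes f :: "(nat \<times> nat) \<times> (nat \<times> nat) \<Rightarrow> real"
  assumes "a \<in> {1..c}"
  shows "(\<forall>b\<in>{1..p}. netflow G f (a, b) = 0) \<longleftrightarrow>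
    (\<forall>b\<in>{1..p}. f (red a b) = f (red a p) + (\<Sum>i\<in>{1..b}. f (blue (a - 1) i) - f (blue a i)))"
  unfolding cyclic_recurrence_iff[of "\<lambda>b. f (red a b)" "\<lambda>i. f (blue (a - 1) i) - f (blue a i)", symmetric]
  using netflow_internal[OF assms, of _ f] by (intro ball_cong) auto

lemma flow_in_flat: "flow \<beta> y \<in> flat \<beta>" if \<beta>: "\<beta> \<in> selections"
proof -
  have "\<forall>b\<in>{1..p}. netflow G (flow \<beta> y) (a, b) = 0" if a: "a \<in> {1..c}" for a
    unfolding netflow_zero_iff[OF a]
  proof
    fix b assume b: "b \<in> {1..p}"
    have "(\<Sum>i\<in>{1..b}. flow \<beta> y (blue (a - 1) i) - flow \<beta> y (blue a i)) = excess y a b"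
      unfolding excess_def using a b by (intro sum.cong arg_cong2[where f = "(-)"] flow_blue) auto
    then show "flow \<beta> y (red a b)
        = flow \<beta> y (red a p) + (\<Sum>i\<in>{1..b}. flow \<beta> y (blue (a - 1) i) - flow \<beta> y (blue a i))"
      using a b p by (simp add: flow_red excess_p)
  qed
  moreover have "(\<Sum>b\<in>{1..p}. flow \<beta> y (blue 0 b)) = through y"
    unfolding sum_bflow[of y 0, symmetric] by (intro sum.cong flow_blue) auto
  moreover have "(\<Sum>a\<in>{1..c}. flow \<beta> y (red a (\<beta> a))) = (\<Sum>i<c. y i)"
  proof -
    have "(\<Sum>a\<in>{1..c}. flow \<beta> y (red a (\<beta> a))) = (\<Sum>a\<in>{1..c}. y (a - 1))"
    proof (rule sum.cong[OF refl])
      fix a assume a: "a \<in> {1..c}"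
      then have "\<beta> a \<in> {1..p}" using \<beta> by (auto simp: selections_def)
      then show "flow \<beta> y (red a (\<beta> a)) = y (a - 1)" using flow_red[OF a] by simp
    qed
    also have "\<dots> = (\<Sum>i<c. y i)"
      by (rule sum.reindex_bij_witness[of _ Suc "\<lambda>a. a - 1"]) auto
    finally show ?thesis .
  qed
  ultimately show ?thesis by (simp add: flat_def flow_outside through_def)
qed

lemma coord_in_E: "coord \<beta> f \<in> {..<dm} \<rightarrow>\<^sub>E UNIV"
  by (simp add: coord_def)

lemma coord_flow:
  assumes \<beta>: "\<beta> \<in> selections" and y: "y \<in> {..<dm} \<rightarrow>\<^sub>E UNIV"
  shows "coord \<beta> (flow \<beta> y) = y"
proof (rule PiE_ext[OF coord_in_E y])
  fix i assume i: "i \<in> {..<dm}"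
  show "coord \<beta> (flow \<beta> y) i = y i"
  proof (cases "i < c")
    case True
    then have "\<beta> (i + 1) \<in> {1..p}" using \<beta> by (auto simp: selections_def)
    then have "flow \<beta> y (red (i + 1) (\<beta> (i + 1))) = y i" using True by (subst flow_red) auto
    then show ?thesis using True i by (simp add: coord_def)
  next
    case False
    let ?a = "(i - c) div (p - 1)" and ?j = "(i - c) mod (p - 1) + 1"
    have *: "?a \<le> c" "?j < p" "idx ?a ?j = i" using idx_encode[of i] False i by auto
    have "flow \<beta> y (blue ?a ?j) = bflow y ?a ?j" using * by (intro flow_blue) auto
    also have "\<dots> = y i" using * by (simp only: bflow_def if_True)
    finally show ?thesis using False i by (simp add: coord_def)
  qed
qed

lemma layer_sum:
  fixes f :: "(nat \<times> nat) \<times> (nat \<times> nat) \<Rightarrow> real"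
  assumes f: "\<forall>a\<in>{1..c}. \<forall>b\<in>{1..p}. netflow G f (a, b) = 0" and a: "a \<le> c"
  shows "(\<Sum>b\<in>{1..p}. f (blue a b)) = (\<Sum>b\<in>{1..p}. f (blue 0 b))"
  using a
proof (induction a)
  case (Suc a)
  have "\<forall>b\<in>{1..p}. netflow G f (Suc a, b) = 0" using f Suc.prems by auto
  then have "\<forall>b\<in>{1..p}. f (red (Suc a) b)
      = f (red (Suc a) p) + (\<Sum>i\<in>{1..b}. f (blue (Suc a - 1) i) - f (blue (Suc a) i))"
    using Suc.prems by (intro iffD1[OF netflow_zero_iff]) simp_all
  from bspec[OF this, of p] have "(\<Sum>i\<in>{1..p}. f (blue a i) - f (blue (Suc a) i)) = 0"
    using p by simp
  then have "(\<Sum>b\<in>{1..p}. f (blue a b)) = (\<Sum>b\<in>{1..p}. f (blue (Suc a) b))"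
    by (simp add: sum_subtractf)
  then show ?case using Suc by simp
qed simp

text \<open>The blue values with \<open>b < p\<close> are coordinates and the last one is the
  remainder of the layer total. The red values then follow from conservation, with the free constant
  of each cycle fixed at its selected arc.\<close>

lemma flow_coord:
  assumes \<beta>: "\<beta> \<in> selections" and f: "f \<in> flat \<beta>"
  shows "flow \<beta> (coord \<beta> f) = f"
proof
  let ?y = "coord \<beta> f"
  have net: "\<forall>a\<in>{1..c}. \<forall>b\<in>{1..p}. netflow G f (a, b) = 0" using f by (simp add: flat_def)
  have yc: "?y i = f (red (i + 1) (\<beta> (i + 1)))" if "i < c" for i
    using that by (simp add: coord_def dm_def)
  have "(\<Sum>i<c. ?y i) = (\<Sum>a\<in>{1..c}. f (red a (\<beta> a)))"
    by (rule sum.reindex_bij_witness[of _ "\<lambda>a. a - 1" Suc]) (auto simp: yc)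
  then have th: "through ?y = (\<Sum>b\<in>{1..p}. f (blue 0 b))" using f by (simp add: flat_def through_def)
  have yb: "?y (idx a j) = f (blue a j)" if "a \<le> c" "1 \<le> j" "j < p" for a j
    using idx_less[OF that] idx_decode[OF that(2,3)] by (simp add: coord_def)
  have bl: "bflow ?y a b = f (blue a b)" if a: "a \<le> c" and b: "b \<in> {1..p}" for a b
  proof (cases "b < p")
    case False
    have "(\<Sum>k\<in>{1..<p}. ?y (idx a k)) = (\<Sum>k\<in>{1..<p}. f (blue a k))"
      using yb a by (intro sum.cong) auto
    moreover have "(\<Sum>k\<in>{1..p}. f (blue a k)) = f (blue a p) + (\<Sum>k\<in>{1..<p}. f (blue a k))"
      unfolding interval_split_last by (rule sum.insert) auto
    ultimately show ?thesis using False b th layer_sum[OF net a] by (simp add: bflow_def)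
  qed (use yb that in \<open>auto simp: bflow_def\<close>)
  fix e
  consider "e \<notin> arcs G" | a b where "e = blue a b" "a \<le> c" "b \<in> {1..p}"
    | a b where "e = red a b" "a \<in> {1..c}" "b \<in> {1..p}"
    unfolding arcs_iff by blast
  then show "flow \<beta> ?y e = f e"
  proof cases
    case 1
    then have "f e = 0" using f unfolding flat_def by blast
    then show ?thesis using flow_outside[OF 1] by (simp only:)
  next
    case 2
    then show ?thesis using flow_blue bl by simp
  next
    case 3
    have "\<forall>b\<in>{1..p}. f (red a b) = f (red a p) + excess ?y a b"
    proof
      fix b assume b: "b \<in> {1..p}"
      have "excess ?y a b = (\<Sum>i\<in>{1..b}. f (blue (a - 1) i) - f (blue a i))"
        unfolding excess_def using 3 b by (intro sum.cong arg_cong2[where f = "(-)"] bl) auto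
      moreover have "f (red a b) = f (red a p) + (\<Sum>i\<in>{1..b}. f (blue (a - 1) i) - f (blue a i))"
        by (rule bspec[OF iffD1[OF netflow_zero_iff[OF 3(2)] bspec[OF net 3(2)]] b])
      ultimately show "f (red a b) = f (red a p) + excess ?y a b" by (simp only:)
    qed
    moreover have "\<beta> a \<in> {1..p}" using \<beta> 3 by (auto simp: selections_def)
    ultimately have "f (red a b) - f (red a (\<beta> a)) = excess ?y a b - excess ?y a (\<beta> a)"
      using 3 by (metis add_diff_cancel_left)
    moreover have "a - 1 < c" "a - 1 + 1 = a" using 3(2) by auto
    then have "?y (a - 1) = f (red a (\<beta> a))" using yc[of "a - 1"] by (simp only:)
    ultimately show ?thesis using flow_red[OF 3(2,3), of \<beta> ?y] unfolding 3(1) by linarith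
  qed
qed

lemma form_through: "affine_form dm through"
  unfolding through_def by (intro affine_form_diff affine_form_const affine_form_sum affine_form_coord) (simp add: dm_def)

lemma form_bflow: "a \<le> c \<Longrightarrow> b \<in> {1..p} \<Longrightarrow> affine_form dm (\<lambda>y. bflow y a b)"
  unfolding bflow_def
  by (cases "b < p") (auto intro!: affine_form_diff form_through affine_form_sum affine_form_coord idx_less)

lemma form_excess: "a \<in> {1..c} \<Longrightarrow> b \<in> {1..p} \<Longrightarrow> affine_form dm (\<lambda>y. excess y a b)"
  unfolding excess_def by (intro affine_form_sum affine_form_diff form_bflow) auto

lemma form_flow: "\<beta> \<in> selections \<Longrightarrow> affine_form dm (\<lambda>y. flow \<beta> y e)"
proof -
  assume \<beta>: "\<beta> \<in> selections"
  consider "e \<notin> arcs G" | a b where "e = blue a b" "a \<le> c" "b \<in> {1..p}"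
    | a b where "e = red a b" "a \<in> {1..c}" "b \<in> {1..p}"
    unfolding arcs_iff by blast
  then show ?thesis
  proof cases
    case 3
    then have "\<beta> a \<in> {1..p}" using \<beta> by (auto simp: selections_def)
    moreover have "affine_form dm (\<lambda>y. y (a - 1))" using 3 by (intro affine_form_coord) (auto simp: dm_def)
    ultimately show ?thesis using 3 unfolding 3(1) flow_red[OF 3(2,3)]
      by (intro affine_form_diff affine_form_add form_excess) auto
  qed (simp_all add: flow_outside flow_blue form_bflow)
qed

lemma chart_flow: "\<beta> \<in> selections \<Longrightarrow> affine_chart dm (form_frame (flow \<beta>)) y = flow \<beta> y"
  by (intro affine_chart_form_frame form_flow)

lemma flow_integral:
  assumes \<beta>: "\<beta> \<in> selections" and y: "y \<in> {..<dm} \<rightarrow>\<^sub>E \<int>"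
  shows "flow \<beta> y \<in> integer_points"
proof -
  have yi: "y i \<in> \<int>" if "i < dm" for i using y that by auto
  have "through y \<in> \<int>" unfolding through_def by (intro Ints_diff Ints_1 Ints_sum yi) (auto simp: dm_def)
  then have bl: "bflow y a b \<in> \<int>" if "a \<le> c" "b \<in> {1..p}" for a b
    unfolding bflow_def using that by (auto intro!: Ints_diff Ints_sum yi idx_less)
  have ex: "excess y a b \<in> \<int>" if "a \<in> {1..c}" "b \<in> {1..p}" for a b
    unfolding excess_def using that by (intro Ints_sum Ints_diff bl) auto
  have "flow \<beta> y e \<in> \<int>" for e
  proof -
    consider "e \<notin> arcs G" | a b where "e = blue a b" "a \<le> c" "b \<in> {1..p}"
      | a b where "e = red a b" "a \<in> {1..c}" "b \<in> {1..p}"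
      unfolding arcs_iff by blast
    then show ?thesis
    proof cases
      case 3
      then have "\<beta> a \<in> {1..p}" using \<beta> by (auto simp: selections_def)
      moreover have "y (a - 1) \<in> \<int>" using 3 by (intro yi) (auto simp: dm_def)
      ultimately show ?thesis using 3 unfolding 3(1) flow_red[OF 3(2,3)]
        by (intro Ints_diff Ints_add ex) auto
    qed (simp_all add: flow_outside flow_blue bl)
  qed
  then show ?thesis by (simp add: integer_points_def)
qed

text \<open>\<open>flow\<close> and \<open>coord\<close> are mutually inverse between coordinates
  and flat, and both preserve integrality; hence they match the lattice points.\<close>

lemma frame_flat:
  assumes \<beta>: "\<beta> \<in> selections"
  shows "lattice_frame dm (flat \<beta>) (form_frame (flow \<beta>))"
proof -
  have chart: "affine_chart dm (form_frame (flow \<beta>)) = flow \<beta>" using chart_flow[OF \<beta>] by blast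
  have "bij_betw (flow \<beta>) ({..<dm} \<rightarrow>\<^sub>E UNIV) (flat \<beta>)"
    using flow_in_flat[OF \<beta>] coord_in_E coord_flow[OF \<beta>] flow_coord[OF \<beta>]
    by (intro bij_betwI[where g = "coord \<beta>"]) auto
  moreover have "flow \<beta> ` ({..<dm} \<rightarrow>\<^sub>E \<int>) = flat \<beta> \<inter> integer_points"
  proof (intro equalityI subsetI)
    fix f assume "f \<in> flow \<beta> ` ({..<dm} \<rightarrow>\<^sub>E \<int>)"
    then show "f \<in> flat \<beta> \<inter> integer_points" using flow_in_flat[OF \<beta>] flow_integral[OF \<beta>] by blast
  next
    fix f assume f: "f \<in> flat \<beta> \<inter> integer_points"
    then have "f e \<in> \<int>" for e unfolding integer_points_def by blast
    then have "coord \<beta> f \<in> {..<dm} \<rightarrow>\<^sub>E \<int>" by (simp add: coord_def)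
    moreover have "flow \<beta> (coord \<beta> f) = f" using flow_coord[OF \<beta>] f by blast
    ultimately show "f \<in> flow \<beta> ` ({..<dm} \<rightarrow>\<^sub>E \<int>)" by (metis imageI)
  qed
  ultimately show ?thesis unfolding lattice_frame_def chart by blast
qed

lemma flat_lattice: "\<beta> \<in> selections \<Longrightarrow> flat \<beta> \<in> lattice_flats dm"
  using frame_flat by (auto simp: lattice_flats_def)

lemma flat_cut_out: "\<exists>H. cut_out_by (flat \<beta>) H"
proof -
  let ?H = "(\<lambda>e f. f e) ` (- arcs G) \<union> (\<lambda>v f. netflow G f v) ` ({1..c} \<times> {1..p}) \<union>
    {\<lambda>f. (\<Sum>b\<in>{1..p}. f (blue 0 b)) + (\<Sum>a\<in>{1..c}. f (red a (\<beta> a))) - 1}"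
  have "flat \<beta> = {f. \<forall>h\<in>?H. h f = 0}" unfolding flat_def ball_Un
    by (rule Collect_cong) (simp only: ball_simps split_paired_Ball_Sigma, simp add: Ball_def)
  moreover have "\<forall>h\<in>?H. \<forall>d v. affine_form d (\<lambda>y. h (affine_chart d v y))"
    unfolding ball_Un ball_simps split_paired_Ball_Sigma
  proof (intro conjI ballI allI)
    fix a b d v assume "a \<in> {1..c}" "b \<in> {1..p}"
    then show "affine_form d (\<lambda>y. netflow G (affine_chart d v y) (a, b))"
      by (simp only: netflow_internal) (intro affine_form_add affine_form_diff affine_form_affine_chart)
  qed (intro affine_form_add affine_form_diff affine_form_sum affine_form_const TrueI affine_form_affine_chart)+
  ultimately show ?thesis unfolding cut_out_by_def by blast
qed

end

section \<open>The volume of the flow complex\<close>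

context nested
begin

definition least :: "((nat \<times> nat) \<times> (nat \<times> nat) \<Rightarrow> real) \<Rightarrow> nat \<Rightarrow> real" where
  "least f a = Min ((\<lambda>b. f (red a b)) ` {1..p})"

definition total :: "((nat \<times> nat) \<times> (nat \<times> nat) \<Rightarrow> real) \<Rightarrow> real" where
  "total f = (\<Sum>b\<in>{1..p}. f (blue 0 b)) + (\<Sum>a\<in>{1..c}. least f a)"

section \<open>The part of the flow complex in each flat\<close>

lemma finite_selections: "finite selections"
  unfolding selections_def by (intro finite_PiE) auto

lemma selectionD: "\<beta> \<in> selections \<Longrightarrow> a \<in> {1..c} \<Longrightarrow> \<beta> a \<in> {1..p}"
  unfolding selections_def by (rule PiE_mem)

lemma least_le: "b \<in> {1..p} \<Longrightarrow> least f a \<le> f (red a b)"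
  unfolding least_def by (intro Min_le) auto

lemma least_attained: "\<exists>b\<in>{1..p}. least f a = f (red a b)"
proof -
  have "least f a \<in> (\<lambda>b. f (red a b)) ` {1..p}"
    unfolding least_def using p by (intro Min_in) auto
  then show ?thesis by blast
qed

lemma least_eqI:
  assumes "b \<in> {1..p}" "\<And>k. k \<in> {1..p} \<Longrightarrow> f (red a b) \<le> f (red a k)"
  shows "least f a = f (red a b)"
  using least_attained[of f a] least_le[OF assms(1), of f a] assms(2) by fastforce

lemma nonneg_flows_iff: "f \<in> nonneg_flows G \<longleftrightarrow>
    (\<forall>e. e \<notin> arcs G \<longrightarrow> f e = 0) \<and> (\<forall>e\<in>arcs G. 0 \<le> f e) \<and>
    (\<forall>a\<in>{1..c}. \<forall>b\<in>{1..p}. netflow G f (a, b) = 0)"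
  unfolding nonneg_flows_def internal_verts_eq mem_Collect_eq split_paired_Ball_Sigma ..

lemma flow_complex_iff: "f \<in> flow_complex G \<longleftrightarrow> f \<in> nonneg_flows G \<and> total f = 1"
proof -
  have "(\<Sum>s\<in>sources G. \<Sum>e\<in>out_arcs G s. f e) = (\<Sum>b\<in>{1..p}. f (blue 0 b))"
    unfolding sources_eq
    by (rule sum.reindex_bij_witness[of _ "\<lambda>b. (0, b)" snd]) (auto simp: out_arcs_eq)
  moreover have "inj_on layer {1..c}" by (rule inj_onI) simp
  then have "(\<Sum>C\<in>minimal_cycles G. Min (f ` C)) = (\<Sum>a\<in>{1..c}. least f a)"
    unfolding minimal_cycles_eq by (subst sum.reindex) (assumption, simp add: least_def layer_def image_image)
  ultimately show ?thesis by (simp add: flow_complex_def total_def)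
qed

text \<open>On \<open>flat \<beta>\<close> the selected values already satisfy the normalization. So
  \<open>total f = 1\<close> says that the nonnegative differences between selected values and
  minima sum to 0, which forces every selected arc to attain its minimum.\<close>

lemma flat_complex_iff:
  assumes \<beta>: "\<beta> \<in> selections" and f: "f \<in> flat \<beta>"
  shows "f \<in> flow_complex G \<longleftrightarrow>
    (\<forall>e\<in>arcs G. 0 \<le> f e) \<and> (\<forall>a\<in>{1..c}. \<forall>b\<in>{1..p}. f (red a (\<beta> a)) \<le> f (red a b))"
proof -
  have nn: "f \<in> nonneg_flows G \<longleftrightarrow> (\<forall>e\<in>arcs G. 0 \<le> f e)"
    using f unfolding flat_def nonneg_flows_iff by blast
  have le: "least f a \<le> f (red a (\<beta> a))" if "a \<in> {1..c}" for a
    by (rule least_le[OF selectionD[OF \<beta> that]])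
  have "total f = 1 \<longleftrightarrow> (\<Sum>a\<in>{1..c}. least f a) = (\<Sum>a\<in>{1..c}. f (red a (\<beta> a)))"
    using f unfolding flat_def total_def by auto
  also have "\<dots> \<longleftrightarrow> (\<forall>a\<in>{1..c}. least f a = f (red a (\<beta> a)))"
  proof
    assume eq: "(\<Sum>a\<in>{1..c}. least f a) = (\<Sum>a\<in>{1..c}. f (red a (\<beta> a)))"
    then have "(\<Sum>a\<in>{1..c}. f (red a (\<beta> a)) - least f a) = 0" by (simp add: sum_subtractf)
    then have "\<forall>a\<in>{1..c}. f (red a (\<beta> a)) - least f a = 0"
      using le by (subst (asm) sum_nonneg_eq_0_iff) auto
    then show "\<forall>a\<in>{1..c}. least f a = f (red a (\<beta> a))" by simp
  qed (rule sum.cong, auto)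
  also have "\<dots> \<longleftrightarrow> (\<forall>a\<in>{1..c}. \<forall>b\<in>{1..p}. f (red a (\<beta> a)) \<le> f (red a b))"
  proof (rule ball_cong[OF refl])
    fix a assume a: "a \<in> {1..c}"
    show "least f a = f (red a (\<beta> a)) \<longleftrightarrow> (\<forall>b\<in>{1..p}. f (red a (\<beta> a)) \<le> f (red a b))"
      using least_le[of _ f a] least_eqI[OF selectionD[OF \<beta> a], of f a] by metis
  qed
  finally show ?thesis unfolding flow_complex_iff nn by simp
qed

lemma flow_complex_subset: "flow_complex G \<subseteq> (\<Union>\<beta>\<in>selections. flat \<beta>)"
proof
  fix f assume f: "f \<in> flow_complex G"
  have "\<forall>a\<in>{1..c}. \<exists>b. b \<in> {1..p} \<and> least f a = f (red a b)" using least_attained by blast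
  then obtain \<beta> where \<beta>: "\<forall>a\<in>{1..c}. \<beta> a \<in> {1..p} \<and> least f a = f (red a (\<beta> a))"
    using bchoice by meson
  let ?\<beta> = "restrict \<beta> {1..c}"
  have "?\<beta> \<in> selections" using \<beta> by (auto simp: selections_def)
  moreover have "(\<Sum>a\<in>{1..c}. f (red a (?\<beta> a))) = (\<Sum>a\<in>{1..c}. least f a)"
    using \<beta> by (intro sum.cong) auto
  then have "f \<in> flat ?\<beta>" using f unfolding flow_complex_iff nonneg_flows_iff total_def flat_def by simp
  ultimately show "f \<in> (\<Union>\<beta>\<in>selections. flat \<beta>)" by blast
qed

text \<open>If the selected arc carries the least excess, nonnegativity on a red cycle need only be
  tested there, where the flow is the coordinate \<open>y (a - 1)\<close>. Only the last condition
  involves \<open>\<beta>\<close>.\<close>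

lemma flow_in_complex_iff:
  assumes \<beta>: "\<beta> \<in> selections"
  shows "flow \<beta> y \<in> flow_complex G \<longleftrightarrow> (\<forall>i<c. 0 \<le> y i) \<and> (\<forall>a\<le>c. \<forall>b\<in>{1..p}. 0 \<le> bflow y a b) \<and>
    (\<forall>a\<in>{1..c}. \<forall>b\<in>{1..p}. excess y a (\<beta> a) \<le> excess y a b)"
    (is "?L \<longleftrightarrow> ?Y \<and> ?B \<and> ?E")
proof -
  have ineq: "flow \<beta> y (red a (\<beta> a)) \<le> flow \<beta> y (red a b) \<longleftrightarrow> excess y a (\<beta> a) \<le> excess y a b"
    if "a \<in> {1..c}" "b \<in> {1..p}" for a b
    using that selectionD[OF \<beta> that(1)] by (simp add: flow_red)
  have root: "flow \<beta> y (red a (\<beta> a)) = y (a - 1)" if "a \<in> {1..c}" for a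
    using flow_red[OF that selectionD[OF \<beta> that], of \<beta> y] by simp
  have "?L \<longleftrightarrow> (\<forall>e\<in>arcs G. 0 \<le> flow \<beta> y e) \<and> ?E"
    unfolding flat_complex_iff[OF \<beta> flow_in_flat[OF \<beta>]] using ineq by blast
  also have "\<dots> \<longleftrightarrow> ?Y \<and> ?B \<and> ?E"
  proof (intro iffI conjI)
    assume *: "(\<forall>e\<in>arcs G. 0 \<le> flow \<beta> y e) \<and> ?E"
    then show ?E by blast
    show ?Y
    proof (intro allI impI)
      fix i assume i: "i < c"
      then have a: "Suc i \<in> {1..c}" by auto
      have "red (Suc i) (\<beta> (Suc i)) \<in> arcs G" using selectionD[OF \<beta> a] a unfolding red_arc by blast
      then show "0 \<le> y i" using * root[OF a] by fastforce
    qed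
    show ?B
    proof (intro allI impI ballI)
      fix a b assume ab: "a \<le> c" "b \<in> {1..p}"
      then have "blue a b \<in> arcs G" by simp
      then show "0 \<le> bflow y a b" using * flow_blue[OF ab, of \<beta> y] by fastforce
    qed
  next
    assume *: "?Y \<and> ?B \<and> ?E"
    then show ?E by blast
    show "\<forall>e\<in>arcs G. 0 \<le> flow \<beta> y e"
    proof
      fix e assume "e \<in> arcs G"
      then consider a b where "e = blue a b" "a \<le> c" "b \<in> {1..p}"
        | a b where "e = red a b" "a \<in> {1..c}" "b \<in> {1..p}"
        unfolding arcs_iff by blast
      then show "0 \<le> flow \<beta> y e"
      proof cases
        case 1
        then show ?thesis using * flow_blue[OF 1(2,3), of \<beta> y] by simp
      next
        case 2
        have "a - 1 < c" using 2 by auto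
        then have "0 \<le> y (a - 1)" using * by blast
        moreover have "excess y a (\<beta> a) \<le> excess y a b" using * 2 by blast
        ultimately show ?thesis using flow_red[OF 2(2,3), of \<beta> y] unfolding 2(1) by linarith
      qed
    qed
  qed
  finally show ?thesis .
qed

section \<open>Dimension of the flow complex\<close>

definition base :: "nat \<Rightarrow> nat" where
  "base = (\<lambda>a\<in>{1..c}. p)"

lemma base_selection: "base \<in> selections"
  using p by (auto simp: base_def selections_def)

text \<open>Homogeneity of the normalization; it is the reason why a ray from the origin meets the
  flow complex at most once.\<close>

lemma total_scale:
  assumes "0 < t" shows "total (t *\<^sub>R f) = t * total f"
proof -
  have "least (t *\<^sub>R f) a = t * least f a" for a
  proof -
    obtain b where b: "b \<in> {1..p}" "least f a = f (red a b)" using least_attained by blast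
    have "least (t *\<^sub>R f) a = (t *\<^sub>R f) (red a b)"
      using least_le[of _ f a] b assms by (intro least_eqI) (auto simp: scaleR_fun_def)
    then show ?thesis using b by (simp add: scaleR_fun_def)
  qed
  then show ?thesis by (simp add: total_def sum_distrib_left distrib_left scaleR_fun_def)
qed

text \<open>The normalization of \<open>base\<close> takes the value 1 at the frame vertex
  \<open>?v 0\<close> and the value \<open>l\<close> at \<open>f\<close>. Adding
  \<open>1 - l\<close> times the vertex therefore moves \<open>f\<close> into
  \<open>flat base\<close>, whose points are combinations of the frame vertices.\<close>

lemma flow_complex_span:
  "flow_complex G \<subseteq> span (form_frame (flow base) ` {..dm})"
proof
  let ?v = "form_frame (flow base)"
  fix f assume f: "f \<in> flow_complex G"
  have v: "lattice_frame dm (flat base) ?v" by (rule frame_flat[OF base_selection])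
  have v0: "?v 0 \<in> flat base" by (rule frame_mem[OF v]) simp
  define l where "l = (\<Sum>b\<in>{1..p}. f (blue 0 b)) + (\<Sum>a\<in>{1..c}. f (red a (base a)))"
  define g where "g = f + (1 - l) *\<^sub>R ?v 0"
  have ge: "g e = f e + (1 - l) * ?v 0 e" for e by (simp add: g_def scaleR_fun_def)
  have "g e = 0" if "e \<notin> arcs G" for e
  proof -
    have "f e = 0" using that f unfolding flow_complex_iff nonneg_flows_iff by blast
    moreover have "?v 0 e = 0" using that v0 unfolding flat_def by blast
    ultimately show ?thesis unfolding ge by (simp only: mult_zero_right add_0)
  qed
  moreover have "netflow G g (a, b) = 0" if "a \<in> {1..c}" "b \<in> {1..p}" for a b
  proof -
    have "netflow G g (a, b) = netflow G f (a, b) + (1 - l) * netflow G (?v 0) (a, b)"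
      by (simp add: netflow_internal[OF that] ge algebra_simps)
    moreover have "netflow G f (a, b) = 0"
      using that f unfolding flow_complex_iff nonneg_flows_iff by blast
    moreover have "netflow G (?v 0) (a, b) = 0" using that v0 unfolding flat_def by blast
    ultimately show ?thesis by (simp only: mult_zero_right add_0)
  qed
  moreover have "(\<Sum>b\<in>{1..p}. g (blue 0 b)) + (\<Sum>a\<in>{1..c}. g (red a (base a)))
      = l + (1 - l) * ((\<Sum>b\<in>{1..p}. ?v 0 (blue 0 b)) + (\<Sum>a\<in>{1..c}. ?v 0 (red a (base a))))"
    by (simp add: ge sum.distrib l_def distrib_left flip: sum_distrib_left)
  moreover have "(\<Sum>b\<in>{1..p}. ?v 0 (blue 0 b)) + (\<Sum>a\<in>{1..c}. ?v 0 (red a (base a))) = 1"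
    using v0 unfolding flat_def by blast
  ultimately have "g \<in> flat base" unfolding flat_def by (simp del: split_paired_All)
  then obtain y where "affine_chart dm ?v y = g" using frame_chart_surj[OF v] by blast
  then have "g \<in> span (?v ` {..dm})"
    unfolding affine_chart_def
    by (auto intro!: span_add span_sum span_scale span_diff intro: span_base)
  moreover have "f = g - (1 - l) *\<^sub>R ?v 0" by (simp add: g_def)
  ultimately show "f \<in> span (?v ` {..dm})" by (auto intro!: span_diff span_scale intro: span_base)
qed

text \<open>Within one flat the minima are values at fixed arcs, so membership in the complex
  reduces to linear inequalities.\<close>

lemma convex_cell: "convex (flow_complex G \<inter> flat base)" (is "convex ?K")
proof (rule convexI)
  fix f g :: "(nat \<times> nat) \<times> (nat \<times> nat) \<Rightarrow> real" and u v :: real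
  assume fg: "f \<in> ?K" "g \<in> ?K" and uv: "0 \<le> u" "0 \<le> v" "u + v = 1"
  let ?h = "u *\<^sub>R f + v *\<^sub>R g"
  have he: "?h e = u * f e + v * g e" for e by (simp add: scaleR_fun_def)
  have f: "f \<in> flat base" "\<forall>e\<in>arcs G. 0 \<le> f e" "\<forall>a\<in>{1..c}. \<forall>b\<in>{1..p}. f (red a (base a)) \<le> f (red a b)"
    and g: "g \<in> flat base" "\<forall>e\<in>arcs G. 0 \<le> g e" "\<forall>a\<in>{1..c}. \<forall>b\<in>{1..p}. g (red a (base a)) \<le> g (red a b)"
    using fg flat_complex_iff[OF base_selection] by blast+
  have "?h e = 0" if "e \<notin> arcs G" for e
  proof -
    have "f e = 0" "g e = 0" using that f(1) g(1) unfolding flat_def by blast+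
    then show ?thesis unfolding he by simp
  qed
  moreover have "netflow G ?h (a, b) = 0" if "a \<in> {1..c}" "b \<in> {1..p}" for a b
  proof -
    have "netflow G ?h (a, b) = u * netflow G f (a, b) + v * netflow G g (a, b)"
      by (simp add: netflow_internal[OF that] he algebra_simps del: plus_fun_apply)
    moreover have "netflow G f (a, b) = 0" "netflow G g (a, b) = 0"
      using that f(1) g(1) unfolding flat_def by blast+
    ultimately show ?thesis by simp
  qed
  moreover have "(\<Sum>b\<in>{1..p}. ?h (blue 0 b)) + (\<Sum>a\<in>{1..c}. ?h (red a (base a))) = 1"
  proof -
    have "(\<Sum>b\<in>{1..p}. ?h (blue 0 b)) + (\<Sum>a\<in>{1..c}. ?h (red a (base a)))
      = u * ((\<Sum>b\<in>{1..p}. f (blue 0 b)) + (\<Sum>a\<in>{1..c}. f (red a (base a))))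
      + v * ((\<Sum>b\<in>{1..p}. g (blue 0 b)) + (\<Sum>a\<in>{1..c}. g (red a (base a))))"
      unfolding he by (simp add: sum.distrib distrib_left flip: sum_distrib_left)
    also have "\<dots> = u * 1 + v * 1"
      using f(1) g(1) unfolding flat_def mem_Collect_eq by (simp only:)
    also have "\<dots> = 1" using uv by simp
    finally show ?thesis .
  qed
  ultimately have h: "?h \<in> flat base" unfolding flat_def by blast
  have "\<forall>e\<in>arcs G. 0 \<le> ?h e" unfolding he using f g uv by simp
  moreover have "\<forall>a\<in>{1..c}. \<forall>b\<in>{1..p}. ?h (red a (base a)) \<le> ?h (red a b)"
    unfolding he using f g uv by (auto intro!: add_mono mult_left_mono)
  ultimately have "?h \<in> flow_complex G" using flat_complex_iff[OF base_selection h] by blast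
  then show "?h \<in> ?K" using h by blast
qed

text \<open>Solves \<open>eps + p * (c + 2) * eps = 1\<close>: blue values of at most
  \<open>eps * (c + 2)\<close> in the first \<open>p - 1\<close> columns, together with red minima
  of total at most \<open>eps\<close>, leave a nonnegative flow for the last blue arc.\<close>

definition eps :: real where
  "eps = 1 / (1 + real p * (real c + 2))"

text \<open>
  The blue flow on column \<open>j < p\<close> decreases with the layer, so the red flow in each layer
  is least on the arc selected by \<open>base\<close>.
\<close>

lemma flow_base_in_complex:
  assumes y: "\<And>i. i < c \<Longrightarrow> 0 \<le> y i" "(\<Sum>i<c. y i) \<le> eps"
    and col: "\<And>a j. a \<le> c \<Longrightarrow> 1 \<le> j \<Longrightarrow> j < p \<Longrightarrow>
      eps * (real c + 1 - real a) \<le> y (idx a j) \<and> y (idx a j) \<le> eps * (real c + 2 - real a)"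
  shows "flow base y \<in> flow_complex G"
proof -
  have e: "0 < eps" unfolding eps_def by (intro divide_pos_pos add_pos_nonneg) auto
  have e1: "eps * (1 + real p * (real c + 2)) = 1"
    unfolding eps_def using e[unfolded eps_def] by (simp only: times_divide_eq_left mult_1 divide_self_if) auto
  have blp: "0 \<le> bflow y a b" if a: "a \<le> c" and b: "b \<in> {1..p}" for a b
  proof (cases "b < p")
    case True
    have "0 \<le> eps * (real c + 1 - real a)" using e a by simp
    then show ?thesis using col[of a b] True a b by (simp add: bflow_def)
  next
    case False
    have "(\<Sum>k\<in>{1..<p}. y (idx a k)) \<le> (\<Sum>k\<in>{1..<p}. eps * (real c + 2))"
    proof (rule sum_mono)
      fix k assume k: "k \<in> {1..<p}"
      then have "y (idx a k) \<le> eps * (real c + 2 - real a)" using col[of a k] a by simp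
      also have "\<dots> \<le> eps * (real c + 2)" using e by (intro mult_left_mono) auto
      finally show "y (idx a k) \<le> eps * (real c + 2)" .
    qed
    also have "\<dots> = real (p - 1) * (eps * (real c + 2))" by simp
    also have "\<dots> \<le> real p * (eps * (real c + 2))" using e by (intro mult_right_mono) auto
    also have "\<dots> = 1 - eps" using e1 by (simp add: algebra_simps)
    also have "\<dots> \<le> through y" using y(2) by (simp add: through_def)
    finally show ?thesis using False by (simp add: bflow_def)
  qed
  have ex: "0 \<le> excess y a b" if a: "a \<in> {1..c}" and b: "b \<in> {1..p}" for a b
  proof (cases "b = p")
    case True
    then show ?thesis by (simp add: excess_p)
  next
    case False
    show ?thesis unfolding excess_def
    proof (rule sum_nonneg)
      fix j assume j: "j \<in> {1..b}"
      then have jp: "1 \<le> j" "j < p" using b False by auto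
      have "y (idx a j) \<le> eps * (real c + 2 - real a)" using col[of a j] a jp by simp
      \<comment> \<open>The upper bound in layer \<open>a\<close> is the lower bound in layer
        \<open>a - 1\<close>. The windows of width \<open>eps\<close> leave room for a
        full-dimensional simplex.\<close>
      also have "\<dots> = eps * (real c + 1 - real (a - 1))" using a by (simp add: of_nat_diff)
      also have "\<dots> \<le> y (idx (a - 1) j)" by (rule conjunct1[OF col[OF _ jp]]) (use a in auto)
      finally show "0 \<le> bflow y (a - 1) j - bflow y a j" using jp by (simp add: bflow_def)
    qed
  qed
  have "excess y a (base a) \<le> excess y a b" if "a \<in> {1..c}" "b \<in> {1..p}" for a b
    using ex[OF that] that by (simp add: base_def excess_p)
  then show ?thesis unfolding flow_in_complex_iff[OF base_selection] using y(1) blp by blast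
qed

lemma complex_dim_flow_complex: "complex_dim (flow_complex G) = dm"
proof (rule complex_dim_eqI[OF frame_flat[OF base_selection] convex_cell Int_lower1])
  \<comment> \<open>Blue coordinates sit at the lower ends of their windows and red ones at 0, so
    any single coordinate may be raised by \<open>eps\<close>.\<close>
  define z where "z i = (if i < c then 0 else eps * (real c + 1 - real ((i - c) div (p - 1))))" for i
  have e: "0 < eps" unfolding eps_def by (intro divide_pos_pos add_pos_nonneg) auto
  show "0 < eps" by (rule e)
  have z: "z (idx a j) = eps * (real c + 1 - real a)" if "1 \<le> j" "j < p" for a j
    using idx_decode[OF that, of a] by (simp add: z_def)
  show "affine_chart dm (form_frame (flow base)) z \<in> flow_complex G \<inter> flat base"
    unfolding chart_flow[OF base_selection] using flow_in_flat[OF base_selection] e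
    by (auto intro!: flow_base_in_complex simp: z) (auto simp: z_def)
  show "affine_chart dm (form_frame (flow base)) (\<lambda>j. z j + (if j = i then eps else 0)) \<in> flow_complex G \<inter> flat base"
    if i: "i < dm" for i
  proof -
    let ?y = "\<lambda>j. z j + (if j = i then eps else 0)"
    have "(\<Sum>j<c. ?y j) = (\<Sum>j<c. if j = i then eps else 0)"
      by (intro sum.cong) (auto simp: z_def)
    also have "\<dots> \<le> eps" using e by simp
    finally have "flow base ?y \<in> flow_complex G"
      using e by (intro flow_base_in_complex) (auto simp: z algebra_simps, auto simp: z_def)
    then show ?thesis unfolding chart_flow[OF base_selection] using flow_in_flat[OF base_selection] by blast
  qed
  show "flow_complex G \<subseteq> span (form_frame (flow base) ` {..dm})" by (rule flow_complex_span)
  show "t = 1" if "f \<in> flow_complex G" "0 < t" "t *\<^sub>R f \<in> flow_complex G" for f t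
    using that total_scale[OF that(2), of f] unfolding flow_complex_iff by simp
qed

text \<open>A test flow separates the flats: one blue unit runs in column \<open>m + 1\<close>
  before layer \<open>l\<close> and in column \<open>m\<close> from there on. The only nonzero
  excess is then -1 at position \<open>m\<close> of cycle \<open>l\<close>, and this distinguishes
  \<open>\<beta> l\<close> from \<open>\<beta>' l\<close>. The red values may be negative, which a
  flat permits.\<close>

lemma flats_distinct:
  assumes \<beta>: "\<beta> \<in> selections" "\<beta>' \<in> selections" "\<beta> \<noteq> \<beta>'"
  shows "\<not> flat \<beta> \<subseteq> flat \<beta>'"
proof
  assume sub: "flat \<beta> \<subseteq> flat \<beta>'"
  obtain l where l: "l \<in> {1..c}" "\<beta> l \<noteq> \<beta>' l"
    using \<beta> unfolding selections_def by (metis PiE_ext)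
  have bl: "\<beta> l \<in> {1..p}" "\<beta>' l \<in> {1..p}" using selectionD \<beta> l by blast+
  define m where "m = min (\<beta> l) (\<beta>' l)"
  define M where "M = max (\<beta> l) (\<beta>' l)"
  have mM: "1 \<le> m" "m < M" "M \<le> p" using l bl by (auto simp: m_def M_def)
  define J where "J a = (if a < l then Suc m else m)" for a
  have J: "J a \<in> {1..p}" for a using mM by (auto simp: J_def)
  define y :: "nat \<Rightarrow> real" where
    "y i = (if i < c then 0 else if (i - c) mod (p - 1) + 1 = J ((i - c) div (p - 1)) then 1 else 0)" for i
  have y: "y (idx a j) = (if j = J a then 1 else 0)" if "1 \<le> j" "j < p" for a j
    using idx_decode[OF that, of a] by (simp add: y_def)
  have th: "through y = 1" by (simp add: through_def y_def)
  have bf: "bflow y a b = (if b = J a then 1 else 0)" if b: "b \<in> {1..p}" for a b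
  proof (cases "b < p")
    case False
    have "(\<Sum>k\<in>{1..<p}. y (idx a k)) = (\<Sum>k\<in>{1..<p}. if k = J a then 1 else 0)"
      using y by (intro sum.cong) auto
    also have "\<dots> = (if J a < p then 1 else 0)" using J[of a] by simp
    finally show ?thesis using False b J[of a] th by (auto simp: bflow_def)
  qed (use b y in \<open>simp add: bflow_def\<close>)
  have ex: "excess y a b = (if J (a - 1) \<le> b then 1 else 0) - (if J a \<le> b then 1 else 0)"
    if "b \<in> {1..p}" for a b
  proof -
    have "excess y a b = (\<Sum>i\<in>{1..b}. (if i = J (a - 1) then 1 else 0) - (if i = J a then 1 else 0))"
      unfolding excess_def using that by (intro sum.cong arg_cong2[where f = "(-)"] bf) auto
    also have "\<dots> = (if J (a - 1) \<le> b then 1 else 0) - (if J a \<le> b then 1 else 0)"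
      using J[of a] J[of "a - 1"] by (simp add: sum_subtractf)
    finally show ?thesis .
  qed
  have other: "excess y a b = 0" if "b \<in> {1..p}" "a \<noteq> l" for a b
    using that ex[OF that(1), of a] by (auto simp: J_def)
  have exl: "excess y l m = -1" "excess y l M = 0"
    using ex[of m l] ex[of M l] mM l(1) by (auto simp: J_def)
  have "flow \<beta> y \<in> flat \<beta>" "flow \<beta> y \<in> flat \<beta>'" using flow_in_flat[OF \<beta>(1)] sub by blast+
  then have eq: "(\<Sum>a\<in>{1..c}. flow \<beta> y (red a (\<beta> a))) = (\<Sum>a\<in>{1..c}. flow \<beta> y (red a (\<beta>' a)))"
    unfolding flat_def mem_Collect_eq by linarith
  have "(\<Sum>a\<in>{1..c}. flow \<beta> y (red a (\<beta>' a)) - flow \<beta> y (red a (\<beta> a)))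
      = (\<Sum>a\<in>{1..c}. if a = l then excess y l (\<beta>' l) - excess y l (\<beta> l) else 0)"
  proof (rule sum.cong[OF refl])
    fix a assume a: "a \<in> {1..c}"
    note b = selectionD[OF \<beta>(1) a] selectionD[OF \<beta>(2) a]
    show "flow \<beta> y (red a (\<beta>' a)) - flow \<beta> y (red a (\<beta> a))
        = (if a = l then excess y l (\<beta>' l) - excess y l (\<beta> l) else 0)"
      using other[OF b(1), of a] other[OF b(2), of a] flow_red[OF a b(1), of \<beta> y] flow_red[OF a b(2), of \<beta> y]
      by auto
  qed
  also have "\<dots> = excess y l (\<beta>' l) - excess y l (\<beta> l)" using l(1) by simp
  finally have "excess y l (\<beta>' l) = excess y l (\<beta> l)" using eq by (simp add: sum_subtractf)
  moreover have "{\<beta> l, \<beta>' l} = {m, M}" by (auto simp: m_def M_def)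
  then have "(\<beta> l = m \<and> \<beta>' l = M) \<or> (\<beta> l = M \<and> \<beta>' l = m)" using mM by (auto simp: doubleton_eq_iff)
  ultimately show False using exl by auto
qed

section \<open>Tiling of one region by the cells\<close>

definition region :: "(nat \<Rightarrow> real) set" where
  "region = {y \<in> {..<dm} \<rightarrow>\<^sub>E UNIV. (\<forall>i<c. 0 \<le> y i) \<and> (\<forall>a\<le>c. \<forall>b\<in>{1..p}. 0 \<le> bflow y a b)}"

definition cell :: "(nat \<Rightarrow> nat) \<Rightarrow> (nat \<Rightarrow> real) set" where
  "cell \<beta> = {y \<in> {..<dm} \<rightarrow>\<^sub>E UNIV. flow \<beta> y \<in> flow_complex G}"

text \<open>In every layer \<open>excess y a\<close> has a minimizer on \<open>{1..p}\<close>;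
  collecting these gives a selection whose cell contains the point.\<close>

lemma region_eq_UN: "region = (\<Union>\<beta>\<in>selections. cell \<beta>)"
proof (intro equalityI subsetI)
  fix y assume y: "y \<in> region"
  have "\<forall>a\<in>{1..c}. \<exists>k. k \<in> {1..p} \<and> (\<forall>b\<in>{1..p}. excess y a k \<le> excess y a b)"
  proof
    fix a
    obtain k where "is_arg_min (excess y a) (\<lambda>k. k \<in> {1..p}) k"
      using ex_is_arg_min_if_finite[of "{1..p}" "excess y a"] p by auto
    then show "\<exists>k. k \<in> {1..p} \<and> (\<forall>b\<in>{1..p}. excess y a k \<le> excess y a b)"
      unfolding is_arg_min_def by (meson not_le_imp_less)
  qed
  from bchoice[OF this] obtain \<beta> where \<beta>: "\<forall>a\<in>{1..c}. \<beta> a \<in> {1..p} \<and> (\<forall>b\<in>{1..p}. excess y a (\<beta> a) \<le> excess y a b)"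
    ..
  let ?\<beta> = "restrict \<beta> {1..c}"
  have s: "?\<beta> \<in> selections" using \<beta> by (auto simp: selections_def)
  have "y \<in> cell ?\<beta>" unfolding cell_def mem_Collect_eq flow_in_complex_iff[OF s]
    using y \<beta> by (simp add: region_def)
  then show "y \<in> (\<Union>\<beta>\<in>selections. cell \<beta>)" using s by blast
next
  fix y assume "y \<in> (\<Union>\<beta>\<in>selections. cell \<beta>)"
  then show "y \<in> region" unfolding cell_def region_def using flow_in_complex_iff by blast
qed

lemma sets_nonneg_form:
  assumes "affine_form d h" shows "{y \<in> space (PiL {..<d}). 0 \<le> h y} \<in> sets (PiL {..<d})"
  using affine_form_measurable[OF assms] by measurable

lemma sets_cell: assumes \<beta>: "\<beta> \<in> selections" shows "cell \<beta> \<in> sets (PiL {..<dm})"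
proof -
  have Y: "{y \<in> space (PiL {..<dm}). 0 \<le> y i} \<in> sets (PiL {..<dm})" if "i \<in> {..<c}" for i
    using that by (intro sets_nonneg_form[where h = "\<lambda>y. y i"] affine_form_coord) (simp add: dm_def)
  have B: "{y \<in> space (PiL {..<dm}). 0 \<le> bflow y a b} \<in> sets (PiL {..<dm})"
    if "a \<in> {..c}" "b \<in> {1..p}" for a b
    using that by (intro sets_nonneg_form[where h = "\<lambda>y. bflow y a b"] form_bflow) simp_all
  have X: "{y \<in> space (PiL {..<dm}). 0 \<le> excess y a b - excess y a (\<beta> a)} \<in> sets (PiL {..<dm})"
    if "a \<in> {1..c}" "b \<in> {1..p}" for a b
  proof (rule sets_nonneg_form[where h = "\<lambda>y. excess y a b - excess y a (\<beta> a)"])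
    show "affine_form dm (\<lambda>y. excess y a b - excess y a (\<beta> a))"
      by (rule affine_form_diff; rule form_excess; rule that selectionD[OF \<beta> that(1)])
  qed
  have "cell \<beta> = {y \<in> space (PiL {..<dm}). (\<forall>i\<in>{..<c}. 0 \<le> y i) \<and>
      (\<forall>a\<in>{..c}. \<forall>b\<in>{1..p}. 0 \<le> bflow y a b) \<and>
      (\<forall>a\<in>{1..c}. \<forall>b\<in>{1..p}. 0 \<le> excess y a b - excess y a (\<beta> a))}"
    unfolding cell_def flow_in_complex_iff[OF \<beta>] by (auto simp: space_PiM)
  also have "\<dots> \<in> sets (PiL {..<dm})"
    by (intro sets.sets_Collect_conj sets.sets_Collect_finite_All Y B X) auto
  finally show ?thesis .
qed

text \<open>On the overlap both selections minimize the same \<open>excess\<close>, so the two flows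
  coincide and lie in both flats. Distinct flats meet in a null set.\<close>

lemma cells_almost_disjoint:
  assumes \<beta>: "\<beta> \<in> selections" "\<beta>' \<in> selections" "\<beta> \<noteq> \<beta>'"
  shows "\<exists>Z\<in>null_sets (PiL {..<dm}). cell \<beta> \<inter> cell \<beta>' \<subseteq> Z"
proof -
  obtain H where H: "cut_out_by (flat \<beta>') H" using flat_cut_out by blast
  obtain Z where Z: "Z \<in> null_sets (PiL {..<dm})"
    "{y \<in> {..<dm} \<rightarrow>\<^sub>E UNIV. affine_chart dm (form_frame (flow \<beta>)) y \<in> flat \<beta>'} \<subseteq> Z"
    using frame_preimage_null[OF frame_flat[OF \<beta>(1)] H flats_distinct[OF \<beta>]] by (elim bexE)
  have "cell \<beta> \<inter> cell \<beta>'
      \<subseteq> {y \<in> {..<dm} \<rightarrow>\<^sub>E UNIV. affine_chart dm (form_frame (flow \<beta>)) y \<in> flat \<beta>'}"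
  proof
    fix y assume y: "y \<in> cell \<beta> \<inter> cell \<beta>'"
    have eq: "excess y a (\<beta> a) = excess y a (\<beta>' a)" if a: "a \<in> {1..c}" for a
      using y a selectionD[OF \<beta>(1) a] selectionD[OF \<beta>(2) a]
      unfolding cell_def by (auto simp: flow_in_complex_iff \<beta> intro!: antisym)
    have "flow \<beta> y = flow \<beta>' y"
    proof
      fix e
      consider "e \<notin> arcs G" | a b where "e = blue a b" "a \<le> c" "b \<in> {1..p}"
        | a b where "e = red a b" "a \<in> {1..c}" "b \<in> {1..p}"
        unfolding arcs_iff by blast
      then show "flow \<beta> y e = flow \<beta>' y e"
      proof cases
        case 3
        show ?thesis unfolding 3(1) flow_red[OF 3(2,3)] eq[OF 3(2)] ..
      qed (simp_all add: flow_outside flow_blue)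
    qed
    then have "flow \<beta> y \<in> flat \<beta>'" using flow_in_flat[OF \<beta>(2)] by simp
    then show "y \<in> {y \<in> {..<dm} \<rightarrow>\<^sub>E UNIV. affine_chart dm (form_frame (flow \<beta>)) y \<in> flat \<beta>'}"
      using y unfolding chart_flow[OF \<beta>(1)] cell_def by blast
  qed
  then show ?thesis using Z by (intro bexI[of _ Z] order.trans[OF _ Z(2)])
qed

text \<open>The coordinates of layer \<open>a\<close> occupy \<open>p - 1\<close> consecutive
  indices, and nonnegativity of the last blue arc is the size bound of the simplex on this
  block.\<close>

lemma emeasure_region:
  "emeasure (PiL {..<dm}) region = ennreal (fact N / (fact (p - 1) ^ (c + 1) * fact dm))"
proof -
  have dm: "dm = c + (c + 1) * (p - 1)" by (simp add: dm_def N_def)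
  have "region = {y \<in> space (PiL {..<dm}). (\<forall>i<c. 0 \<le> y i) \<and>
      (\<forall>a<c + 1. y \<in> orthant_simplex {c + a * (p - 1)..<c + a * (p - 1) + (p - 1)} (1 - sum y {..<c}))}"
  proof -
    have "(\<forall>b\<in>{1..p}. 0 \<le> bflow y a b) \<longleftrightarrow>
        y \<in> orthant_simplex {c + a * (p - 1)..<c + a * (p - 1) + (p - 1)} (1 - sum y {..<c})" for y a
    proof -
      let ?J = "{c + a * (p - 1)..<c + a * (p - 1) + (p - 1)}"
      have im: "idx a ` {1..<p} = ?J"
      proof (intro equalityI subsetI)
        fix i assume "i \<in> ?J"
        then have "i = idx a (i - (c + a * (p - 1)) + 1)" "i - (c + a * (p - 1)) + 1 \<in> {1..<p}"
          by (auto simp: idx_def)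
        then show "i \<in> idx a ` {1..<p}" by blast
      qed (auto simp: idx_def)
      have "inj_on (idx a) {1..<p}" by (auto simp: inj_on_def idx_def)
      then have "sum y ?J = (\<Sum>k\<in>{1..<p}. y (idx a k))"
        unfolding im[symmetric] by (simp add: sum.reindex)
      moreover have "(\<forall>i\<in>?J. 0 \<le> y i) \<longleftrightarrow> (\<forall>k\<in>{1..<p}. 0 \<le> y (idx a k))"
        unfolding im[symmetric] by simp
      moreover have "(\<forall>b\<in>{1..p}. 0 \<le> bflow y a b) \<longleftrightarrow> 0 \<le> bflow y a p \<and> (\<forall>k\<in>{1..<p}. 0 \<le> bflow y a k)"
        unfolding interval_split_last by simp
      moreover have "(\<forall>k\<in>{1..<p}. 0 \<le> bflow y a k) \<longleftrightarrow> (\<forall>k\<in>{1..<p}. 0 \<le> y (idx a k))"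
        by (intro ball_cong) (auto simp: bflow_def)
      ultimately show ?thesis by (auto simp: orthant_simplex_def bflow_def through_def)
    qed
    then show ?thesis unfolding region_def by (auto simp: space_PiM less_Suc_eq_le)
  qed
  then show ?thesis
    using emeasure_simplex_fibration[of "c + 1" c "p - 1"] unfolding dm[symmetric] by (simp add: N_def)
qed

lemma sum_measure_cells:
  "(\<Sum>\<beta>\<in>selections. measure (PiL {..<dm}) (cell \<beta>)) = fact N / (fact (p - 1) ^ (c + 1) * fact dm)"
proof -
  let ?M = "PiL {..<dm}"
  have sub: "cell \<beta> \<subseteq> region" if "\<beta> \<in> selections" for \<beta> using that region_eq_UN by blast
  have sr: "region \<in> sets ?M"
    unfolding region_eq_UN using finite_selections sets_cell by (intro sets.finite_UN) auto
  have r: "region \<in> fmeasurable ?M" using sr emeasure_region by (intro fmeasurableI) auto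
  have "measure ?M (\<Union>\<beta>\<in>selections. cell \<beta>) = (\<Sum>\<beta>\<in>selections. measure ?M (cell \<beta>))"
  proof (rule measure_UNION_AE[OF finite_selections])
    show "cell \<beta> \<in> fmeasurable ?M" if "\<beta> \<in> selections" for \<beta>
      using fmeasurableI2[OF r sub[OF that] sets_cell[OF that]] .
    show "pairwise (\<lambda>\<beta> \<beta>'. AE x in ?M. x \<notin> cell \<beta> \<or> x \<notin> cell \<beta>') selections"
    proof (rule pairwiseI)
      fix \<beta> \<beta>' assume \<beta>: "\<beta> \<in> selections" "\<beta>' \<in> selections" "\<beta> \<noteq> \<beta>'"
      then obtain Z where "Z \<in> null_sets ?M" "cell \<beta> \<inter> cell \<beta>' \<subseteq> Z" using cells_almost_disjoint by blast
      then show "AE x in ?M. x \<notin> cell \<beta> \<or> x \<notin> cell \<beta>'" by (intro AE_I'[of Z]) auto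
    qed
  qed
  then show ?thesis
    unfolding region_eq_UN[symmetric] using emeasure_region by (simp add: measure_def)
qed

text \<open>Distinct selections give distinct flats, so each flat accounts for exactly one cell; the
  factor \<open>fact dm\<close> of the normalization cancels the one in the measure of the
  region.\<close>

lemma normalized_volume_flow_complex:
  "normalized_volume (flow_complex G) = fact N / fact (p - 1) ^ (c + 1)"
proof -
  have inj: "inj_on flat selections"
    using flats_distinct by (intro inj_onI) blast
  have vol: "flat_volume dm (flat \<beta>) (flow_complex G) = fact dm * measure (PiL {..<dm}) (cell \<beta>)"
    if \<beta>: "\<beta> \<in> selections" for \<beta>
    using flat_volume_frame[OF frame_flat[OF \<beta>], of "flow_complex G"] sets_cell[OF \<beta>]
    unfolding chart_flow[OF \<beta>] cell_def by blast
  have "normalized_volume (flow_complex G) = (\<Sum>A\<in>flat ` selections. flat_volume dm A (flow_complex G))"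
    using complex_dim_flow_complex finite_selections flow_complex_subset flat_lattice flat_cut_out
    by (intro normalized_volume_eq_sum) auto
  also have "\<dots> = (\<Sum>\<beta>\<in>selections. fact dm * measure (PiL {..<dm}) (cell \<beta>))"
    by (subst sum.reindex[OF inj]) (simp add: vol)
  also have "\<dots> = fact dm * (\<Sum>\<beta>\<in>selections. measure (PiL {..<dm}) (cell \<beta>))"
    by (simp add: sum_distrib_left)
  also have "\<dots> = fact N / fact (p - 1) ^ (c + 1)" unfolding sum_measure_cells by simp
  finally show ?thesis .
qed

end

section \<open>Counting cyclic integer flows\<close>

text \<open>The factor for \<open>a\<close> adjoins a block of size \<open>q\<close> to the
  \<open>a\<close> blocks already placed, which builds up a multinomial coefficient. It is
  multiplied out to avoid division of natural numbers.\<close>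

lemma prod_binomial_multiples:
  "(\<Prod>a\<in>{1..c}. (a * q + q) choose (a * q)) * fact q ^ (c + 1) = (fact ((c + 1) * q) :: nat)"
proof (induction c)
  case (Suc c)
  let ?n = "Suc c * q"
  have "(\<Prod>a\<in>{1..Suc c}. (a * q + q) choose (a * q)) * fact q ^ (Suc c + 1)
      = ((\<Prod>a\<in>{1..c}. (a * q + q) choose (a * q)) * fact q ^ (c + 1)) * fact q * ((?n + q) choose ?n)"
    by (simp add: prod.nat_ivl_Suc')
  also have "\<dots> = fact ?n * fact q * ((?n + q) choose ?n)"
    using Suc.IH by (simp only: Suc_eq_plus1)
  also have "\<dots> = fact (?n + q)"
    using binomial_fact_lemma[of ?n "?n + q"] by simp
  also have "?n + q = (Suc c + 1) * q" by simp
  finally show ?case .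
qed simp

section \<open>Cyclic flows layer by layer\<close>

context nested
begin

text \<open>Counterpart of \<open>excess\<close> when every vertex of the layer has netflow 1; the
  exceptional vertex with netflow 0 is corrected separately by a term that is 0 or 1.\<close>

definition psum :: "((nat \<times> nat) \<times> (nat \<times> nat) \<Rightarrow> int) \<Rightarrow> nat \<Rightarrow> nat \<Rightarrow> int" where
  "psum f a b = (\<Sum>i\<in>{1..b}. f (blue (a - 1) i) - f (blue a i) + 1)"

text \<open>The rightmost minimizer. Strictness after \<open>k\<close> makes it unique and matches
  the positivity of the red flow beyond the zero arc.\<close>

definition last_min :: "(nat \<Rightarrow> int) \<Rightarrow> nat \<Rightarrow> bool" where
  "last_min P k \<longleftrightarrow> k \<in> {1..p} \<and> (\<forall>b\<in>{1..p}. (b < k \<longrightarrow> P k \<le> P b) \<and> (k < b \<longrightarrow> P k < P b))"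

lemma last_min_unique: "last_min P k \<Longrightarrow> last_min P l \<Longrightarrow> k = l"
  unfolding last_min_def by (metis linorder_neqE_nat not_le)

lemma last_min_exists: "\<exists>k. last_min P k"
proof -
  let ?S = "{b \<in> {1..p}. \<forall>l\<in>{1..p}. P b \<le> P l}"
  obtain k0 where "is_arg_min P (\<lambda>k. k \<in> {1..p}) k0"
    using ex_is_arg_min_if_finite[of "{1..p}" P] p by auto
  then have "k0 \<in> ?S" unfolding is_arg_min_def by (auto simp: not_less)
  then have ne: "?S \<noteq> {}" by blast
  have fin: "finite ?S" by simp
  have M: "Max ?S \<in> ?S" using Max_in[OF fin ne] .
  have "P (Max ?S) < P b" if b: "b \<in> {1..p}" "Max ?S < b" for b
  proof (rule ccontr)
    assume "\<not> P (Max ?S) < P b"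
    then have "b \<in> ?S" using M b(1) by fastforce
    then show False using Max_ge[OF fin] b(2) by (meson leD)
  qed
  then have "last_min P (Max ?S)" using M unfolding last_min_def by blast
  then show ?thesis by blast
qed

text \<open>The recurrence, corrected by 1 at \<open>k\<close>, is summed and evaluated at
  \<open>k\<close>, where the red flow vanishes. The term for \<open>b < k\<close> is the difference
  of the accumulated corrections at \<open>k\<close> and at \<open>b\<close>; evaluation at
  \<open>p\<close> gives the total 1.\<close>

lemma layer_flow_iff:
  fixes f :: "(nat \<times> nat) \<times> (nat \<times> nat) \<Rightarrow> int"
  assumes a: "a \<in> {1..c}" and k: "k \<in> {1..p}"
  shows "f (red a k) = 0 \<and> (\<forall>b\<in>{1..p}. netflow G f (a, b) = (if b = k then 0 else 1)) \<longleftrightarrow>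
    psum f a p = 1 \<and> (\<forall>b\<in>{1..p}. f (red a b) = psum f a b - psum f a k + (if b < k then 1 else 0))"
proof -
  let ?s = "\<lambda>i. f (blue (a - 1) i) - f (blue a i) + (if i = k then 0 else 1)"
  have s: "sum ?s {1..b} = psum f a b - (if k \<le> b then 1 else 0)" for b
  proof -
    have "sum ?s {1..b} = (\<Sum>i\<in>{1..b}. (f (blue (a - 1) i) - f (blue a i) + 1) - (if i = k then 1 else 0))"
      by (intro sum.cong) auto
    also have "\<dots> = psum f a b - (if k \<le> b then 1 else 0)"
      using k by (simp only: sum_subtractf psum_def) simp
    finally show ?thesis .
  qed
  have "(\<forall>b\<in>{1..p}. netflow G f (a, b) = (if b = k then 0 else 1))
      \<longleftrightarrow> (\<forall>b\<in>{1..p}. f (red a b) = f (red a (prev b)) + ?s b)"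
    using netflow_internal[OF a, of _ f] by (intro ball_cong) auto
  also have "\<dots> \<longleftrightarrow> (\<forall>b\<in>{1..p}. f (red a b) = f (red a p) + (psum f a b - (if k \<le> b then 1 else 0)))"
    unfolding cyclic_recurrence_iff[of "\<lambda>b. f (red a b)" ?s] s ..
  finally have *: "(\<forall>b\<in>{1..p}. netflow G f (a, b) = (if b = k then 0 else 1))
      \<longleftrightarrow> (\<forall>b\<in>{1..p}. f (red a b) = f (red a p) + (psum f a b - (if k \<le> b then 1 else 0)))" .
  have p1: "p \<in> {1..p}" using p by simp
  show ?thesis unfolding *
  proof (intro iffI conjI ballI)
    assume L: "f (red a k) = 0 \<and>
      (\<forall>b\<in>{1..p}. f (red a b) = f (red a p) + (psum f a b - (if k \<le> b then 1 else 0)))"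
    note eq = bspec[OF conjunct2[OF L]]
    show "psum f a p = 1" using eq[OF p1] k by simp
    fix b assume "b \<in> {1..p}"
    from eq[OF this] eq[OF k] L
    show "f (red a b) = psum f a b - psum f a k + (if b < k then 1 else 0)"
      by (auto split: if_splits)
  next
    assume R: "psum f a p = 1 \<and>
      (\<forall>b\<in>{1..p}. f (red a b) = psum f a b - psum f a k + (if b < k then 1 else 0))"
    note eq = bspec[OF conjunct2[OF R]]
    show "f (red a k) = 0" using eq[OF k] by simp
    have "f (red a p) = 1 - psum f a k" using eq[OF p1] conjunct1[OF R] k by simp
    fix b assume "b \<in> {1..p}"
    from eq[OF this] \<open>f (red a p) = 1 - psum f a k\<close>
    show "f (red a b) = f (red a p) + (psum f a b - (if k \<le> b then 1 else 0))"
      by (auto split: if_splits)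
  qed
qed

text \<open>The red arcs of a layer have distinct tails, so the exceptional vertex of layer
  \<open>a\<close> is the tail of its zero arc, and one index \<open>k\<close> describes
  both.\<close>

lemma cyclic_flows_iff: "f \<in> cyclic_integer_flows_0 G \<longleftrightarrow>
    (\<forall>e. e \<notin> arcs G \<longrightarrow> f e = 0) \<and> (\<forall>e\<in>arcs G. 0 \<le> f e) \<and> (\<forall>b\<in>{1..p}. f (blue 0 b) = 0) \<and>
    (\<forall>a\<in>{1..c}. \<exists>k\<in>{1..p}. f (red a k) = 0 \<and> (\<forall>b\<in>{1..p}. b \<noteq> k \<longrightarrow> f (red a b) \<noteq> 0) \<and>
      (\<forall>b\<in>{1..p}. netflow G f (a, b) = (if b = k then 0 else 1)))"
proof -
  have zt: "(a, b) \<in> zero_tails G f \<longleftrightarrow> f (red a b) = 0" if "a \<in> {1..c}" "b \<in> {1..p}" for a b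
  proof
    assume "(a, b) \<in> zero_tails G f"
    then obtain e a' where e: "(a, b) = tail G e" "e \<in> layer a'" "f e = 0"
      unfolding zero_tails_def minimal_cycles_eq by blast
    then have "e = red a b" by (auto simp: layer_def)
    then show "f (red a b) = 0" using e(3) by blast
  next
    assume "f (red a b) = 0"
    moreover have "red a b \<in> layer a" using that by (simp add: layer_def)
    moreover have "layer a \<in> minimal_cycles G" using that unfolding minimal_cycles_eq by blast
    ultimately show "(a, b) \<in> zero_tails G f" unfolding zero_tails_def by (intro CollectI exI[of _ "red a b"]) auto
  qed
  have src: "(\<forall>s\<in>sources G. netflow G f s = 0) \<longleftrightarrow> (\<forall>b\<in>{1..p}. f (blue 0 b) = 0)"
    unfolding sources_eq using netflow_source[of _ f] by auto
  have layers: "(\<forall>C\<in>minimal_cycles G. \<exists>!e. e \<in> C \<and> f e = 0) \<and>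
      (\<forall>v\<in>internal_verts G. netflow G f v = (if v \<in> zero_tails G f then 0 else 1)) \<longleftrightarrow>
    (\<forall>a\<in>{1..c}. \<exists>k\<in>{1..p}. f (red a k) = 0 \<and> (\<forall>b\<in>{1..p}. b \<noteq> k \<longrightarrow> f (red a b) \<noteq> 0) \<and>
      (\<forall>b\<in>{1..p}. netflow G f (a, b) = (if b = k then 0 else 1)))" (is "?L1 \<and> ?L2 \<longleftrightarrow> ?R")
  proof
    assume L: "?L1 \<and> ?L2"
    show ?R
    proof
      fix a assume a: "a \<in> {1..c}"
      then have "\<exists>!e. e \<in> layer a \<and> f e = 0" using L minimal_cycles_eq by blast
      then obtain k where k: "k \<in> {1..p}" "f (red a k) = 0"
        and uniq: "\<And>b. b \<in> {1..p} \<Longrightarrow> f (red a b) = 0 \<Longrightarrow> red a b = red a k"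
        unfolding layer_def by blast
      have net: "netflow G f (a, b) = (if b = k then 0 else 1)" if b: "b \<in> {1..p}" for b
      proof -
        have "(a, b) \<in> internal_verts G" unfolding internal_verts_eq using a b by simp
        then have "netflow G f (a, b) = (if (a, b) \<in> zero_tails G f then 0 else 1)" using L by blast
        moreover have "(a, b) \<in> zero_tails G f \<longleftrightarrow> b = k" unfolding zt[OF a b] using uniq[OF b] k by auto
        ultimately show ?thesis by simp
      qed
      show "\<exists>k\<in>{1..p}. f (red a k) = 0 \<and> (\<forall>b\<in>{1..p}. b \<noteq> k \<longrightarrow> f (red a b) \<noteq> 0) \<and>
          (\<forall>b\<in>{1..p}. netflow G f (a, b) = (if b = k then 0 else 1))"
      proof (intro bexI[of _ k] conjI ballI impI)
        show "f (red a b) \<noteq> 0" if "b \<in> {1..p}" "b \<noteq> k" for b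
          using uniq[OF that(1)] that(2) by auto
      qed (rule k net | assumption)+
    qed
  next
    assume R: ?R
    show "?L1 \<and> ?L2"
    proof
      show ?L1
      proof
        fix C assume "C \<in> minimal_cycles G"
        then obtain a where a: "a \<in> {1..c}" "C = layer a" unfolding minimal_cycles_eq by blast
        obtain k where k: "k \<in> {1..p}" "f (red a k) = 0" "\<forall>b\<in>{1..p}. b \<noteq> k \<longrightarrow> f (red a b) \<noteq> 0"
          using bspec[OF R a(1)] by blast
        show "\<exists>!e. e \<in> C \<and> f e = 0"
          by (rule ex1I[of _ "red a k"]) (use k a(2) in \<open>auto simp: layer_def\<close>)
      qed
      show ?L2
      proof
        fix v assume "v \<in> internal_verts G"
        then obtain a b where v: "v = (a, b)" "a \<in> {1..c}" "b \<in> {1..p}" unfolding internal_verts_eq by blast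
        obtain k where k: "f (red a k) = 0" "\<forall>b\<in>{1..p}. b \<noteq> k \<longrightarrow> f (red a b) \<noteq> 0"
          "\<forall>b\<in>{1..p}. netflow G f (a, b) = (if b = k then 0 else 1)"
          using bspec[OF R v(2)] by blast
        have "f (red a b) = 0 \<longleftrightarrow> b = k" using k v(3) by blast
        then show "netflow G f v = (if v \<in> zero_tails G f then 0 else 1)"
          unfolding v(1) zt[OF v(2,3)] using k(3) v(3) by simp
      qed
    qed
  qed
  show ?thesis
    unfolding cyclic_integer_flows_0_def cyclic_integer_flows_def mem_Collect_eq src layers[symmetric]
    by (intro iffI; elim conjE; intro conjI; assumption)
qed

text \<open>
  For integers with sum 1 arranged on a cycle there is exactly one rotation with positive
  partial sums, namely the one starting after the last minimum of the partial sums. Hence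
  in each layer the red part of a cyclic flow is determined by the blue part.
\<close>

lemma cyclic_flows_last_min:
  "f \<in> cyclic_integer_flows_0 G \<longleftrightarrow>
    (\<forall>e. e \<notin> arcs G \<longrightarrow> f e = 0) \<and> (\<forall>a\<le>c. \<forall>b\<in>{1..p}. 0 \<le> f (blue a b)) \<and> (\<forall>b\<in>{1..p}. f (blue 0 b) = 0) \<and>
    (\<forall>a\<in>{1..c}. psum f a p = 1 \<and> (\<exists>k. last_min (psum f a) k \<and>
      (\<forall>b\<in>{1..p}. f (red a b) = psum f a b - psum f a k + (if b < k then 1 else 0))))"
proof -
  have arcs: "(\<forall>e\<in>arcs G. 0 \<le> f e) \<longleftrightarrow> (\<forall>a\<le>c. \<forall>b\<in>{1..p}. 0 \<le> f (blue a b)) \<and>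
      (\<forall>a\<in>{1..c}. \<forall>b\<in>{1..p}. 0 \<le> f (red a b))"
  proof (intro iffI conjI allI impI ballI)
    fix e assume "(\<forall>a\<le>c. \<forall>b\<in>{1..p}. 0 \<le> f (blue a b)) \<and> (\<forall>a\<in>{1..c}. \<forall>b\<in>{1..p}. 0 \<le> f (red a b))"
      and "e \<in> arcs G"
    then show "0 \<le> f e" unfolding arcs_iff by (elim disjE conjE exE) simp_all
  next
    fix a b assume "\<forall>e\<in>arcs G. 0 \<le> f e" "a \<le> c" "b \<in> {1..p}"
    then show "0 \<le> f (blue a b)" using blue_arc by blast
  next
    fix a b assume "\<forall>e\<in>arcs G. 0 \<le> f e" "a \<in> {1..c}" "b \<in> {1..p}"
    then show "0 \<le> f (red a b)" using red_arc by blast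
  qed
  have layer: "(\<forall>b\<in>{1..p}. 0 \<le> f (red a b)) \<and>
      (\<exists>k\<in>{1..p}. f (red a k) = 0 \<and> (\<forall>b\<in>{1..p}. b \<noteq> k \<longrightarrow> f (red a b) \<noteq> 0) \<and>
        (\<forall>b\<in>{1..p}. netflow G f (a, b) = (if b = k then 0 else 1))) \<longleftrightarrow>
      psum f a p = 1 \<and> (\<exists>k. last_min (psum f a) k \<and>
        (\<forall>b\<in>{1..p}. f (red a b) = psum f a b - psum f a k + (if b < k then 1 else 0)))"
    if a: "a \<in> {1..c}" for a
  proof -
    \<comment> \<open>For \<open>b < k\<close> the summand 1 makes positivity over the integers
      equivalent to the weak inequality \<open>psum f a k \<le> psum f a b\<close>; for
      \<open>k < b\<close> there is no such summand and the inequality is strict.\<close>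
    have sign: "(\<forall>b\<in>{1..p}. 0 \<le> f (red a b)) \<and> (\<forall>b\<in>{1..p}. b \<noteq> k \<longrightarrow> f (red a b) \<noteq> 0)
        \<longleftrightarrow> last_min (psum f a) k"
      if k: "k \<in> {1..p}"
        and eq: "\<forall>b\<in>{1..p}. f (red a b) = psum f a b - psum f a k + (if b < k then 1 else 0)" for k
    proof -
      have "0 \<le> f (red a b) \<and> (b \<noteq> k \<longrightarrow> f (red a b) \<noteq> 0) \<longleftrightarrow>
          (b < k \<longrightarrow> psum f a k \<le> psum f a b) \<and> (k < b \<longrightarrow> psum f a k < psum f a b)"
        if "b \<in> {1..p}" for b
        using bspec[OF eq that] by (cases b k rule: linorder_cases) auto
      then show ?thesis using k unfolding last_min_def by blast
    qed
    show ?thesis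
    proof
      assume L: "(\<forall>b\<in>{1..p}. 0 \<le> f (red a b)) \<and>
        (\<exists>k\<in>{1..p}. f (red a k) = 0 \<and> (\<forall>b\<in>{1..p}. b \<noteq> k \<longrightarrow> f (red a b) \<noteq> 0) \<and>
          (\<forall>b\<in>{1..p}. netflow G f (a, b) = (if b = k then 0 else 1)))"
      then obtain k where k: "k \<in> {1..p}" "\<forall>b\<in>{1..p}. b \<noteq> k \<longrightarrow> f (red a b) \<noteq> 0"
        "f (red a k) = 0 \<and> (\<forall>b\<in>{1..p}. netflow G f (a, b) = (if b = k then 0 else 1))" by blast
      note R = iffD1[OF layer_flow_iff[OF a k(1)] k(3)]
      have "last_min (psum f a) k" using sign[OF k(1) conjunct2[OF R]] L k(2) by blast
      then show "psum f a p = 1 \<and> (\<exists>k. last_min (psum f a) k \<and>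
          (\<forall>b\<in>{1..p}. f (red a b) = psum f a b - psum f a k + (if b < k then 1 else 0)))"
        using R by blast
    next
      assume "psum f a p = 1 \<and> (\<exists>k. last_min (psum f a) k \<and>
        (\<forall>b\<in>{1..p}. f (red a b) = psum f a b - psum f a k + (if b < k then 1 else 0)))"
      then obtain k where R: "psum f a p = 1 \<and>
          (\<forall>b\<in>{1..p}. f (red a b) = psum f a b - psum f a k + (if b < k then 1 else 0))"
        and lm: "last_min (psum f a) k" by blast
      have k: "k \<in> {1..p}" using lm by (simp add: last_min_def)
      note L = iffD2[OF layer_flow_iff[OF a k] R]
      show "(\<forall>b\<in>{1..p}. 0 \<le> f (red a b)) \<and>
        (\<exists>k\<in>{1..p}. f (red a k) = 0 \<and> (\<forall>b\<in>{1..p}. b \<noteq> k \<longrightarrow> f (red a b) \<noteq> 0) \<and>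
          (\<forall>b\<in>{1..p}. netflow G f (a, b) = (if b = k then 0 else 1)))"
        using sign[OF k conjunct2[OF R]] lm L k by blast
    qed
  qed
  have layers: "(\<forall>a\<in>{1..c}. \<forall>b\<in>{1..p}. 0 \<le> f (red a b)) \<and>
      (\<forall>a\<in>{1..c}. \<exists>k\<in>{1..p}. f (red a k) = 0 \<and> (\<forall>b\<in>{1..p}. b \<noteq> k \<longrightarrow> f (red a b) \<noteq> 0) \<and>
        (\<forall>b\<in>{1..p}. netflow G f (a, b) = (if b = k then 0 else 1))) \<longleftrightarrow>
      (\<forall>a\<in>{1..c}. psum f a p = 1 \<and> (\<exists>k. last_min (psum f a) k \<and>
        (\<forall>b\<in>{1..p}. f (red a b) = psum f a b - psum f a k + (if b < k then 1 else 0))))"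
    unfolding ball_conj_distrib[of "{1..c}" "\<lambda>a. \<forall>b\<in>{1..p}. 0 \<le> f (red a b)", symmetric]
    by (rule ball_cong[OF refl layer])
  show ?thesis unfolding cyclic_flows_iff arcs layers[symmetric]
    by (intro iffI; elim conjE; intro conjI; assumption)
qed

section \<open>Encoding by the blue flow\<close>

definition encode :: "((nat \<times> nat) \<times> (nat \<times> nat) \<Rightarrow> int) \<Rightarrow> nat \<Rightarrow> nat list" where
  "encode f = (\<lambda>a\<in>{1..c}. map (\<lambda>b. nat (f (blue a (b + 1)))) [0..<p])"

text \<open>Netflow 1 at all but one of the \<open>p\<close> vertices of a layer adds
  \<open>p - 1\<close> to the blue total, starting from 0.\<close>

definition blue_parts :: "(nat \<Rightarrow> nat list) set" where
  "blue_parts = (\<Pi>\<^sub>E a\<in>{1..c}. {l. length l = p \<and> sum_list l = a * (p - 1)})"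

definition decode_blue :: "(nat \<Rightarrow> nat list) \<Rightarrow> nat \<Rightarrow> nat \<Rightarrow> int" where
  "decode_blue w a b = (if a = 0 then 0 else int (w a ! (b - 1)))"

text \<open>Expressed through the lists alone, so that \<open>decode\<close> can refer to it; on the
  decoded flow it agrees with \<open>psum\<close>.\<close>

definition decode_psum :: "(nat \<Rightarrow> nat list) \<Rightarrow> nat \<Rightarrow> nat \<Rightarrow> int" where
  "decode_psum w a b = (\<Sum>i\<in>{1..b}. decode_blue w (a - 1) i - decode_blue w a i + 1)"

definition decode :: "(nat \<Rightarrow> nat list) \<Rightarrow> (nat \<times> nat) \<times> (nat \<times> nat) \<Rightarrow> int" where
  "decode w e = (if e \<notin> arcs G then 0
     else let a = fst (fst e); b = snd (fst e); k = (SOME k. last_min (decode_psum w a) k) in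
       if fst (snd e) \<noteq> a then decode_blue w a b
       else decode_psum w a b - decode_psum w a k + (if b < k then 1 else 0))"

lemma decode_blue_arc: "a \<le> c \<Longrightarrow> b \<in> {1..p} \<Longrightarrow> decode w (blue a b) = decode_blue w a b"
  by (simp add: decode_def) (simp add: blue_def)

lemma decode_red_arc: "a \<in> {1..c} \<Longrightarrow> b \<in> {1..p} \<Longrightarrow> decode w (red a b) =
    decode_psum w a b - decode_psum w a (SOME k. last_min (decode_psum w a) k) +
    (if b < (SOME k. last_min (decode_psum w a) k) then 1 else 0)"
  by (simp add: decode_def) (simp add: red_def Let_def)

lemma sum_shift: "(\<Sum>b\<in>{0..<p}. h (b + 1)) = (\<Sum>b\<in>{1..p}. h b)"
  by (rule sum.reindex_bij_witness[of _ "\<lambda>b. b - 1" "\<lambda>b. b + 1"]) auto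

lemma psum_total:
  "psum f a p = (\<Sum>b\<in>{1..p}. f (blue (a - 1) b)) - (\<Sum>b\<in>{1..p}. f (blue a b)) + int p"
  by (simp add: psum_def sum.distrib sum_subtractf)

lemma encode_in: 
  assumes f: "f \<in> cyclic_integer_flows_0 G" shows "encode f \<in> blue_parts"
proof -
  have F: "\<forall>a\<le>c. \<forall>b\<in>{1..p}. 0 \<le> f (blue a b)" "\<forall>b\<in>{1..p}. f (blue 0 b) = 0" "\<forall>a\<in>{1..c}. psum f a p = 1"
    using f unfolding cyclic_flows_last_min by blast+
  have sums: "(\<Sum>b\<in>{1..p}. f (blue a b)) = int (a * (p - 1))" if "a \<le> c" for a
    using that
  proof (induction a)
    case 0
    then show ?case using F(2) by simp
  next
    case (Suc a)
    then have "psum f (Suc a) p = 1" using F(3) by simp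
    then have "(\<Sum>b\<in>{1..p}. f (blue a b)) - (\<Sum>b\<in>{1..p}. f (blue (Suc a) b)) + int p = 1"
      unfolding psum_total by simp
    moreover have "int (Suc a * (p - 1)) = int (a * (p - 1)) + int p - 1"
      using p by (simp add: of_nat_diff)
    ultimately show ?case using Suc.IH Suc.prems by linarith
  qed
  have "sum_list (map (\<lambda>b. nat (f (blue a (b + 1)))) [0..<p]) = a * (p - 1)" if a: "a \<in> {1..c}" for a
  proof -
    have "int (sum_list (map (\<lambda>b. nat (f (blue a (b + 1)))) [0..<p])) = (\<Sum>b\<in>{0..<p}. int (nat (f (blue a (b + 1)))))"
      by (simp add: interv_sum_list_conv_sum_set_nat)
    also have "\<dots> = (\<Sum>b\<in>{1..p}. int (nat (f (blue a b))))" by (rule sum_shift)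
    also have "\<dots> = (\<Sum>b\<in>{1..p}. f (blue a b))" using F(1) a by (intro sum.cong) auto
    also have "\<dots> = int (a * (p - 1))" using a by (intro sums) simp
    finally show ?thesis by (simp only: of_nat_eq_iff)
  qed
  then show ?thesis unfolding encode_def blue_parts_def by (intro restrict_PiE_iff[THEN iffD2] ballI) simp
qed

text \<open>Equal blue parts give equal partial sums, hence the same unique last minimizer and the
  same red flow.\<close>

lemma encode_inj: "inj_on encode (cyclic_integer_flows_0 G)"
proof (rule inj_onI)
  fix f g assume f: "f \<in> cyclic_integer_flows_0 G" and g: "g \<in> cyclic_integer_flows_0 G"
    and eq: "encode f = encode g"
  have F: "\<forall>e. e \<notin> arcs G \<longrightarrow> f e = 0" "\<forall>a\<le>c. \<forall>b\<in>{1..p}. 0 \<le> f (blue a b)" "\<forall>b\<in>{1..p}. f (blue 0 b) = 0"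
    "\<forall>a\<in>{1..c}. \<exists>k. last_min (psum f a) k \<and>
      (\<forall>b\<in>{1..p}. f (red a b) = psum f a b - psum f a k + (if b < k then 1 else 0))"
    using f unfolding cyclic_flows_last_min by blast+
  have H: "\<forall>e. e \<notin> arcs G \<longrightarrow> g e = 0" "\<forall>a\<le>c. \<forall>b\<in>{1..p}. 0 \<le> g (blue a b)" "\<forall>b\<in>{1..p}. g (blue 0 b) = 0"
    "\<forall>a\<in>{1..c}. \<exists>k. last_min (psum g a) k \<and>
      (\<forall>b\<in>{1..p}. g (red a b) = psum g a b - psum g a k + (if b < k then 1 else 0))"
    using g unfolding cyclic_flows_last_min by blast+
  have bl: "f (blue a b) = g (blue a b)" if a: "a \<le> c" and b: "b \<in> {1..p}" for a b
  proof (cases "a = 0")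
    case True
    then show ?thesis using F(3) H(3) b by simp
  next
    case False
    then have "map (\<lambda>b. nat (f (blue a (b + 1)))) [0..<p] = map (\<lambda>b. nat (g (blue a (b + 1)))) [0..<p]"
      using fun_cong[OF eq, of a] a by (simp add: encode_def)
    then have "\<forall>i\<in>{0..<p}. nat (f (blue a (i + 1))) = nat (g (blue a (i + 1)))"
      unfolding map_eq_conv set_upt .
    moreover have "b - 1 \<in> {0..<p}" "b - 1 + 1 = b" using b by auto
    ultimately have "nat (f (blue a b)) = nat (g (blue a b))" by metis
    then show ?thesis using F(2) H(2) a b by (metis eq_nat_nat_iff)
  qed
  have ps: "psum f a b = psum g a b" if "a \<in> {1..c}" "b \<in> {1..p}" for a b
    unfolding psum_def using that by (intro sum.cong) (auto simp: bl)
  show "f = g"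
  proof
    fix e
    consider "e \<notin> arcs G" | a b where "e = blue a b" "a \<le> c" "b \<in> {1..p}"
      | a b where "e = red a b" "a \<in> {1..c}" "b \<in> {1..p}"
      unfolding arcs_iff by blast
    then show "f e = g e"
    proof cases
      case 1
      have "f e = 0" "g e = 0" using F(1) H(1) 1 by blast+
      then show ?thesis by simp
    next
      case 2
      then show ?thesis using bl by simp
    next
      case 3
      obtain k where k: "last_min (psum f a) k"
        "f (red a b) = psum f a b - psum f a k + (if b < k then 1 else 0)" using F(4) 3 by blast
      obtain l where l: "last_min (psum g a) l"
        "g (red a b) = psum g a b - psum g a l + (if b < l then 1 else 0)" using H(4) 3 by blast
      have "last_min (psum f a) l" using l(1) ps[OF 3(2)] unfolding last_min_def by metis
      then have "k = l" using last_min_unique[OF k(1)] by blast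
      moreover have "l \<in> {1..p}" using l(1) by (simp add: last_min_def)
      ultimately show ?thesis using k(2) l(2) ps[OF 3(2)] 3 by simp
    qed
  qed
qed

text \<open>Prescribed layer totals make the partial sums end in 1, and a last minimizer always
  exists, so the red part can be filled in.\<close>

lemma encode_surj:
  assumes w: "w \<in> blue_parts"
  shows "decode w \<in> cyclic_integer_flows_0 G" "encode (decode w) = w"
proof -
  have wa: "length (w a) = p" "sum_list (w a) = a * (p - 1)" if "a \<in> {1..c}" for a
    using PiE_mem[OF w[unfolded blue_parts_def] that] by simp_all
  have sums: "(\<Sum>b\<in>{1..p}. decode_blue w a b) = int (a * (p - 1))" if "a \<le> c" for a
  proof (cases "a = 0")
    case False
    then have a: "a \<in> {1..c}" using that by simp
    have "(\<Sum>b\<in>{1..p}. decode_blue w a b) = (\<Sum>b\<in>{0..<p}. decode_blue w a (b + 1))"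
      by (rule sum_shift[symmetric])
    also have "\<dots> = int (\<Sum>b\<in>{0..<p}. w a ! b)" using False by (simp add: decode_blue_def)
    also have "(\<Sum>b\<in>{0..<p}. w a ! b) = sum_list (w a)" using wa(1)[OF a] by (simp add: sum_list_sum_nth)
    finally show ?thesis using wa(2)[OF a] by simp
  qed (simp add: decode_blue_def)
  have ps: "psum (decode w) a b = decode_psum w a b" if "a \<in> {1..c}" "b \<in> {1..p}" for a b
    unfolding psum_def decode_psum_def using that by (intro sum.cong) (auto simp: decode_blue_arc)
  have total: "psum (decode w) a p = 1" if a: "a \<in> {1..c}" for a
  proof -
    have sum_blue: "(\<Sum>b\<in>{1..p}. decode w (blue a' b)) = int (a' * (p - 1))" if "a' \<le> c" for a'
      using that by (subst sums[OF that, symmetric]) (intro sum.cong decode_blue_arc, auto)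
    have "a \<le> c" "a - 1 \<le> c" using a by auto
    then have "psum (decode w) a p = int ((a - 1) * (p - 1)) - int (a * (p - 1)) + int p"
      unfolding psum_total by (simp only: sum_blue)
    moreover obtain a' where "a = Suc a'" using a by (cases a) auto
    then have "int (a * (p - 1)) = int ((a - 1) * (p - 1)) + int p - 1"
      using p by (simp add: of_nat_diff)
    ultimately show ?thesis by linarith
  qed
  have red: "\<exists>k. last_min (psum (decode w) a) k \<and> (\<forall>b\<in>{1..p}.
      decode w (red a b) = psum (decode w) a b - psum (decode w) a k + (if b < k then 1 else 0))"
    if a: "a \<in> {1..c}" for a
  proof -
    let ?k = "SOME k. last_min (decode_psum w a) k"
    have k: "last_min (decode_psum w a) ?k" using last_min_exists by (rule someI_ex)
    then have kp: "?k \<in> {1..p}" by (simp add: last_min_def)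
    have "last_min (psum (decode w) a) l \<longleftrightarrow> last_min (decode_psum w a) l" for l
      unfolding last_min_def by (intro conj_cong refl ball_cong) (simp_all add: ps[OF a])
    then have "last_min (psum (decode w) a) ?k" using k by blast
    moreover have "\<forall>b\<in>{1..p}. decode w (red a b)
        = psum (decode w) a b - psum (decode w) a ?k + (if b < ?k then 1 else 0)"
      by (intro ballI) (simp only: decode_red_arc[OF a] ps[OF a] ps[OF a kp])
    ultimately show ?thesis by blast
  qed
  have outside: "decode w e = 0" if "e \<notin> arcs G" for e using that by (simp add: decode_def)
  have nonneg: "0 \<le> decode w (blue a b)" if "a \<le> c" "b \<in> {1..p}" for a b
    using that by (simp add: decode_blue_arc decode_blue_def)
  have source: "decode w (blue 0 b) = 0" if "b \<in> {1..p}" for b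
    using that by (simp add: decode_blue_arc decode_blue_def)
  show "decode w \<in> cyclic_integer_flows_0 G"
    unfolding cyclic_flows_last_min
    by (intro conjI allI ballI impI) (rule outside nonneg source total red; assumption)+
  have "encode (decode w) \<in> extensional {1..c}" by (simp add: encode_def)
  moreover have "w \<in> extensional {1..c}" using w by (simp add: blue_parts_def PiE_def)
  moreover have "encode (decode w) a = w a" if a: "a \<in> {1..c}" for a
  proof (rule nth_equalityI)
    show "length (encode (decode w) a) = length (w a)" using wa[OF a] a by (simp add: encode_def)
    fix i assume "i < length (encode (decode w) a)"
    then have "i < p" using a by (simp add: encode_def)
    then show "encode (decode w) a ! i = w a ! i"
      using a by (simp add: encode_def decode_blue_arc decode_blue_def)
  qed
  ultimately show "encode (decode w) = w" by (rule extensionalityI)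
qed

text \<open>The layers are chosen independently; layer \<open>a\<close> contributes the number of
  lists of length \<open>p\<close> with sum \<open>a * (p - 1)\<close>, which is a binomial
  coefficient.\<close>

lemma card_cyclic_flows: "card (cyclic_integer_flows_0 G) * fact (p - 1) ^ (c + 1) = fact ((c + 1) * (p - 1))"
proof -
  have "encode ` cyclic_integer_flows_0 G = blue_parts"
    using encode_in encode_surj by (auto intro!: equalityI) (metis imageI)
  then have "card (cyclic_integer_flows_0 G) = card blue_parts"
    using card_image[OF encode_inj] by simp
  also have "\<dots> = (\<Prod>a\<in>{1..c}. (a * (p - 1) + (p - 1)) choose (a * (p - 1)))"
    unfolding blue_parts_def using p by (simp add: card_PiE card_length_sum_list)
  finally show ?thesis using prod_binomial_multiples[of "p - 1" c] by simp
qed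

end

section \<open>Comparison of volume and count\<close>

context nested
begin

lemma multinomial_eq_card: "multinomial (replicate (c + 1) (p - 1)) = card (cyclic_integer_flows_0 G)"
proof -
  have "multinomial (replicate (c + 1) (p - 1)) = fact ((c + 1) * (p - 1)) div fact (p - 1) ^ (c + 1)"
    by (simp only: multinomial_def sum_list_replicate map_replicate prod_list_replicate of_nat_id)
  then show ?thesis unfolding card_cyclic_flows[symmetric] by simp
qed

lemma normalized_volume_eq_card:
  "normalized_volume (flow_complex G) = real (card (cyclic_integer_flows_0 G))"
proof -
  have "real (card (cyclic_integer_flows_0 G)) * fact (p - 1) ^ (c + 1) = fact N"
    using arg_cong[OF card_cyclic_flows, of real] by (simp add: N_def)
  then show ?thesis unfolding normalized_volume_flow_complex by (simp add: field_simps)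
qed

end

theorem theorem8p3:
  fixes c p :: nat
  assumes "c \<ge> 1" and "p \<ge> 1"
  shows "normalized_volume (flow_complex (nested_cycles c p))
           = real (card (cyclic_integer_flows_0 (nested_cycles c p))) \<and>
         card (cyclic_integer_flows_0 (nested_cycles c p))
           = multinomial (replicate (c + 1) (p - 1)) \<and>
         normalized_volume (flow_complex (nested_cycles 1 p)) = real ((2 * p - 2) choose (p - 1)) \<and>
         normalized_volume (flow_complex (nested_cycles c 2)) = fact (c + 1)"
proof -
  interpret general: nested c p using assms by unfold_locales
  interpret one_cycle: nested 1 p using assms by unfold_locales auto
  interpret two_cycles: nested c 2 using assms by unfold_locales auto
  have "one_cycle.N = 2 * p - 2" unfolding one_cycle.N_def by simp
  then have "normalized_volume (flow_complex (nested_cycles 1 p)) = fact (2 * p - 2) / (fact (p - 1) * fact (p - 1))"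
    unfolding one_cycle.normalized_volume_flow_complex by (simp only: power_add power_one_right)
  also have "\<dots> = real ((2 * p - 2) choose (p - 1))"
  proof -
    have "2 * p - 2 - (p - 1) = p - 1" "p - 1 \<le> 2 * p - 2" using assms(2) by auto
    then show ?thesis using binomial_fact[of "p - 1" "2 * p - 2", where ?'a = real] by simp
  qed
  finally have "normalized_volume (flow_complex (nested_cycles 1 p)) = real ((2 * p - 2) choose (p - 1))" .
  moreover have "normalized_volume (flow_complex (nested_cycles c 2)) = fact (c + 1)"
    unfolding two_cycles.normalized_volume_flow_complex two_cycles.N_def by simp
  ultimately show ?thesis
    using general.normalized_volume_eq_card general.multinomial_eq_card by simp
qed

end
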